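(* Let $l\ge3$. Identify $\mathbb CQ\otimes\mathcal B^{\otimes\tilde I}$ with $\mathcal B=\bigoplus_{\lambda\in\Pi}\mathbb Cb_\lambda$ by means of the bijection $CQ:\Pi\to Q\times\Pi^{\tilde I}$ (taking $l$-core and $l$-quotient). Then the action of $\hat{\mathfrak{sl}}_l$ on $\mathcal B$ obtained by the Frenkel-Kac construction from the $\mathcal H_{l-1}$-module $\mathcal B^{\otimes\tilde I}$ is given as follows, for $i\in\mathbb Z/l\mathbb Z$ and $\lambda\in\Pi$: (1) $\hat e_ib_\lambda=(-1)^{v_i(\lambda)+v_{i+1}(\lambda)}\sum_\mu(-1)^{\eta^-(\lambda,i,\lambda\setminus\mu)}b_\mu$, where the summation runs over all $\mu$ obtained from $\lambda$ by removing a removable $i$-node; (2) $\hat f_ib_\lambda=(-1)^{v_{i-1}(\lambda)+v_i(\lambda)}\sum_\mu(-1)^{\eta^-(\lambda,i,\mu\setminus\lambda)}b_\mu$, where the summation runs over all $\mu$ obtained from $\lambda$ by adding an addable $i$-node; (3) $\hat h_ib_\lambda=(|A_{\lambda,i}|-|R_{\lambda,i}|)\,b_\lambda$.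
   Context: $I=\mathbb Z/l\mathbb Z$, $\tilde I=\{\frac12,\frac32,\dots,l-\frac12\}$, $Q=\{c\in\mathbb Z^{\tilde I}:\sum c_k=0\}$. **Young diagrams.** $\Pi$ is the set of Young diagrams, regarded as subsets $\lambda\subset(\mathbb Z_{\ge0})^2$. The content of a node $(a,b)$ is $a-b$; it is an $i$-node if $a-b\equiv i$ mod $l$. $n_j(\lambda)$ is the number of nodes of $\lambda$ of content $j$, $v_i(\lambda)$ the number of $i$-nodes. $A_{\lambda,i}$ (resp. $R_{\lambda,i}$) is the set of addable (resp. removable) $i$-nodes of $\lambda$. For an addable or removable node $X$, $\eta^-(\lambda,i,X)$ is the number of addable $i$-nodes minus the number of removable $i$-nodes of $\lambda$ to the left of $X$, i.e. of content smaller than that of $X$. **Cores and quotients.** A Maya diagram is a map $\mathbf m:\mathbb Z+\frac12\to\{\pm1\}$ with $\mathbf m(h)=1$ for $h\gg0$, $-1$ for $h\ll0$; its charge is $c(\mathbf m)=\#\{h>0:\mathbf m(h)=-1\}-\#\{h<0:\mathbf m(h)=1\}$; $\mathbf m^{(c)}(h)=\mathbf m(h+c)$. For $\lambda\in\Pi$, with $d=n_{k-1/2}(\lambda)-n_{k+1/2}(\lambda)$: for $k<0$, $\mathbf m_\lambda(k)=1$ if $d=-1$, $-1$ if $d=0$; for $k>0$, $\mathbf m_\lambda(k)=1$ if $d=0$, $-1$ if $d=1$. The map $F:(c,\lambda)\mapsto\mathbf m_\lambda^{(-c)}$ is a bijection from $\mathbb Z\times\Pi$ to Maya diagrams; write $F^{-1}(\mathbf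 m)=(c(\mathbf m),q(\mathbf m))$. For $k\in\tilde I$: $\mathbf m_{\lambda,k}(h)=\mathbf m_\lambda(l(h-\frac12)+k)$, $c_k(\lambda)=c(\mathbf m_{\lambda,k})$, $q_k(\lambda)=q(\mathbf m_{\lambda,k})$. $CQ(\lambda)=((c_k(\lambda))_k,(q_k(\lambda))_k)$ is a bijection $\Pi\to Q\times\Pi^{\tilde I}$. **Heisenberg module.** $\mathcal H_{l-1}$ is the algebra generated by $p_i(m)$ ($1\le i\le l-1$, $m\in\mathbb Z\setminus\{0\}$) and a central element $c$ with $[p_i(m),p_j(n)]=m\,\delta_{m+n,0}\,a_{ij}c$, $(a_{ij})$ the Cartan matrix of type $A_{l-1}$; level-1 means $c=1$. $\mathcal B=\bigoplus_\lambda\mathbb Cb_\lambda$ is identified with the ring of symmetric functions $\mathbb C[p_1,p_2,\dots]$ ($p_m$ the power sums), $b_\lambda$ being the Schur function $s_\lambda$. For $m>0$, $p(-m)\cdot f=mp_mf$ and $p(m)\cdot f=\partial f/\partial p_m$. On $\mathcal B^{\otimes\tilde I}$ put $p_i(m)=p(m)_{i-1/2}-p(m)_{i+1/2}$, $p(m)_k$ being the action of $p(m)$ on the $k$-th factor; this is a level-1 module. **Frenkel-Kac construction.** $\hat{\mathfrak{sl}}_l=\mathfrak{sl}_l\otimes\mathbb C[t^{\pm1}]\oplus\mathbb Cc\oplus\mathbb Cd$. $Q$ is identified with the root lattice of type $A_{l-1}$ by $\alpha_i\mapsto\mathbf e_{i-1/2}-\mathbf e_{i+1/2}$ ($1\le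 i\le l-1$), with its standard form. For a positive root $\alpha=\mathbf e_k-\mathbf e_{k'}$ ($k<k'$) let $e_\alpha=E_{k+1/2,k'+1/2}$, $f_\alpha=E_{k'+1/2,k+1/2}$ (matrix units), and $h_i=E_{ii}-E_{i+1,i+1}$. $\hat e_i,\hat f_i,\hat h_i$ ($i\in I$) are the Chevalley generators: $\hat e_i=e_{\alpha_i}\otimes1$, $\hat f_i=f_{\alpha_i}\otimes1$, $\hat h_i=h_i\otimes1$ for $1\le i\le l-1$, and $\hat e_0$ is the root vector of $-\sum_{i\ge1}\alpha_i$ tensored with $t$ (with $\hat f_0,\hat h_0$ the corresponding generators). For $\alpha=\sum n_i\alpha_i$ put $\alpha(m)=\sum n_ip_i(m)$ and, on $\mathbb CQ\otimes B$ with $B=\mathcal B^{\otimes\tilde I}$, $$X(\alpha,z)=\exp\Big(\sum_{m\ge1}\tfrac{z^m}m\alpha(-m)\Big)\exp\Big(-\sum_{m\ge1}\tfrac{z^{-m}}m\alpha(m)\Big)T_\alpha=\sum_{m\in\mathbb Z}X_m(\alpha)z^m,$$ $T_\alpha([\beta]\otimes b)=z^{\frac12(\alpha,\alpha)+(\alpha,\beta)}[\alpha+\beta]\otimes b$. Let $\varepsilon:Q\times Q\to\{\pm1\}$ be bimultiplicative with $\varepsilon(\alpha_i,\alpha_j)=-1$ if $j=i,i+1$ and $1$ otherwise. The Frenkel-Kac action on $\mathbb CQ\otimes B$ is: $(h_i\otimes1)([\beta]\otimes b)=\langle\alpha_i,\beta\rangle[\beta]\otimes b$; $(h_i\otimes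 t^m)([\beta]\otimes b)=[\beta]\otimes p_i(m)b$ ($m\ne0$); for each positive root $\alpha$, $(e_\alpha\otimes t^m)([\beta]\otimes b)=\varepsilon(\alpha,\beta)X_m(\alpha)([\beta]\otimes b)$ and $(f_\alpha\otimes t^m)([\beta]\otimes b)=\varepsilon(\beta,\alpha)X_{-m}(-\alpha)([\beta]\otimes b)$; $c=1$, $d=0$.
   Formalization: Corrected, since as printed [ê_0,f̂_0]b_∅ = -b_∅ ≠ ĥ_0 b_∅: prefactor of (1) is (-1)^{v_{i-1}(λ)+v_i(λ)+1}; e_α⊗t^m acts by ε(α,β)X_{-m}(α); f_α⊗t^m by -ε(-α,β)X_{-m}(-α); p_m is 1/m times the power sum. *)

theory Defs
  imports
    Complex_Main
    "HOL-Library.Poly_Mapping"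
    "Jordan_Normal_Form.Determinant"
begin

section \<open>Young diagrams\<close>

type_synonym diagram = "(nat \<times> nat) set"

definition young_diagrams :: "diagram set" where
  "young_diagrams =
     {lam. finite lam \<and> (\<forall>a b a' b'. (a, b) \<in> lam \<and> a' \<le> a \<and> b' \<le> b \<longrightarrow> (a', b') \<in> lam)}"

definition node_content :: "nat \<times> nat \<Rightarrow> int" where
  "node_content x = int (fst x) - int (snd x)"

definition is_node_of_residue :: "nat \<Rightarrow> int \<Rightarrow> nat \<times> nat \<Rightarrow> bool" where
  "is_node_of_residue l i x \<longleftrightarrow> node_content x mod int l = i mod int l"

definition content_count :: "int \<Rightarrow> diagram \<Rightarrow> int" where
  "content_count j lam = int (card {x \<in> lam. node_content x = j})"

definition residue_count :: "nat \<Rightarrow> int \<Rightarrow> diagram \<Rightarrow> nat" where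
  "residue_count l i lam = card {x \<in> lam. is_node_of_residue l i x}"

definition addable :: "nat \<Rightarrow> int \<Rightarrow> diagram \<Rightarrow> (nat \<times> nat) set" where
  "addable l i lam = {x. x \<notin> lam \<and> insert x lam \<in> young_diagrams \<and> is_node_of_residue l i x}"

definition removable :: "nat \<Rightarrow> int \<Rightarrow> diagram \<Rightarrow> (nat \<times> nat) set" where
  "removable l i lam = {x. x \<in> lam \<and> lam - {x} \<in> young_diagrams \<and> is_node_of_residue l i x}"

definition eta_minus :: "nat \<Rightarrow> int \<Rightarrow> diagram \<Rightarrow> nat \<times> nat \<Rightarrow> int" where
  "eta_minus l i lam x =
     int (card {y \<in> addable l i lam. node_content y < node_content x})
     - int (card {y \<in> removable l i lam. node_content y < node_content x})"


section \<open>Cores and quotients\<close>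

text \<open>
  A half-integer \<open>n + 1/2\<close> is encoded by the integer \<open>n\<close>; in particular the index set
  \<open>{1/2, 3/2, \<dots>, l - 1/2}\<close> becomes \<open>{0, \<dots>, l - 1}\<close>, the condition \<open>h > 0\<close> becomes \<open>n \<ge> 0\<close>, and
  \<open>n\<^bsub>k-1/2\<^esub> - n\<^bsub>k+1/2\<^esub>\<close> at \<open>k = n + 1/2\<close> involves the contents \<open>n\<close> and \<open>n + 1\<close>.
  Maya diagrams are maps to \<open>{1, -1}\<close> that are \<open>1\<close> far to the right and \<open>-1\<close> far to the left.
\<close>

type_synonym maya = "int \<Rightarrow> int"

definition charge :: "maya \<Rightarrow> int" where
  "charge m = int (card {n. n \<ge> 0 \<and> m n = -1}) - int (card {n. n < 0 \<and> m n = 1})"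

definition maya_shift :: "maya \<Rightarrow> int \<Rightarrow> maya" where
  "maya_shift m c = (\<lambda>n. m (n + c))"

definition maya_of :: "diagram \<Rightarrow> maya" where
  "maya_of lam n =
     (let d = content_count n lam - content_count (n + 1) lam
      in if n < 0 then (if d = -1 then 1 else -1) else (if d = 0 then 1 else -1))"

definition maya_of_charged :: "int \<times> diagram \<Rightarrow> maya" where
  "maya_of_charged = (\<lambda>(c, lam). maya_shift (maya_of lam) (- c))"

definition maya_diagram :: "maya \<Rightarrow> diagram" where
  "maya_diagram m = (THE lam. lam \<in> young_diagrams \<and> maya_of_charged (charge m, lam) = m)"

definition maya_component :: "nat \<Rightarrow> diagram \<Rightarrow> nat \<Rightarrow> maya" where
  "maya_component l lam k = (\<lambda>n. maya_of lam (int l * n + int k))"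

definition core_charges :: "nat \<Rightarrow> diagram \<Rightarrow> nat \<Rightarrow> int" where
  "core_charges l lam k = (if k < l then charge (maya_component l lam k) else 0)"

definition diagram_quotient :: "nat \<Rightarrow> diagram \<Rightarrow> nat \<Rightarrow> diagram" where
  "diagram_quotient l lam k = maya_diagram (maya_component l lam k)"


section \<open>The Fock space and its Heisenberg action\<close>

text \<open>
  The \<open>l\<close>-fold tensor power of \<open>\<complex>[p\<^sub>1, p\<^sub>2, \<dots>]\<close> is the polynomial ring in variables
  \<open>p\<^sub>m\<close> of the \<open>k\<close>-th factor, indexed by pairs \<open>(k, m)\<close> with \<open>k < l\<close> and \<open>m \<ge> 1\<close>.
\<close>

type_synonym fock = "((nat \<times> nat) \<Rightarrow>\<^sub>0 nat) \<Rightarrow>\<^sub>0 complex"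

definition fock_const :: "complex \<Rightarrow> fock" where
  "fock_const c = Poly_Mapping.single 0 c"

definition pvar :: "nat \<Rightarrow> nat \<Rightarrow> fock" where
  "pvar k m = Poly_Mapping.single (Poly_Mapping.single (k, m) 1) 1"

definition fock_deriv :: "nat \<Rightarrow> nat \<Rightarrow> fock \<Rightarrow> fock" where
  "fock_deriv k m f =
     (\<Sum>u\<in>Poly_Mapping.keys f.
        Poly_Mapping.single (u - Poly_Mapping.single (k, m) 1)
          (of_nat (Poly_Mapping.lookup u (k, m)) * Poly_Mapping.lookup f u))"

text \<open>The operator \<open>p(m)\<close>, \<open>m \<noteq> 0\<close>, on the \<open>k\<close>-th tensor factor.\<close>

definition heis_factor :: "nat \<Rightarrow> int \<Rightarrow> fock \<Rightarrow> fock" where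
  "heis_factor k m f =
     (if m < 0 then of_nat (nat (- m)) * pvar k (nat (- m)) * f else fock_deriv k (nat m) f)"

definition heis :: "nat \<Rightarrow> int \<Rightarrow> fock \<Rightarrow> fock" where
  "heis i m f = heis_factor (i - 1) m f - heis_factor i m f"

text \<open>
  For pairwise commuting operators \<open>A\<^sub>1, A\<^sub>2, \<dots>\<close>, this is the coefficient of \<open>z\<^sup>n\<close> in
  \<open>exp (\<Sum>\<^bsub>m\<ge>1\<^esub> A\<^sub>m z\<^sup>m) = \<Sum>\<^sub>j (\<Sum>\<^bsub>m\<ge>1\<^esub> A\<^sub>m z\<^sup>m)\<^sup>j / j!\<close>, applied to \<open>f\<close>.
\<close>

definition exp_coeff :: "(nat \<Rightarrow> fock \<Rightarrow> fock) \<Rightarrow> nat \<Rightarrow> fock \<Rightarrow> fock" where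
  "exp_coeff A n f =
     (\<Sum>ms\<in>{ms. sum_list ms = n \<and> 0 \<notin> set ms}. fock_const (1 / fact (length ms)) * foldr A ms f)"

text \<open>
  Complete symmetric and Schur functions in the \<open>k\<close>-th tensor factor. The action
  \<open>p(-m) f = m p\<^sub>m f\<close>, \<open>p(m) f = \<partial>f/\<partial>p\<^sub>m\<close> forces the normalisation
  \<open>m p\<^sub>m = x\<^sub>1\<^sup>m + x\<^sub>2\<^sup>m + \<dots>\<close> of the power sums: the generating function
  \<open>exp (\<Sum>\<^sub>m (\<Sum>\<^sub>j x\<^sub>j\<^sup>m) z\<^sup>m / m)\<close> of the complete symmetric functions is then
  \<open>exp (\<Sum>\<^sub>m p\<^sub>m z\<^sup>m)\<close>. Schur functions are given by the Jacobi-Trudi determinant; the node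
  \<open>(a, b)\<close> lies in column \<open>a\<close> and row \<open>b\<close>.
\<close>

definition complete_sym :: "nat \<Rightarrow> int \<Rightarrow> fock" where
  "complete_sym k n = (if n < 0 then 0 else exp_coeff (\<lambda>m f. pvar k m * f) (nat n) 1)"

definition row_length :: "diagram \<Rightarrow> nat \<Rightarrow> nat" where
  "row_length lam b = card {a. (a, b) \<in> lam}"

definition num_rows :: "diagram \<Rightarrow> nat" where
  "num_rows lam = card {b. (0, b) \<in> lam}"

definition schur :: "nat \<Rightarrow> diagram \<Rightarrow> fock" where
  "schur k lam =
     det (mat (num_rows lam) (num_rows lam)
       (\<lambda>(i, j). complete_sym k (int (row_length lam i) - int i + int j)))"


section \<open>Vertex operators\<close>

text \<open>
  An element of \<open>\<int>\<^sup>l\<close> is a function that vanishes outside \<open>{0, \<dots>, l - 1}\<close>; \<open>Q\<close> consists of those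
  with coordinate sum \<open>0\<close>. The sum of \<open>[\<beta>] \<otimes> f\<^sub>\<beta>\<close> is represented by the finitely supported map
  \<open>\<beta> \<mapsto> f\<^sub>\<beta>\<close>.
\<close>

type_synonym lattice_vec = "nat \<Rightarrow> int"

type_synonym fk_space = "lattice_vec \<Rightarrow>\<^sub>0 fock"

definition root_lattice :: "nat \<Rightarrow> lattice_vec set" where
  "root_lattice l = {beta. (\<forall>k\<ge>l. beta k = 0) \<and> (\<Sum>k<l. beta k) = 0}"

definition lattice_form :: "nat \<Rightarrow> lattice_vec \<Rightarrow> lattice_vec \<Rightarrow> int" where
  "lattice_form l alpha beta = (\<Sum>k<l. alpha k * beta k)"

definition root_vec :: "nat \<Rightarrow> nat \<Rightarrow> lattice_vec" where
  "root_vec k k' = (\<lambda>j. (if j = k then 1 else 0) - (if j = k' then 1 else 0))"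

abbreviation simple_root :: "nat \<Rightarrow> lattice_vec" where
  "simple_root i \<equiv> root_vec (i - 1) i"

text \<open>The coefficient \<open>n\<^sub>i\<close> in \<open>\<alpha> = \<Sum>\<^bsub>1\<le>i<l\<^esub> n\<^sub>i \<alpha>\<^sub>i\<close>, for \<open>\<alpha>\<close> in the root lattice.\<close>

definition root_coeff :: "lattice_vec \<Rightarrow> nat \<Rightarrow> int" where
  "root_coeff alpha i = (\<Sum>k<i. alpha k)"

definition cocycle :: "nat \<Rightarrow> lattice_vec \<Rightarrow> lattice_vec \<Rightarrow> complex" where
  "cocycle l alpha beta =
     (\<Prod>i\<in>{1..<l}. \<Prod>j\<in>{1..<l}.
        (if j = i \<or> j = i + 1 then -1 else 1) powi (root_coeff alpha i * root_coeff beta j))"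

lemma cocycle_add_left:
  "cocycle l (\<lambda>k. alpha k + alpha' k) beta = cocycle l alpha beta * cocycle l alpha' beta"
  unfolding cocycle_def root_coeff_def prod.distrib[symmetric]
  by (intro prod.cong refl) (simp add: sum.distrib ring_distribs power_int_add)

lemma cocycle_add_right:
  "cocycle l alpha (\<lambda>k. beta k + beta' k) = cocycle l alpha beta * cocycle l alpha beta'"
  unfolding cocycle_def root_coeff_def prod.distrib[symmetric]
  by (intro prod.cong refl) (simp add: sum.distrib ring_distribs power_int_add)

lemma root_coeff_simple_root:
  "1 \<le> i \<Longrightarrow> root_coeff (simple_root i) j = (if j = i then 1 else 0)"
  by (auto simp: root_coeff_def root_vec_def sum_subtractf)

lemma cocycle_simple_root:
  assumes "i \<in> {1..<l}" "j \<in> {1..<l}"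
  shows "cocycle l (simple_root i) (simple_root j) = (if j = i \<or> j = i + 1 then -1 else 1)"
proof -
  have rc: "root_coeff (simple_root i) j' = (if j' = i then 1 else 0)"
    "root_coeff (simple_root j) j' = (if j' = j then 1 else 0)" for j'
    using assms by (simp_all only: root_coeff_simple_root atLeastLessThan_iff)
  have "cocycle l (simple_root i) (simple_root j) =
      (\<Prod>i'\<in>{1..<l}. \<Prod>j'\<in>{1..<l}. if j' = j then (if i' = i then
         (if j = i \<or> j = i + 1 then -1 else 1) else 1) else 1)"
    unfolding cocycle_def using rc by (intro prod.cong refl) auto
  also have "\<dots> = (if j = i \<or> j = i + 1 then -1 else 1)"
    using assms by (simp add: prod.delta)
  finally show ?thesis .
qed

definition heis_root :: "nat \<Rightarrow> lattice_vec \<Rightarrow> int \<Rightarrow> fock \<Rightarrow> fock" where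
  "heis_root l alpha m f = (\<Sum>i\<in>{1..<l}. of_int (root_coeff alpha i) * heis i m f)"

definition creation_part :: "nat \<Rightarrow> lattice_vec \<Rightarrow> nat \<Rightarrow> fock \<Rightarrow> fock" where
  "creation_part l alpha =
     exp_coeff (\<lambda>m f. fock_const (1 / of_nat m) * heis_root l alpha (- int m) f)"

definition annihilation_part :: "nat \<Rightarrow> lattice_vec \<Rightarrow> nat \<Rightarrow> fock \<Rightarrow> fock" where
  "annihilation_part l alpha =
     exp_coeff (\<lambda>m f. fock_const (- 1 / of_nat m) * heis_root l alpha (int m) f)"

text \<open>
  \<open>X\<^sub>m(\<alpha>) ([\<beta>] \<otimes> f)\<close>, the coefficient of \<open>z\<^sup>m\<close>. The \<open>z\<close>-degree of a term is
  \<open>(\<alpha>,\<alpha>)/2 + (\<alpha>,\<beta>) + s - r\<close>, where \<open>r\<close> and \<open>s\<close> come from the annihilation and the creation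
  exponential; only finitely many \<open>r\<close> contribute.
\<close>

definition vertex_mode :: "nat \<Rightarrow> lattice_vec \<Rightarrow> int \<Rightarrow> lattice_vec \<Rightarrow> fock \<Rightarrow> fk_space" where
  "vertex_mode l alpha m beta f =
     (let e = lattice_form l alpha alpha div 2 + lattice_form l alpha beta
      in Poly_Mapping.single (\<lambda>k. alpha k + beta k)
           (\<Sum>r\<in>{r. annihilation_part l alpha r f \<noteq> 0 \<and> 0 \<le> m - e + int r}.
              creation_part l alpha (nat (m - e + int r)) (annihilation_part l alpha r f)))"

definition fk_scale :: "complex \<Rightarrow> fk_space \<Rightarrow> fk_space" where
  "fk_scale c w = Poly_Mapping.map (\<lambda>f. fock_const c * f) w"


section \<open>The affine Lie algebra\<close>

text \<open>
  An element \<open>\<Sum>\<^sub>m A\<^sub>m \<otimes> t\<^sup>m + a c + b d\<close>. Matrix indices start at \<open>0\<close>, so that the matrix unit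
  \<open>E\<^bsub>k+1/2,k'+1/2\<^esub>\<close> attached to the half-integers \<open>k, k'\<close> has the same indices as the vectors
  \<open>\<^bold>e\<^sub>k, \<^bold>e\<^bsub>k'\<^esub>\<close>.
\<close>

record affine =
  loop :: "int \<Rightarrow> complex mat"
  central :: complex
  degree_part :: complex

definition loop_support :: "nat \<Rightarrow> affine \<Rightarrow> int set" where
  "loop_support l x = {m. loop x m \<noteq> 0\<^sub>m l l}"

definition mat_trace :: "complex mat \<Rightarrow> complex" where
  "mat_trace A = (\<Sum>r<dim_row A. A $$ (r, r))"

definition affine_sl :: "nat \<Rightarrow> affine set" where
  "affine_sl l =
     {x. (\<forall>m. loop x m \<in> carrier_mat l l \<and> mat_trace (loop x m) = 0) \<and> finite (loop_support l x)}"

definition affine_bracket :: "nat \<Rightarrow> affine \<Rightarrow> affine \<Rightarrow> affine" where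
  "affine_bracket l x y =
     \<lparr>loop = (\<lambda>n. mat l l (\<lambda>(r, s).
        (\<Sum>m\<in>loop_support l x. (loop x m * loop y (n - m) - loop y (n - m) * loop x m) $$ (r, s))
        + degree_part x * of_int n * loop y n $$ (r, s)
        - degree_part y * of_int n * loop x n $$ (r, s))),
      central = (\<Sum>m\<in>loop_support l x. of_int m * mat_trace (loop x m * loop y (- m))),
      degree_part = 0\<rparr>"

definition unit_mat :: "nat \<Rightarrow> nat \<Rightarrow> nat \<Rightarrow> complex mat" where
  "unit_mat l r s = mat l l (\<lambda>(i, j). if i = r \<and> j = s then 1 else 0)"

definition loop_elem :: "nat \<Rightarrow> complex mat \<Rightarrow> int \<Rightarrow> complex \<Rightarrow> affine" where
  "loop_elem l A m a =
     \<lparr>loop = (\<lambda>n. if n = m then A else 0\<^sub>m l l), central = a, degree_part = 0\<rparr>"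

definition e_hat :: "nat \<Rightarrow> nat \<Rightarrow> affine" where
  "e_hat l i =
     (if i = 0 then loop_elem l (unit_mat l (l - 1) 0) 1 0
      else loop_elem l (unit_mat l (i - 1) i) 0 0)"

definition f_hat :: "nat \<Rightarrow> nat \<Rightarrow> affine" where
  "f_hat l i =
     (if i = 0 then loop_elem l (unit_mat l 0 (l - 1)) (-1) 0
      else loop_elem l (unit_mat l i (i - 1)) 0 0)"

definition h_hat :: "nat \<Rightarrow> nat \<Rightarrow> affine" where
  "h_hat l i =
     (if i = 0 then loop_elem l (unit_mat l (l - 1) (l - 1) - unit_mat l 0 0) 0 1
      else loop_elem l (unit_mat l (i - 1) (i - 1) - unit_mat l i i) 0 0)"

lemma chevalley_in_affine_sl:
  assumes "2 \<le> l" "i < l"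
  shows "e_hat l i \<in> affine_sl l" "f_hat l i \<in> affine_sl l" "h_hat l i \<in> affine_sl l"
proof -
  have fin: "finite (loop_support l (loop_elem l A m a))" for A m a
    by (rule finite_subset[of _ "{m}"]) (auto simp: loop_support_def loop_elem_def)
  show "e_hat l i \<in> affine_sl l" "f_hat l i \<in> affine_sl l" "h_hat l i \<in> affine_sl l"
    using assms fin
    by (auto simp: affine_sl_def e_hat_def f_hat_def h_hat_def loop_elem_def mat_trace_def
        unit_mat_def sum_subtractf intro!: sum.neutral)
qed

lemma unit_mat_mult:
  assumes "s < l" "r' < l"
  shows "unit_mat l r s * unit_mat l r' s' = (if s = r' then unit_mat l r s' else 0\<^sub>m l l)"
proof (rule eq_matI)
  fix i j
  assume "i < dim_row (if s = r' then unit_mat l r s' else 0\<^sub>m l l)"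
    and "j < dim_col (if s = r' then unit_mat l r s' else 0\<^sub>m l l)"
  then have ij: "i < l" "j < l"
    by (simp_all add: unit_mat_def split: if_splits)
  then have "(unit_mat l r s * unit_mat l r' s') $$ (i, j) =
      (\<Sum>t\<in>{0..<l}. (if i = r \<and> t = s then 1 else 0) * (if t = r' \<and> j = s' then 1 else 0))"
    by (simp add: unit_mat_def scalar_prod_def)
  also have "\<dots> =
      (\<Sum>t\<in>{0..<l}. if t = s then (if i = r \<and> s = r' \<and> j = s' then 1 else 0) else 0)"
    by (intro sum.cong refl) auto
  also have "\<dots> = (if i = r \<and> s = r' \<and> j = s' then 1 else 0)"
    using assms by simp
  finally show "(unit_mat l r s * unit_mat l r' s') $$ (i, j) =
      (if s = r' then unit_mat l r s' else 0\<^sub>m l l) $$ (i, j)"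
    using ij by (simp add: unit_mat_def)
qed (simp_all add: unit_mat_def)

lemma affine_bracket_loop_elem:
  assumes "A \<in> carrier_mat l l" "B \<in> carrier_mat l l" "A \<noteq> 0\<^sub>m l l"
  shows "affine_bracket l (loop_elem l A m a) (loop_elem l B n b) =
    loop_elem l (A * B - B * A) (m + n) (if m + n = 0 then of_int m * mat_trace (A * B) else 0)"
proof -
  have "loop_support l (loop_elem l A m a) = {m}"
    using assms by (auto simp: loop_support_def loop_elem_def)
  moreover have "mat_trace (0\<^sub>m l l) = 0"
    by (simp add: mat_trace_def)
  ultimately show ?thesis
    using assms
    by (auto simp: affine_bracket_def loop_elem_def fun_eq_iff add_eq_0_iff2 intro!: eq_matI)
qed

lemma bracket_e_hat_f_hat:
  assumes "2 \<le> l" "i < l"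
  shows "affine_bracket l (e_hat l i) (f_hat l i) = h_hat l i"
proof -
  have nz: "unit_mat l r s \<noteq> 0\<^sub>m l l" if "r < l" "s < l" for r s
  proof
    assume "unit_mat l r s = 0\<^sub>m l l"
    then have "unit_mat l r s $$ (r, s) = 0\<^sub>m l l $$ (r, s)" by simp
    then show False using that by (simp add: unit_mat_def)
  qed
  have car: "unit_mat l r s \<in> carrier_mat l l" for r s
    by (simp add: unit_mat_def)
  have tr: "mat_trace (unit_mat l r r) = 1" if "r < l" for r
    using that by (simp add: mat_trace_def unit_mat_def)
  show ?thesis
    using assms
    by (auto simp: e_hat_def f_hat_def h_hat_def affine_bracket_loop_elem car nz unit_mat_mult tr)
qed


section \<open>The Frenkel-Kac action\<close>

definition act_h :: "nat \<Rightarrow> nat \<Rightarrow> int \<Rightarrow> lattice_vec \<Rightarrow> fock \<Rightarrow> fk_space" where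
  "act_h l i m beta f =
     Poly_Mapping.single beta
       (if m = 0 then of_int (lattice_form l (simple_root i) beta) * f else heis i m f)"

text \<open>
  The operators \<open>e\<^sub>\<alpha> \<otimes> t\<^sup>m\<close> and \<open>f\<^sub>\<alpha> \<otimes> t\<^sup>m\<close> for a positive root \<open>\<alpha>\<close>. As \<open>X\<^sub>n\<close> raises the degree
  by \<open>n\<close> and \<open>h \<otimes> t\<^sup>m\<close> lowers it by \<open>m\<close>, both have to be modes of index \<open>-m\<close>. The root vector
  of \<open>-\<alpha>\<close> defined by the cocycle, \<open>\<epsilon>(-\<alpha>,\<beta>) X\<^bsub>-m\<^esub>(-\<alpha>)\<close>, is \<open>-f\<^sub>\<alpha> \<otimes> t\<^sup>m\<close>, because
  \<open>\<epsilon>(\<alpha>,-\<alpha>) = -1\<close>.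
\<close>

definition act_e :: "nat \<Rightarrow> lattice_vec \<Rightarrow> int \<Rightarrow> lattice_vec \<Rightarrow> fock \<Rightarrow> fk_space" where
  "act_e l alpha m beta f = fk_scale (cocycle l alpha beta) (vertex_mode l alpha (- m) beta f)"

definition act_f :: "nat \<Rightarrow> lattice_vec \<Rightarrow> int \<Rightarrow> lattice_vec \<Rightarrow> fock \<Rightarrow> fk_space" where
  "act_f l alpha m beta f =
     fk_scale (- cocycle l (\<lambda>k. - alpha k) beta) (vertex_mode l (\<lambda>k. - alpha k) (- m) beta f)"

text \<open>
  The linear extension: a traceless diagonal matrix \<open>D\<close> equals
  \<open>\<Sum>\<^bsub>1\<le>i<l\<^esub> (D\<^bsub>00\<^esub> + \<dots> + D\<^bsub>i-1,i-1\<^esub>) h\<^sub>i\<close>; the central element acts by \<open>1\<close> and \<open>d\<close> by \<open>0\<close>.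
\<close>

definition fk_action_homogeneous :: "nat \<Rightarrow> affine \<Rightarrow> lattice_vec \<Rightarrow> fock \<Rightarrow> fk_space" where
  "fk_action_homogeneous l x beta f =
     (\<Sum>m\<in>loop_support l x.
        (\<Sum>i\<in>{1..<l}. fk_scale (\<Sum>k<i. loop x m $$ (k, k)) (act_h l i m beta f))
        + (\<Sum>k'<l. \<Sum>k<k'.
             fk_scale (loop x m $$ (k, k')) (act_e l (root_vec k k') m beta f)
             + fk_scale (loop x m $$ (k', k)) (act_f l (root_vec k k') m beta f)))
     + fk_scale (central x) (Poly_Mapping.single beta f)"

definition fk_action :: "nat \<Rightarrow> affine \<Rightarrow> fk_space \<Rightarrow> fk_space" where
  "fk_action l x w =
     (\<Sum>beta\<in>Poly_Mapping.keys w. fk_action_homogeneous l x beta (Poly_Mapping.lookup w beta))"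

text \<open>The vector \<open>b\<^sub>\<lambda>\<close>, transported along the core and quotient bijection.\<close>

definition basis_vec :: "nat \<Rightarrow> diagram \<Rightarrow> fk_space" where
  "basis_vec l lam =
     Poly_Mapping.single (core_charges l lam) (\<Prod>k<l. schur k (diagram_quotient l lam k))"

end

theory Submission
  imports Defs "HOL-Computational_Algebra.Formal_Laurent_Series" "Jordan_Normal_Form.Char_Poly"
begin

text \<open>
  The boson-fermion correspondence: reading a Maya diagram as a set of particles (the positions
  with value \<open>-1\<close>), the half vertex operator \<open>exp (\<Sum> z\<^sup>m p\<^sub>m) exp (- \<Sum> z\<^bsup>-m\<^esup>/m \<partial>/\<partial>p\<^sub>m)\<close> acts on
  Schur functions by inserting a particle, and its inverse by removing one, with the sign given by
  the number of particles to the right. For determinants of complete symmetric functions this is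
  a computation with row and column operations, because the second exponential is the ring
  homomorphism \<open>h\<^sub>n \<mapsto> h\<^sub>n - h\<^bsub>n-1\<^esub>/z\<close> (respectively \<open>h\<^sub>n \<mapsto> \<Sum>\<^sub>r h\<^bsub>n-r\<^esub> z\<^bsup>-r\<^esup>\<close>). Hence \<open>X\<^sub>m(\<alpha>)\<close> moves
  particles between two of the \<open>l\<close> runners, and for the Chevalley generators the displacement on
  the full Maya diagram is by one position, which adds or removes a node. The signs agree because
  \<open>v\<^sub>i - v\<^bsub>i+1\<^esub> = c\<^sub>i\<close> expresses the cocycle through residue counts, while the charges of two
  neighbouring runners differ by the number of addable minus removable nodes.
\<close>

section \<open>Exponentials of commuting operators\<close>

text \<open>The creation exponential is a power series in z, while the annihilation exponential,
  applied to a fixed polynomial, is a polynomial in 1/z. They are multiplied as Laurent series, and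
  the annihilation part becomes a ring homomorphism into \<open>fock fls\<close>, so that it passes
  inside a determinant entry by entry. For the root e_k - e_k' the same homomorphism separates the
  tensor factors: creation on runner k, annihilation on runner k', and all other factors carried
  along as constants. The exponent (\<alpha>,\<alpha>)/2 + (\<alpha>,\<beta>) = 1 + c_k - c_k'
  converts Laurent degrees, which measure positions relative to the charges, into absolute
  positions, so mode m takes a particle from q to q + m. The resulting signs count to the right,
  whereas \<open>eta_minus\<close> counts to the left; the total needed to pass between them is the
  charge difference, a second difference of residue counts up to a correction at i = 0. Determinants
  of different sizes are compared by appending empty rows.\<close>

definition fock_linear :: "(fock \<Rightarrow> fock) \<Rightarrow> bool" where
  "fock_linear T \<longleftrightarrow> (\<forall>f g. T (f + g) = T f + T g) \<and> (\<forall>c f. T (fock_const c * f) = fock_const c * T f)"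

lemma fock_const_mult: "fock_const a * fock_const b = fock_const (a * b)"
  by (simp add: fock_const_def mult_single)

lemma fock_const_1 [simp]: "fock_const 1 = 1"
  by (simp add: fock_const_def)

lemma fock_const_0 [simp]: "fock_const 0 = 0"
  by (simp add: fock_const_def)

lemma fock_const_add: "fock_const (a + b) = fock_const a + fock_const b"
  by (simp add: fock_const_def single_add)

lemma fock_const_uminus: "fock_const (- a) = - fock_const a"
  by (simp add: fock_const_def single_uminus)

lemma fock_const_of_nat: "fock_const (of_nat n) = of_nat n"
  by (simp add: fock_const_def)

lemma fock_const_of_int: "fock_const (of_int n) = of_int n"
  by (simp add: fock_const_def)

text \<open>Positive integers are invertible constants of \<open>fock\<close>; this is why a
  recurrence for n * E_n determines E_n.\<close>

lemma of_nat_mult_cancel_fock: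
  fixes x y :: fock
  assumes "0 < n" "of_nat n * x = of_nat n * y"
  shows "x = y"
proof -
  have "fock_const (1 / of_nat n) * (of_nat n * x) = x" for x :: fock
    using assms(1)
    by (simp add: fock_const_of_nat[symmetric] mult.assoc[symmetric] fock_const_mult)
  with assms(2) show ?thesis by metis
qed

context
  fixes T assumes T: "fock_linear T"
begin

lemma fock_linear_add: "T (f + g) = T f + T g"
  using T by (simp add: fock_linear_def)

lemma fock_linear_const: "T (fock_const c * f) = fock_const c * T f"
  using T by (simp add: fock_linear_def)

lemma fock_linear_0: "T 0 = 0"
  using fock_linear_const[of 0 0] by simp

lemma fock_linear_sum: "T (\<Sum>x\<in>A. f x) = (\<Sum>x\<in>A. T (f x))"
  by (induction A rule: infinite_finite_induct) (simp_all add: fock_linear_0 fock_linear_add)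

lemma fock_linear_uminus: "T (- f) = - T f"
  using fock_linear_const[of "-1" f] by (simp add: fock_const_uminus)

lemma fock_linear_diff: "T (f - g) = T f - T g"
  using fock_linear_add[of f "- g"] by (simp add: fock_linear_uminus)

lemma fock_linear_of_nat: "T (of_nat n * f) = of_nat n * T f"
  using fock_linear_const[of "of_nat n" f] by (simp add: fock_const_of_nat)

end

lemma foldr_linear:
  assumes "\<And>m. fock_linear (A m)"
  shows "fock_linear (foldr A ms)"
  by (induction ms) (auto simp: fock_linear_def fock_linear_add[OF assms] fock_linear_const[OF assms])

text \<open>Parts are ordered: expanding the j-th power of \<open>\<Sum> A_m z^m\<close> gives one
  word in the operators per list, so 1/j! is the only coefficient and no multinomials occur.\<close>

definition compositions :: "nat \<Rightarrow> nat list set" where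
  "compositions n = {ms. sum_list ms = n \<and> 0 \<notin> set ms}"

lemma finite_compositions [simp, intro]: "finite (compositions n)"
proof (rule finite_subset)
  have "length ms \<le> sum_list ms" if "0 \<notin> set ms" for ms :: "nat list"
    using that by (induction ms) (auto simp: Suc_le_eq trans_le_add2)
  moreover have "x \<le> sum_list ms" if "x \<in> set ms" for ms :: "nat list" and x
    using that by (simp add: member_le_sum_list)
  ultimately show "compositions n \<subseteq> {ms. set ms \<subseteq> {..n} \<and> length ms \<le> n}"
    by (auto simp: compositions_def)
  show "finite {ms. set ms \<subseteq> {..n} \<and> length ms \<le> n}"
    by (rule finite_lists_length_le) simp
qed

lemma compositions_0: "compositions 0 = {[]}"
  by (auto simp: compositions_def) (metis all_not_in_conv set_empty sum_list_eq_0_iff)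

lemma exp_coeff_0: "exp_coeff A 0 f = f"
  using compositions_0 by (simp add: exp_coeff_def compositions_def)

lemma exp_coeff_alt: "exp_coeff A n f = (\<Sum>ms\<in>compositions n. fock_const (1 / fact (length ms)) * foldr A ms f)"
  by (simp add: exp_coeff_def compositions_def)

lemma exp_coeff_linear:
  assumes "\<And>m. fock_linear (A m)"
  shows "fock_linear (exp_coeff A n)"
  unfolding fock_linear_def exp_coeff_alt
  by (simp add: fock_linear_add[OF foldr_linear[OF assms]] fock_linear_const[OF foldr_linear[OF assms]]
      ring_distribs sum.distrib sum_distrib_left mult.left_commute)

lemma foldr_commuting_permute:
  assumes "\<And>m n f. A m (A n f) = A n (A m f)" "mset xs = mset ys"
  shows "foldr A xs f = foldr A ys f"
proof -
  have "foldr A xs = foldr A ys" if "mset xs = mset ys" for xs ys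
  proof -
    have "fold A (rev xs) = fold A (rev ys)"
      using that assms(1) by (intro fold_multiset_equiv) (auto simp: fun_eq_iff)
    then show ?thesis by (simp add: foldr_conv_fold)
  qed
  from this[OF assms(2)] show ?thesis by simp
qed

lemma mset_rotate: "mset (rotate n xs) = mset xs"
  by (metis append_take_drop_id mset_append rotate_drop_take union_commute)

lemma sum_list_rotate: "sum_list (rotate n xs) = sum_list (xs :: nat list)"
  by (metis mset_rotate sum_mset_sum_list)

text \<open>
  The coefficientwise form of \<open>z E' = (\<Sum>\<^sub>m m A\<^sub>m z\<^sup>m) E\<close>. Rotating a composition moves each of
  its parts to the front, and this does not change the product of the commuting operators.
\<close>

lemma exp_coeff_recurrence:
  assumes lin: "\<And>m. fock_linear (A m)" and comm: "\<And>m n f. A m (A n f) = A n (A m f)"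
  shows "of_nat n * exp_coeff A n f = (\<Sum>m=1..n. of_nat m * A m (exp_coeff A (n - m) f))"
proof (cases "n = 0")
  case False
  \<comment> \<open>\<open>g\<close> weights a composition by its first part. Over all rotations of
    \<open>ms\<close> the first parts run through all parts, whose sum is the factor n on the
    left.\<close>
  define g where "g ms = fock_const (1 / fact (length ms)) * (of_nat (hd ms) * foldr A ms f)" for ms
  have ne: "ms \<noteq> []" if "ms \<in> compositions n" for ms
    using that False by (auto simp: compositions_def)
  have "of_nat n * exp_coeff A n f =
      (\<Sum>ms\<in>compositions n. \<Sum>p<length ms. g (rotate p ms))"
    unfolding exp_coeff_alt sum_distrib_left
  proof (intro sum.cong refl)
    fix ms assume ms: "ms \<in> compositions n"
    have "g (rotate p ms) = of_nat (ms ! p) * (fock_const (1 / fact (length ms)) * foldr A ms f)"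
      if "p < length ms" for p
    proof -
      have "hd (rotate p ms) = ms ! p"
        using that ne[OF ms] by (simp add: hd_rotate_conv_nth)
      moreover have "foldr A (rotate p ms) f = foldr A ms f"
        using comm by (rule foldr_commuting_permute) (rule mset_rotate)
      ultimately show ?thesis by (simp only: g_def length_rotate mult.left_commute)
    qed
    then have "(\<Sum>p<length ms. g (rotate p ms)) =
        of_nat (\<Sum>p<length ms. ms ! p) * (fock_const (1 / fact (length ms)) * foldr A ms f)"
      by (simp add: sum_distrib_right)
    also have "(\<Sum>p<length ms. ms ! p) = n"
      using ms by (simp add: compositions_def sum_list_sum_nth atLeast0LessThan)
    finally show "of_nat n * (fock_const (1 / fact (length ms)) * foldr A ms f) =
        (\<Sum>p<length ms. g (rotate p ms))" ..
  qed
  also have "\<dots> = (\<Sum>(ms, p)\<in>(SIGMA ms:compositions n. {..<length ms}). g (rotate p ms))"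
    by (subst sum.Sigma) auto
  \<comment> \<open>For fixed p, rotation by p permutes the compositions of each length, so every
    amount of rotation contributes equally.\<close>
  also have "\<dots> = (\<Sum>(ms, p)\<in>(SIGMA ms:compositions n. {..<length ms}). g ms)"
    by (rule sum.reindex_bij_witness[where j = "\<lambda>(ms, p). (rotate p ms, p)"
          and i = "\<lambda>(ms, p). (rotate (length ms - p) ms, p)"])
      (auto simp: compositions_def rotate_rotate sum_list_rotate)
  also have "\<dots> = (\<Sum>ms\<in>compositions n. of_nat (length ms) * g ms)"
    by (simp add: sum.Sigma[symmetric])
  \<comment> \<open>Cutting off the first part m leaves a composition of n - m, and length/length!
    becomes the 1/(length - 1)! of the shorter list.\<close>
  also have "\<dots> = (\<Sum>(m, ms)\<in>(SIGMA m:{1..n}. compositions (n - m)).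
      of_nat m * A m (fock_const (1 / fact (length ms)) * foldr A ms f))"
  proof (rule sum.reindex_bij_witness[where i = "\<lambda>(m, ms). m # ms" and j = "\<lambda>ms. (hd ms, tl ms)"])
    fix ms assume ms: "ms \<in> compositions n"
    then obtain m ms' where [simp]: "ms = m # ms'" using ne by (cases ms) auto
    show "(case (hd ms, tl ms) of (m, ms) \<Rightarrow> m # ms) = ms" by simp
    show "(hd ms, tl ms) \<in> (SIGMA m:{1..n}. compositions (n - m))"
      using ms by (auto simp: compositions_def)
    have "of_nat (length ms) * g ms =
        (of_nat (length ms) * fock_const (1 / fact (length ms))) * (of_nat m * foldr A ms f)"
      by (simp add: g_def mult_ac)
    also have "of_nat (length ms) * fock_const (1 / fact (length ms)) = fock_const (1 / fact (length ms'))"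
      by (simp only: fock_const_of_nat[symmetric] fock_const_mult)
        (simp add: field_simps del: of_nat_Suc)
    finally show "(case (hd ms, tl ms) of
          (m, ms) \<Rightarrow> of_nat m * A m (fock_const (1 / fact (length ms)) * foldr A ms f)) =
        of_nat (length ms) * g ms"
      by (simp add: fock_linear_const[OF lin])
  qed (auto simp: compositions_def)
  also have "\<dots> = (\<Sum>m=1..n. of_nat m * A m (exp_coeff A (n - m) f))"
    by (subst sum.Sigma[symmetric])
      (auto simp: exp_coeff_alt fock_linear_sum[OF lin] sum_distrib_left intro!: sum.cong)
  finally show ?thesis .
qed simp

text \<open>Term n of the recurrence is fixed by the earlier ones. Later exponentials are identified
  by guessing E and checking the recurrence, without returning to compositions.\<close>

lemma exp_coeff_unique:
  assumes "\<And>m. fock_linear (A m)" "\<And>m n f. A m (A n f) = A n (A m f)"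
    and "E 0 = f" "\<And>n. 0 < n \<Longrightarrow> of_nat n * E n = (\<Sum>m=1..n. of_nat m * A m (E (n - m)))"
  shows "exp_coeff A n f = E n"
proof (induction n rule: less_induct)
  case (less n)
  show ?case
  proof (cases "n = 0")
    case False
    have "of_nat n * exp_coeff A n f = (\<Sum>m=1..n. of_nat m * A m (exp_coeff A (n - m) f))"
      by (rule exp_coeff_recurrence[OF assms(1,2)])
    also have "\<dots> = of_nat n * E n"
      using False less by (simp add: assms(4))
    finally show ?thesis
      using of_nat_mult_cancel_fock[of n] False by blast
  qed (simp add: exp_coeff_0 assms(3))
qed

section \<open>Derivations and complete symmetric functions\<close>

lemma exp_coeff_cong:
  assumes "\<And>m f. 0 < m \<Longrightarrow> A m f = B m f"
  shows "exp_coeff A n f = exp_coeff B n f"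
proof -
  have "foldr A ms f = foldr B ms f" if "0 \<notin> set ms" for ms
    using that by (induction ms) (auto simp: assms)
  then show ?thesis
    unfolding exp_coeff_def by (intro sum.cong) auto
qed

section \<open>Partial derivatives on the polynomial ring\<close>

lemma poly_mapping_eq_sum_single:
  "f = (\<Sum>u\<in>Poly_Mapping.keys f. Poly_Mapping.single u (Poly_Mapping.lookup f u))"
  by (rule poly_mapping_eqI)
    (auto simp: lookup_sum lookup_single when_def in_keys_iff)

lemma fock_deriv_superset:
  assumes "finite S" "Poly_Mapping.keys f \<subseteq> S"
  shows "fock_deriv k m f = (\<Sum>u\<in>S. Poly_Mapping.single (u - Poly_Mapping.single (k, m) 1)
          (of_nat (Poly_Mapping.lookup u (k, m)) * Poly_Mapping.lookup f u))"
  unfolding fock_deriv_def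
  by (rule sum.mono_neutral_left[OF assms]) (simp add: in_keys_iff)

lemma lookup_fock_const_mult:
  "Poly_Mapping.lookup (fock_const c * f) u = c * Poly_Mapping.lookup f u"
  by (simp add: fock_const_def mult_map_scale_conv_mult[symmetric] map.rep_eq when_def)

lemma fock_linear_fock_deriv: "fock_linear (fock_deriv k m)"
  unfolding fock_linear_def
proof (intro conjI allI)
  fix f g :: fock and c
  let ?S = "Poly_Mapping.keys f \<union> Poly_Mapping.keys g"
  have "Poly_Mapping.keys (f + g) \<subseteq> ?S" by (rule keys_add)
  then show "fock_deriv k m (f + g) = fock_deriv k m f + fock_deriv k m g"
    by (simp add: fock_deriv_superset[of ?S] lookup_add ring_distribs single_add sum.distrib)
  have "Poly_Mapping.keys (fock_const c * f) \<subseteq> Poly_Mapping.keys f"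
    by (auto simp: in_keys_iff lookup_fock_const_mult)
  then show "fock_deriv k m (fock_const c * f) = fock_const c * fock_deriv k m f"
    by (simp add: fock_deriv_superset[of "Poly_Mapping.keys f"] lookup_fock_const_mult)
      (simp add: sum_distrib_left fock_const_def mult_single mult.left_commute)
qed

lemma fock_deriv_single:
  "fock_deriv k m (Poly_Mapping.single u c) =
     Poly_Mapping.single (u - Poly_Mapping.single (k, m) 1) (of_nat (Poly_Mapping.lookup u (k, m)) * c)"
  by (subst fock_deriv_superset[of "{u}"]) auto

lemma fock_single_induct:
  assumes "\<And>u c. P (Poly_Mapping.single u c)" "\<And>f g. P f \<Longrightarrow> P g \<Longrightarrow> P (f + g)"
  shows "P (f :: fock)"
proof -
  have "P (\<Sum>u\<in>S. Poly_Mapping.single u (g u))" if "finite S" for S and g :: "_ \<Rightarrow> complex"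
    using that by induction (use assms assms(1)[of 0 0] in auto)
  then show ?thesis
    by (subst poly_mapping_eq_sum_single) simp
qed

lemma fock_deriv_mult: "fock_deriv k m (f * g) = fock_deriv k m f * g + f * fock_deriv k m g"
proof (induction f rule: fock_single_induct)
  case (1 u c)
  show ?case
  proof (induction g rule: fock_single_induct)
    case (1 v d)
    let ?e = "Poly_Mapping.single (k, m) (1 :: nat)"
    \<comment> \<open>Subtraction of exponents truncates at 0, so it passes to x only when the
      variable occurs there; otherwise the coefficient coming from the derivative vanishes.\<close>
    have diff: "x + y - ?e = (x - ?e) + y" if "Poly_Mapping.lookup x (k, m) > 0"
      for x y :: "(nat \<times> nat) \<Rightarrow>\<^sub>0 nat"
      using that by (intro poly_mapping_eqI) (auto simp: lookup_add lookup_minus lookup_single when_def)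
    have 1: "Poly_Mapping.single (u + v - ?e) (of_nat (Poly_Mapping.lookup u (k, m)) * c * d) =
        Poly_Mapping.single ((u - ?e) + v) (of_nat (Poly_Mapping.lookup u (k, m)) * c * d)"
      by (cases "Poly_Mapping.lookup u (k, m) = 0") (simp_all add: diff del: One_nat_def)
    have 2: "Poly_Mapping.single (u + v - ?e) (of_nat (Poly_Mapping.lookup v (k, m)) * c * d) =
        Poly_Mapping.single (u + (v - ?e)) (of_nat (Poly_Mapping.lookup v (k, m)) * c * d)"
      using diff[of v u] by (cases "Poly_Mapping.lookup v (k, m) = 0") (simp_all add: add.commute del: One_nat_def)
    show ?case
      using 1 2 by (simp add: mult_single fock_deriv_single lookup_add ring_distribs single_add mult_ac add.commute del: One_nat_def)
  next
    case (2 f g)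
    then show ?case
      by (simp add: ring_distribs fock_linear_add[OF fock_linear_fock_deriv])
  qed
next
  case (2 f g)
  then show ?case
    by (simp add: ring_distribs fock_linear_add[OF fock_linear_fock_deriv])
qed

lemma fock_deriv_commute: "fock_deriv k m (fock_deriv k' m' f) = fock_deriv k' m' (fock_deriv k m f)"
proof (induction f rule: fock_single_induct)
  case (1 u c)
  have "u - a - b = u - b - a" for a b :: "(nat \<times> nat) \<Rightarrow>\<^sub>0 nat"
    by (rule poly_mapping_eqI) (simp add: lookup_minus)
  then show ?case
    by (auto simp: fock_deriv_single lookup_minus lookup_single when_def mult_ac)
next
  case (2 f g)
  then show ?case
    by (simp add: fock_linear_add[OF fock_linear_fock_deriv])
qed

lemma fock_deriv_const [simp]: "fock_deriv k m (fock_const c) = 0"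
  by (simp add: fock_const_def fock_deriv_single)

lemma fock_deriv_1 [simp]: "fock_deriv k m 1 = 0"
  using fock_deriv_const[of k m 1] by simp

lemma fock_deriv_pvar: "fock_deriv k m (pvar k' m') = (if k = k' \<and> m = m' then 1 else 0)"
  by (simp add: pvar_def fock_deriv_single lookup_single when_def)

text \<open>Monomials are reached by splitting off one variable at a time, with the total degree as
  measure. This suits properties that are stable under products but awkward on monomials.\<close>

lemma fock_induct [case_names const pvar add mult]:
  assumes const: "\<And>c. P (fock_const c)" and pvar: "\<And>k m. P (pvar k m)"
    and add: "\<And>f g. P f \<Longrightarrow> P g \<Longrightarrow> P (f + g)" and mult: "\<And>f g. P f \<Longrightarrow> P g \<Longrightarrow> P (f * g)"
  shows "P (f :: fock)"
proof (induction f rule: fock_single_induct)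
  case (1 u c)
  show ?case
  proof (induction "\<Sum>x\<in>Poly_Mapping.keys u. Poly_Mapping.lookup u x" arbitrary: u rule: less_induct)
    case less
    show ?case
    proof (cases "u = 0")
      case True
      then show ?thesis using const[of c] by (simp add: fock_const_def)
    next
      case False
      then obtain k m where km: "(k, m) \<in> Poly_Mapping.keys u"
        by (metis keys_eq_empty ex_in_conv surj_pair)
      define v where "v = u - Poly_Mapping.single (k, m) 1"
      have lk: "Poly_Mapping.lookup u (k, m) > 0"
        using km by (simp add: in_keys_iff)
      have u: "u = Poly_Mapping.single (k, m) 1 + v"
        using lk by (intro poly_mapping_eqI) (auto simp: v_def lookup_add lookup_minus lookup_single when_def)
      have vu: "Poly_Mapping.keys v \<subseteq> Poly_Mapping.keys u"
        by (auto simp: v_def in_keys_iff lookup_minus)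
      have "(\<Sum>x\<in>Poly_Mapping.keys v. Poly_Mapping.lookup v x) = (\<Sum>x\<in>Poly_Mapping.keys u. Poly_Mapping.lookup v x)"
        by (rule sum.mono_neutral_left) (use vu in \<open>auto simp: in_keys_iff\<close>)
      also have "\<dots> < (\<Sum>x\<in>Poly_Mapping.keys u. Poly_Mapping.lookup u x)"
        by (rule sum_strict_mono_ex1) (use km lk in \<open>auto simp: v_def lookup_minus lookup_single intro!: bexI[of _ "(k, m)"]\<close>)
      finally have "P (Poly_Mapping.single v c)" by (rule less)
      from mult[OF pvar[of k m] this] show ?thesis
        by (simp add: pvar_def mult_single u[symmetric] del: One_nat_def)
    qed
  qed
next
  case (2 f g)
  then show ?case by (rule add)
qed

section \<open>Exponential power series\<close>

lemma fock_linear_mult: "fock_linear (\<lambda>f. a * f)"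
  by (simp add: fock_linear_def ring_distribs mult.left_commute)

definition exp_series :: "(nat \<Rightarrow> fock) \<Rightarrow> fock fps" where
  "exp_series a = Abs_fps (\<lambda>n. exp_coeff (\<lambda>m f. a m * f) n 1)"

lemma exp_coeff_mult_eq: "exp_coeff (\<lambda>m f. a m * f) n f = fps_nth (exp_series a) n * f"
proof -
  have "foldr (\<lambda>m f. a m * f) ms f = foldr (\<lambda>m f. a m * f) ms 1 * f" for ms
    by (induction ms) (simp_all add: mult.assoc)
  then show ?thesis
    by (simp add: exp_series_def exp_coeff_def sum_distrib_right mult.assoc)
qed

lemma exp_series_0: "fps_nth (exp_series a) 0 = 1"
  by (simp add: exp_series_def exp_coeff_0)

lemma exp_series_recurrence:
  "of_nat n * fps_nth (exp_series a) n = (\<Sum>m=1..n. of_nat m * (a m * fps_nth (exp_series a) (n - m)))"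
  unfolding exp_series_def fps_nth_Abs_fps
  by (rule exp_coeff_recurrence) (auto simp: fock_linear_mult mult.left_commute)

text \<open>Read as a differential equation, the recurrence can be handled by power-series calculus;
  the summand m = 0 may be added because its weight is 0.\<close>

lemma exp_series_diff_eq:
  "fps_X * fps_deriv (exp_series a) = Abs_fps (\<lambda>m. of_nat m * a m) * exp_series a"
proof (rule fps_ext)
  fix n
  have "fps_nth (fps_X * fps_deriv (exp_series a)) n = of_nat n * fps_nth (exp_series a) n"
    by (cases n) simp_all
  also have "\<dots> = (\<Sum>m=0..n. of_nat m * (a m * fps_nth (exp_series a) (n - m)))"
    unfolding exp_series_recurrence by (rule sum.mono_neutral_left) (auto simp: Suc_le_eq)
  finally show "fps_nth (fps_X * fps_deriv (exp_series a)) n =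
      fps_nth (Abs_fps (\<lambda>m. of_nat m * a m) * exp_series a) n"
    by (simp add: fps_mult_nth mult.assoc)
qed

lemma exp_series_unique:
  assumes "fps_nth F 0 = 1" and "fps_X * fps_deriv F = Abs_fps (\<lambda>m. of_nat m * a m) * F"
  shows "exp_series a = F"
proof (rule fps_ext)
  fix n
  show "fps_nth (exp_series a) n = fps_nth F n"
    unfolding exp_series_def fps_nth_Abs_fps
  proof (rule exp_coeff_unique)
    fix n :: nat
    have "of_nat n * fps_nth F n = fps_nth (fps_X * fps_deriv F) n"
      by (cases n) simp_all
    also have "\<dots> = (\<Sum>m=0..n. of_nat m * (a m * fps_nth F (n - m)))"
      by (simp add: assms(2) fps_mult_nth mult.assoc)
    also have "\<dots> = (\<Sum>m=1..n. of_nat m * (a m * fps_nth F (n - m)))"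
      by (rule sum.mono_neutral_right) (auto simp: Suc_le_eq)
    finally show "of_nat n * fps_nth F n = (\<Sum>m=1..n. of_nat m * (a m * fps_nth F (n - m)))" .
  qed (auto simp: assms fock_linear_mult mult.left_commute)
qed

text \<open>By the Leibniz rule the product solves the differential equation of the sum, with the
  same constant term.\<close>

lemma exp_series_add: "exp_series (\<lambda>m. a m + b m) = exp_series a * exp_series b"
proof (rule exp_series_unique)
  let ?A = "exp_series a" and ?B = "exp_series b"
  have "Abs_fps (\<lambda>m. of_nat m * (a m + b m)) =
      Abs_fps (\<lambda>m. of_nat m * a m) + Abs_fps (\<lambda>m. of_nat m * b m)"
    by (rule fps_ext) (simp add: ring_distribs)
  moreover have "fps_X * fps_deriv (?A * ?B) = (fps_X * fps_deriv ?A) * ?B + ?A * (fps_X * fps_deriv ?B)"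
    by (simp add: ring_distribs mult_ac)
  ultimately show "fps_X * fps_deriv (?A * ?B) = Abs_fps (\<lambda>m. of_nat m * (a m + b m)) * (?A * ?B)"
    unfolding exp_series_diff_eq by (simp add: ring_distribs mult_ac)
qed (simp add: exp_series_0)

lemma exp_series_zero: "exp_series (\<lambda>m. 0) = 1"
  by (rule exp_series_unique) (auto simp: fps_eq_iff fps_mult_nth)

abbreviation H_series :: "nat \<Rightarrow> fock fps" where
  "H_series k \<equiv> exp_series (pvar k)"

text \<open>If \<open>H_series k\<close> is \<open>\<Sum> h_n z^n\<close>, this is
  \<open>\<Sum> (-1)^n e_n z^n\<close>, the signed series of elementary symmetric functions.\<close>

definition H_inv_series :: "nat \<Rightarrow> fock fps" where
  "H_inv_series k = exp_series (\<lambda>m. - pvar k m)"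

lemma H_series_mult_inv: "H_series k * H_inv_series k = 1"
  unfolding H_inv_series_def exp_series_add[symmetric] by (simp add: exp_series_zero)

lemma complete_sym_of_nat: "complete_sym k (int n) = fps_nth (H_series k) n"
  by (simp add: complete_sym_def exp_series_def)

lemma complete_sym_neg: "n < 0 \<Longrightarrow> complete_sym k n = 0"
  by (simp add: complete_sym_def)

lemma complete_sym_0: "complete_sym k 0 = 1"
  using complete_sym_of_nat[of k 0] by (simp add: exp_series_0)

text \<open>On generating functions the derivative of H is z^m H. The induction uses Newton's
  identity \<open>n h_n = \<Sum> j p_j h_{n-j}\<close>: differentiating p_m yields m copies of
  h_{n-m}, the other Leibniz terms yield n - m copies, and n is cancelled.\<close>

lemma fock_deriv_complete_sym:
  assumes "0 < m"
  shows "fock_deriv k m (complete_sym k' n) = (if k = k' then complete_sym k' (n - int m) else 0)"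
proof (cases "n < 0")
  case True
  then show ?thesis
    by (simp add: complete_sym_neg fock_linear_0[OF fock_linear_fock_deriv])
next
  case False
  then obtain n' where n: "n = int n'" by (metis not_le nonneg_int_cases)
  let ?e = "if k = k' then 1 else 0 :: fock"
  have "fock_deriv k m (complete_sym k' (int n')) = ?e * complete_sym k' (int n' - int m)"
  proof (induction n' rule: less_induct)
    case (less n)
    let ?h = "\<lambda>n. complete_sym k' n"
    let ?D = "fock_deriv k m"
    note lin = fock_linear_fock_deriv[of k m]
    have rec: "of_nat n * ?h (int n) = (\<Sum>j=1..n. of_nat j * (pvar k' j * ?h (int n - int j)))" for n
      using exp_series_recurrence[of n "pvar k'"]
      by (simp add: complete_sym_of_nat[symmetric] of_nat_diff)
    show ?case
    proof (cases "n = 0")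
      case True
      then show ?thesis using assms by (simp add: complete_sym_0 complete_sym_neg)
    next
      case False
      have "of_nat n * ?D (?h n) = ?D (of_nat n * ?h n)"
        by (simp add: fock_linear_of_nat[OF lin])
      also have "\<dots> = (\<Sum>j=1..n. of_nat j * (?D (pvar k' j) * ?h (int n - int j)
          + pvar k' j * ?D (?h (int n - int j))))"
        unfolding rec by (simp add: fock_linear_sum[OF lin] fock_linear_of_nat[OF lin]) (simp add: fock_deriv_mult)
      also have "\<dots> = (\<Sum>j=1..n. if j = m then of_nat m * (?e * ?h (int n - int m)) else 0)
          + (\<Sum>j=1..n. of_nat j * (pvar k' j * ?D (?h (int n - int j))))"
        by (subst sum.distrib[symmetric]) (auto intro!: sum.cong simp: fock_deriv_pvar ring_distribs)
      also have "(\<Sum>j=1..n. if j = m then of_nat m * (?e * ?h (int n - int m)) else 0) =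
          ?e * (of_nat m * ?h (int n - int m))"
        using assms by (auto simp: complete_sym_neg)
      also have "(\<Sum>j=1..n. of_nat j * (pvar k' j * ?D (?h (int n - int j)))) =
          ?e * (\<Sum>j=1..n. of_nat j * (pvar k' j * ?h (int n - int m - int j)))"
        unfolding sum_distrib_left
      proof (intro sum.cong refl)
        fix j assume j: "j \<in> {1..n}"
        then have "?D (?h (int (n - j))) = ?e * ?h (int (n - j) - int m)"
          by (intro less) auto
        with j show "of_nat j * (pvar k' j * ?D (?h (int n - int j))) =
            ?e * (of_nat j * (pvar k' j * ?h (int n - int m - int j)))"
          by (simp add: of_nat_diff algebra_simps)
      qed
      also have "(\<Sum>j=1..n. of_nat j * (pvar k' j * ?h (int n - int m - int j))) =
          of_nat (n - m) * ?h (int n - int m)"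
      proof (cases "m \<le> n")
        case True
        have "(\<Sum>j=1..n. of_nat j * (pvar k' j * ?h (int n - int m - int j))) =
            (\<Sum>j=1..n-m. of_nat j * (pvar k' j * ?h (int (n - m) - int j)))"
          using True by (intro sum.mono_neutral_cong_right) (auto simp: complete_sym_neg of_nat_diff)
        with True show ?thesis
          using rec[of "n - m"] by (simp add: of_nat_diff)
      qed (simp add: complete_sym_neg)
      \<comment> \<open>For m > n the truncated n - m is not the true difference, but then h_{n-m} =
        0 and both sides vanish.\<close>
      also have "?e * (of_nat m * ?h (int n - int m)) + ?e * (of_nat (n - m) * ?h (int n - int m)) =
          of_nat n * (?e * ?h (int n - int m))"
        by (cases "m \<le> n") (auto simp: of_nat_diff algebra_simps complete_sym_neg)
      finally show ?thesis
        using of_nat_mult_cancel_fock[of n] False by blast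
    qed
  qed
  then show ?thesis by (simp add: n)
qed

section \<open>The annihilation exponential\<close>

definition deriv_diff :: "nat \<Rightarrow> nat \<Rightarrow> nat \<Rightarrow> fock \<Rightarrow> fock" where
  "deriv_diff k k' m f = fock_deriv k m f - fock_deriv k' m f"

text \<open>The annihilation exponential of the root e_k - e_k', written with the two derivations to
  which \<open>heis_root\<close> telescopes; the index is the power of 1/z.\<close>

definition annihilator :: "nat \<Rightarrow> nat \<Rightarrow> nat \<Rightarrow> fock \<Rightarrow> fock" where
  "annihilator k k' = exp_coeff (\<lambda>m f. fock_const (- 1 / of_nat m) * deriv_diff k k' m f)"

lemma fock_linear_deriv_diff: "fock_linear (deriv_diff k k' m)"
  using fock_linear_fock_deriv[of k m] fock_linear_fock_deriv[of k' m]
  by (simp add: fock_linear_def deriv_diff_def algebra_simps)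

lemma deriv_diff_mult:
  "deriv_diff k k' m (f * g) = deriv_diff k k' m f * g + f * deriv_diff k k' m g"
  by (simp add: deriv_diff_def fock_deriv_mult algebra_simps)

lemma deriv_diff_commute:
  "deriv_diff k k' m (deriv_diff k k' n f) = deriv_diff k k' n (deriv_diff k k' m f)"
  by (simp add: deriv_diff_def fock_linear_diff[OF fock_linear_fock_deriv] fock_deriv_commute)

lemma deriv_diff_complete_sym:
  assumes "0 < m"
  shows "deriv_diff k k' m (complete_sym j n) =
    ((if k = j then 1 else 0) - (if k' = j then 1 else 0)) * complete_sym j (n - int m)"
  using assms by (auto simp: deriv_diff_def fock_deriv_complete_sym)

lemma deriv_diff_const: "deriv_diff k k' m (fock_const c) = 0"
  by (simp add: deriv_diff_def)

lemma fock_linear_annihilator_op: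
  "fock_linear (\<lambda>f. fock_const (- 1 / of_nat m) * deriv_diff k k' m f)"
  using fock_linear_deriv_diff[of k k' m]
  by (simp add: fock_linear_def algebra_simps)

lemma annihilator_op_commute:
  "fock_const a * deriv_diff k k' m (fock_const b * deriv_diff k k' n f) =
   fock_const b * deriv_diff k k' n (fock_const a * deriv_diff k k' m f)"
  by (simp add: fock_linear_const[OF fock_linear_deriv_diff] deriv_diff_commute[of k k' m n] mult.left_commute)

lemma fock_linear_annihilator: "fock_linear (annihilator k k' n)"
  unfolding annihilator_def by (rule exp_coeff_linear) (rule fock_linear_annihilator_op)

lemma annihilator_0: "annihilator k k' 0 f = f"
  by (simp add: annihilator_def exp_coeff_0)

lemma annihilator_op_scaled:
  "0 < m \<Longrightarrow> of_nat m * (fock_const (- 1 / of_nat m) * g) = - g"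
  by (simp add: mult.assoc[symmetric] fock_const_of_nat[symmetric] fock_const_mult fock_const_uminus)

text \<open>The 1/m in the exponent cancels the weight m, which leaves a recurrence in bare
  derivations.\<close>

lemma annihilator_recurrence:
  "of_nat n * annihilator k k' n f = - (\<Sum>m=1..n. deriv_diff k k' m (annihilator k k' (n - m) f))"
proof -
  have "of_nat n * annihilator k k' n f =
      (\<Sum>m=1..n. of_nat m * (fock_const (- 1 / of_nat m) * deriv_diff k k' m (annihilator k k' (n - m) f)))"
    unfolding annihilator_def
    by (rule exp_coeff_recurrence) (rule fock_linear_annihilator_op annihilator_op_commute)+
  also have "\<dots> = (\<Sum>m=1..n. - deriv_diff k k' m (annihilator k k' (n - m) f))"
    by (intro sum.cong refl annihilator_op_scaled) auto
  finally show ?thesis by (simp add: sum_negf)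
qed

lemma annihilator_unique:
  assumes "E 0 = f" "\<And>n. 0 < n \<Longrightarrow> of_nat n * E n = - (\<Sum>m=1..n. deriv_diff k k' m (E (n - m)))"
  shows "annihilator k k' n f = E n"
  unfolding annihilator_def
proof (rule exp_coeff_unique)
  fix n :: nat assume n: "0 < n"
  have "(\<Sum>m=1..n. of_nat m * (fock_const (- 1 / of_nat m) * deriv_diff k k' m (E (n - m)))) =
     (\<Sum>m=1..n. - deriv_diff k k' m (E (n - m)))"
    by (intro sum.cong refl annihilator_op_scaled) auto
  then show "of_nat n * E n =
      (\<Sum>m=1..n. of_nat m * (fock_const (- 1 / of_nat m) * deriv_diff k k' m (E (n - m))))"
    by (simp add: assms(2)[OF n] sum_negf)
qed (rule fock_linear_annihilator_op annihilator_op_commute assms)+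

text \<open>Exponentials of derivations are multiplicative: by the Leibniz rule the Cauchy product
  satisfies the recurrence of \<open>f * g\<close>.\<close>

lemma annihilator_mult:
  "annihilator k k' n (f * g) = (\<Sum>i\<le>n. annihilator k k' i f * annihilator k k' (n - i) g)"
proof (rule annihilator_unique)
  fix n :: nat
  let ?F = "\<lambda>i. annihilator k k' i f" and ?G = "\<lambda>i. annihilator k k' i g" and ?D = "deriv_diff k k'"
  have "of_nat n * (\<Sum>i\<le>n. ?F i * ?G (n - i)) =
      (\<Sum>i\<le>n. (of_nat i * ?F i) * ?G (n - i)) + (\<Sum>i\<le>n. ?F i * (of_nat (n - i) * ?G (n - i)))"
    by (subst sum.distrib[symmetric]) (auto simp: sum_distrib_left of_nat_diff algebra_simps intro!: sum.cong)
  also have "(\<Sum>i\<le>n. (of_nat i * ?F i) * ?G (n - i)) =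
      - (\<Sum>(i, m)\<in>(SIGMA i:{..n}. {1..i}). ?D m (?F (i - m)) * ?G (n - i))"
    unfolding annihilator_recurrence
    by (subst sum.Sigma[symmetric]) (auto simp: sum_distrib_right sum_negf)
  \<comment> \<open>Both triangular sums are rearranged with m outermost and the inner index up to n
    - m, so that they combine into derivatives of the Cauchy product at n - m.\<close>
  also have "(\<Sum>(i, m)\<in>(SIGMA i:{..n}. {1..i}). ?D m (?F (i - m)) * ?G (n - i)) =
      (\<Sum>(m, i)\<in>(SIGMA m:{1..n}. {..n - m}). ?D m (?F i) * ?G (n - m - i))"
    by (rule sum.reindex_bij_witness[where j = "\<lambda>(i, m). (m, i - m)" and i = "\<lambda>(m, i). (i + m, m)"])
      (auto simp: diff_diff_eq)
  also have "(\<Sum>i\<le>n. ?F i * (of_nat (n - i) * ?G (n - i))) =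
      - (\<Sum>(i, m)\<in>(SIGMA i:{..n}. {1..n - i}). ?F i * ?D m (?G (n - i - m)))"
    unfolding annihilator_recurrence
    by (subst sum.Sigma[symmetric]) (auto simp: sum_distrib_left sum_negf)
  also have "(\<Sum>(i, m)\<in>(SIGMA i:{..n}. {1..n - i}). ?F i * ?D m (?G (n - i - m))) =
      (\<Sum>(m, i)\<in>(SIGMA m:{1..n}. {..n - m}). ?F i * ?D m (?G (n - m - i)))"
    by (rule sum.reindex_bij_witness[where j = "\<lambda>(i, m). (m, i)" and i = "\<lambda>(m, i). (i, m)"])
      (auto simp: add.commute)
  finally have "of_nat n * (\<Sum>i\<le>n. ?F i * ?G (n - i)) =
      - (\<Sum>(m, i)\<in>(SIGMA m:{1..n}. {..n - m}). ?D m (?F i * ?G (n - m - i)))"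
    by (simp add: deriv_diff_mult sum.distrib case_prod_unfold)
  also have "\<dots> = - (\<Sum>m=1..n. ?D m (\<Sum>i\<le>n - m. ?F i * ?G (n - m - i)))"
    by (subst sum.Sigma[symmetric]) (auto simp: fock_linear_sum[OF fock_linear_deriv_diff])
  finally show "of_nat n * (\<Sum>i\<le>n. ?F i * ?G (n - i)) =
      - (\<Sum>m=1..n. ?D m (\<Sum>i\<le>n - m. ?F i * ?G (n - m - i)))" .
qed (simp add: annihilator_0)

lemma annihilator_const: "annihilator k k' n (fock_const c) = (if n = 0 then fock_const c else 0)"
  by (rule annihilator_unique)
    (auto simp: deriv_diff_const fock_linear_0[OF fock_linear_deriv_diff] intro!: sum.neutral)

text \<open>Finiteness in 1/z is what makes the annihilation exponential a Laurent series in z. A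
  variable is killed by any two derivations, and the bounds add under products.\<close>

lemma annihilator_eventually_0: "\<forall>\<^sub>\<infinity>n. annihilator k k' n f = 0"
proof (induction f rule: fock_induct)
  case (const c)
  then show ?case by (auto simp: annihilator_const MOST_nat intro!: exI[of _ 0])
next
  case (pvar j m)
  have "deriv_diff k k' n (pvar j m) = (if n = m then
      fock_const ((if k = j then 1 else 0) - (if k' = j then 1 else 0)) else 0)" for n
    by (auto simp: deriv_diff_def fock_deriv_pvar fock_const_uminus)
  then have *: "deriv_diff k k' n (deriv_diff k k' n' (pvar j m)) = 0" for n n'
    using deriv_diff_const[of k k' n] deriv_diff_const[of k k' n 0] by simp
  \<comment> \<open>Since second derivatives of a variable vanish, its exponential stops at the
    linear term.\<close>
  define E where "E n = (if n = 0 then pvar j m else fock_const (- 1 / of_nat n) * deriv_diff k k' n (pvar j m))" for n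
  have "annihilator k k' n (pvar j m) = E n" for n
  proof (rule annihilator_unique)
    fix n :: nat assume n: "0 < n"
    have "(\<Sum>m=1..n. deriv_diff k k' m (E (n - m))) = (\<Sum>m\<in>{n}. deriv_diff k k' m (E (n - m)))"
      using n by (intro sum.mono_neutral_right)
        (auto simp: E_def fock_linear_const[OF fock_linear_deriv_diff] *)
    then show "of_nat n * E n = - (\<Sum>m=1..n. deriv_diff k k' m (E (n - m)))"
      using n annihilator_op_scaled[OF n] by (simp add: E_def)
  qed (simp add: E_def)
  moreover have "E n = 0" if "n > m" for n
    using that by (simp add: E_def deriv_diff_def fock_deriv_pvar)
  ultimately show ?case by (auto simp: MOST_nat)
next
  case (add f g)
  then show ?case
    by eventually_elim (simp add: fock_linear_add[OF fock_linear_annihilator])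
next
  case (mult f g)
  then obtain M N where M: "\<And>n. n > M \<Longrightarrow> annihilator k k' n f = 0"
    and N: "\<And>n. n > N \<Longrightarrow> annihilator k k' n g = 0"
    by (auto simp: MOST_nat)
  have "annihilator k k' n (f * g) = 0" if "n > M + N" for n
    unfolding annihilator_mult
  proof (rule sum.neutral, rule ballI)
    fix i
    have "i > M \<or> n - i > N" using that by auto
    then show "annihilator k k' i f * annihilator k k' (n - i) g = 0"
      using M N by auto
  qed
  then show ?case by (auto simp: MOST_nat)
qed

section \<open>The annihilation exponential as a homomorphism into Laurent series\<close>

definition annihilator_poly :: "nat \<Rightarrow> nat \<Rightarrow> fock \<Rightarrow> fock poly" where
  "annihilator_poly k k' f = Abs_poly (\<lambda>n. annihilator k k' n f)"

lemma coeff_annihilator_poly: "coeff (annihilator_poly k k' f) n = annihilator k k' n f"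
  unfolding annihilator_poly_def by (subst Abs_poly_inverse) (simp_all add: annihilator_eventually_0)

text \<open>The annihilation exponential \<open>\<Sum>\<^sub>r z\<^bsup>-r\<^esup> (annihilator k k' r f)\<close>.\<close>

definition annihilator_series :: "nat \<Rightarrow> nat \<Rightarrow> fock \<Rightarrow> fock fls" where
  "annihilator_series k k' f = poly (map_poly fls_const (annihilator_poly k k' f)) fls_X_inv"

lemma annihilator_poly_add: "annihilator_poly k k' (f + g) = annihilator_poly k k' f + annihilator_poly k k' g"
  by (rule poly_eqI) (simp add: coeff_annihilator_poly fock_linear_add[OF fock_linear_annihilator])

lemma annihilator_poly_mult: "annihilator_poly k k' (f * g) = annihilator_poly k k' f * annihilator_poly k k' g"
  by (rule poly_eqI) (simp add: coeff_annihilator_poly annihilator_mult coeff_mult)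

lemma annihilator_poly_const: "annihilator_poly k k' (fock_const c) = [:fock_const c:]"
  by (rule poly_eqI) (auto simp: coeff_annihilator_poly annihilator_const coeff_pCons split: nat.split)

interpretation fls_const_hom: comm_ring_hom "fls_const :: 'a :: comm_ring_1 \<Rightarrow> 'a fls"
  by unfold_locales (auto simp: fls_plus_const fls_const_mult_const)

interpretation map_poly_fls_const_hom: map_poly_comm_ring_hom "fls_const :: 'a :: comm_ring_1 \<Rightarrow> 'a fls" ..

text \<open>This allows the series to be applied to a Jacobi-Trudi determinant entry by entry, and
  to a product over runners one factor at a time.\<close>

interpretation annihilator_series_hom: comm_ring_hom "annihilator_series k k'"
proof
  show "annihilator_series k k' 1 = 1" "annihilator_series k k' 0 = 0"
    using annihilator_poly_const[of k k' 1] annihilator_poly_const[of k k' 0]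
    by (simp_all add: annihilator_series_def)
qed (simp_all add: annihilator_series_def annihilator_poly_add annihilator_poly_mult
    map_poly_fls_const_hom.hom_add map_poly_fls_const_hom.hom_mult)

lemma annihilator_series_eq_sum:
  assumes "finite R" "\<And>r. annihilator k k' r f \<noteq> 0 \<Longrightarrow> r \<in> R"
  shows "annihilator_series k k' f = (\<Sum>r\<in>R. fls_const (annihilator k k' r f) * fls_X_inv ^ r)"
proof -
  let ?p = "annihilator_poly k k' f"
  have "annihilator_series k k' f = (\<Sum>r\<le>degree (map_poly fls_const ?p). fls_const (annihilator k k' r f) * fls_X_inv ^ r)"
    by (simp add: annihilator_series_def poly_altdef coeff_map_poly coeff_annihilator_poly)
  also have "\<dots> = (\<Sum>r\<in>R \<union> {..degree (map_poly fls_const ?p)}. fls_const (annihilator k k' r f) * fls_X_inv ^ r)"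
  proof (rule sum.mono_neutral_left)
    have "fls_const (annihilator k k' r f) = 0" if "r > degree (map_poly fls_const ?p)" for r
      using coeff_eq_0[OF that] by (simp add: coeff_map_poly coeff_annihilator_poly)
    then show "\<forall>i\<in>R \<union> {..degree (map_poly fls_const ?p)} - {..degree (map_poly fls_const ?p)}.
        fls_const (annihilator k k' i f) * fls_X_inv ^ i = 0"
      by auto
  qed (use assms(1) in auto)
  also have "\<dots> = (\<Sum>r\<in>R. fls_const (annihilator k k' r f) * fls_X_inv ^ r)"
  proof (rule sum.mono_neutral_right)
    have "annihilator k k' r f = 0" if "r \<notin> R" for r
      using assms(2) that by blast
    then show "\<forall>i\<in>R \<union> {..degree (map_poly fls_const ?p)} - R.
        fls_const (annihilator k k' i f) * fls_X_inv ^ i = 0"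
      by auto
  qed (use assms(1) in auto)
  finally show ?thesis .
qed

text \<open>The right-hand side has the shape of the sum in \<open>vertex_mode\<close>, so a mode
  becomes a single Laurent coefficient.\<close>

lemma fls_nth_mult_annihilator_series:
  "fls_nth (fps_to_fls C * annihilator_series k k' f) n =
    (\<Sum>r\<in>{r. annihilator k k' r f \<noteq> 0 \<and> 0 \<le> n + int r}. fps_nth C (nat (n + int r)) * annihilator k k' r f)"
proof -
  have fin: "finite {r. annihilator k k' r f \<noteq> 0}"
    using annihilator_eventually_0[of k k' f] by (simp add: eventually_cofinite)
  have "fls_nth (fps_to_fls C * annihilator_series k k' f) n =
      (\<Sum>r\<in>{r. annihilator k k' r f \<noteq> 0}. fls_nth (fls_const (annihilator k k' r f) * (fls_X_inv ^ r * fps_to_fls C)) n)"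
    by (simp add: annihilator_series_eq_sum[OF fin] sum_distrib_left fls_nth_sum mult_ac)
  also have "\<dots> = (\<Sum>r\<in>{r. annihilator k k' r f \<noteq> 0}.
      annihilator k k' r f * (if n + int r < 0 then 0 else fps_nth C (nat (n + int r))))"
    by (simp add: fls_X_inv_power_times_conv_shift fls_mult_const_nth)
  also have "\<dots> = (\<Sum>r\<in>{r. annihilator k k' r f \<noteq> 0 \<and> 0 \<le> n + int r}. fps_nth C (nat (n + int r)) * annihilator k k' r f)"
    by (rule sum.mono_neutral_cong_right) (use fin in \<open>auto simp: mult_ac\<close>)
  finally show ?thesis .
qed

lemma annihilator_series_unique:
  assumes "E 0 = f" "\<And>n. 0 < n \<Longrightarrow> of_nat n * E n = - (\<Sum>m=1..n. deriv_diff k k' m (E (n - m)))"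
    and "\<And>n. n > N \<Longrightarrow> E n = 0"
  shows "annihilator_series k k' f = (\<Sum>r\<le>N. fls_const (E r) * fls_X_inv ^ r)"
proof -
  have E: "annihilator k k' n f = E n" for n
    by (rule annihilator_unique) (rule assms)+
  have "annihilator k k' n f \<noteq> 0 \<Longrightarrow> n \<in> {..N}" for n
    using assms(3)[of n] by (cases "n \<le> N") (auto simp: E)
  then show ?thesis
    by (subst annihilator_series_eq_sum[of "{..N}"]) (simp_all add: E)
qed

lemma annihilator_series_complete_sym_neutral:
  assumes "j \<noteq> k" "j \<noteq> k'"
  shows "annihilator_series k k' (complete_sym j n) = fls_const (complete_sym j n)"
  using assms
  by (subst annihilator_series_unique[of "\<lambda>r. if r = 0 then complete_sym j n else 0" _ _ _ 0])
    (auto simp: deriv_diff_complete_sym fock_linear_0[OF fock_linear_deriv_diff] intro!: sum.neutral)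

text \<open>Orders from 2 on vanish: in the recurrence at order r, the derivative of h_n is h_{n-r}
  and that of -h_{n-1} is -h_{n-r}.\<close>

lemma annihilator_series_complete_sym_left:
  assumes "k \<noteq> k'"
  shows "annihilator_series k k' (complete_sym k n) =
    fls_const (complete_sym k n) - fls_X_inv * fls_const (complete_sym k (n - 1))"
proof -
  let ?h = "complete_sym k"
  let ?E = "\<lambda>r. if r = 0 then ?h n else if r = 1 then - ?h (n - 1) else 0"
  have "annihilator_series k k' (?h n) = (\<Sum>r\<le>1. fls_const (?E r) * fls_X_inv ^ r)"
  proof (rule annihilator_series_unique)
    fix r :: nat assume r: "0 < r"
    \<comment> \<open>Only r - m = 0 or 1 meets a nonzero value of \<open>?E\<close>. Removing 0
      covers r = 1, where r - 1 lies outside the range of summation.\<close>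
    have "(\<Sum>m=1..r. deriv_diff k k' m (?E (r - m))) =
        (\<Sum>m\<in>{r - 1, r} - {0}. deriv_diff k k' m (?E (r - m)))"
      using r by (intro sum.mono_neutral_right) (auto simp: fock_linear_0[OF fock_linear_deriv_diff])
    also have "\<dots> = (if r = 1 then ?h (n - 1) else 0)"
    proof (cases "r = 1")
      case False
      with r have "{r - 1, r} - {0} = {r - 1, r}" "r - 1 \<noteq> r" by auto
      with r False assms show ?thesis
        by (simp add: deriv_diff_complete_sym fock_linear_uminus[OF fock_linear_deriv_diff] of_nat_diff)
    qed (use assms in \<open>simp add: deriv_diff_complete_sym\<close>)
    finally show "of_nat r * ?E r = - (\<Sum>m=1..r. deriv_diff k k' m (?E (r - m)))"
      using r by auto
  qed auto
  then show ?thesis by simp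
qed

text \<open>The derivations now act with the opposite sign: all r summands of the recurrence equal
  -h_{n-r} and nothing cancels. The sum may stop at \<open>nat n\<close> because h vanishes in
  negative degrees.\<close>

lemma annihilator_series_complete_sym_right:
  assumes "k \<noteq> k'"
  shows "annihilator_series k k' (complete_sym k' n) =
    (\<Sum>r\<le>nat n. fls_const (complete_sym k' (n - int r)) * fls_X_inv ^ r)"
proof (rule annihilator_series_unique)
  fix r :: nat
  have "(\<Sum>m=1..r. deriv_diff k k' m (complete_sym k' (n - int (r - m)))) =
      (\<Sum>m=1..r. - complete_sym k' (n - int r))"
    using assms by (intro sum.cong refl) (auto simp: deriv_diff_complete_sym of_nat_diff)
  then show "of_nat r * complete_sym k' (n - int r) =
      - (\<Sum>m=1..r. deriv_diff k k' m (complete_sym k' (n - int (r - m))))"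
    by simp
qed (auto simp: complete_sym_neg)

section \<open>Jacobi-Trudi determinants\<close>

text \<open>The -i of the usual Jacobi-Trudi entry is absorbed into \<open>mu i\<close>, so that
  rows can be inserted or deleted without relabelling the others.\<close>

definition jt_det :: "(int \<Rightarrow> 'a :: comm_ring_1) \<Rightarrow> nat \<Rightarrow> (nat \<Rightarrow> int) \<Rightarrow> 'a" where
  "jt_det h n mu = det (mat n n (\<lambda>(i, j). h (mu i + int j)))"

lemma jt_det_cong:
  assumes "\<And>i. i < n \<Longrightarrow> mu i = nu i"
  shows "jt_det h n mu = jt_det h n nu"
proof -
  have "mat n n (\<lambda>(i, j). h (mu i + int j)) = mat n n (\<lambda>(i, j). h (nu i + int j))"
    by (rule eq_matI) (auto simp: assms)
  then show ?thesis by (simp add: jt_det_def)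
qed

text \<open>Right multiplication by a unitriangular matrix subtracts c times the original preceding
  column from every column at once.\<close>

lemma det_column_difference:
  fixes c :: "'a :: comm_ring_1"
  assumes "A \<in> carrier_mat n n"
  shows "det (mat n n (\<lambda>(i, j). A $$ (i, j) - (if j = 0 then 0 else c * A $$ (i, j - 1)))) = det A"
proof -
  define U where "U = mat n n (\<lambda>(i, j). if i = j then 1 else if Suc i = j then - c else 0)"
  have U: "U \<in> carrier_mat n n" by (simp add: U_def)
  have "det U = prod_list (diag_mat U)"
    by (rule det_upper_triangular[OF _ U]) (auto simp: U_def upper_triangular_def)
  also have "diag_mat U = map (\<lambda>i. 1) [0..<n]"
    by (auto simp: diag_mat_def U_def)
  also have "prod_list \<dots> = 1" by (simp add: prod_list_replicate map_replicate_const)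
  finally have 1: "det U = 1" .
  have "mat n n (\<lambda>(i, j). A $$ (i, j) - (if j = 0 then 0 else c * A $$ (i, j - 1))) = A * U"
  proof (rule eq_matI)
    fix i j assume "i < dim_row (A * U)" "j < dim_col (A * U)"
    then have ij: "i < n" "j < n" using assms by (auto simp: U_def)
    then have "(A * U) $$ (i, j) = (\<Sum>t\<in>{0..<n}. A $$ (i, t) * U $$ (t, j))"
      using assms by (auto simp: U_def scalar_prod_def)
    also have "\<dots> = (\<Sum>t\<in>{0..<n}. (if t = j then A $$ (i, j) else 0) + (if Suc t = j then - c * A $$ (i, j - 1) else 0))"
      using ij by (intro sum.cong refl) (auto simp: U_def)
    also have "\<dots> = A $$ (i, j) + (\<Sum>t\<in>{0..<n}. if Suc t = j then - c * A $$ (i, j - 1) else 0)"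
      using ij by (simp add: sum.distrib)
    also have "(\<Sum>t\<in>{0..<n}. if Suc t = j then - c * A $$ (i, j - 1) else 0) =
        (if j = 0 then 0 else - c * A $$ (i, j - 1))"
      using ij by (cases j) auto
    finally show "mat n n (\<lambda>(i, j). A $$ (i, j) - (if j = 0 then 0 else c * A $$ (i, j - 1))) $$ (i, j) = (A * U) $$ (i, j)"
      using ij by simp
  qed (use assms in \<open>auto simp: U_def\<close>)
  then show ?thesis
    using det_mult[OF assms U] 1 by simp
qed

lemma det_unit_first_row:
  assumes "A \<in> carrier_mat (Suc n) (Suc n)"
    and "\<And>j. j < Suc n \<Longrightarrow> A $$ (0, j) = (if j = 0 then 1 else 0)"
  shows "det A = det (mat_delete A 0 0)"
proof -
  have "det A = (\<Sum>j<Suc n. A $$ (0, j) * cofactor A 0 j)"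
    by (rule laplace_expansion_row[OF assms(1)]) simp
  also have "\<dots> = (\<Sum>j<Suc n. if j = 0 then cofactor A 0 0 else 0)"
    by (intro sum.cong) (simp_all add: assms(2))
  finally show ?thesis by (simp add: cofactor_def)
qed

lemma fls_const_sign_mult: "fls_const ((-1) ^ j * x) = (-1) ^ j * fls_const (x :: 'a :: comm_ring_1)"
  by (cases "even j") (simp_all add: fls_const_hom.hom_uminus)

lemma mat_delete_mat:
  "mat_delete (mat (Suc n) (Suc n) f) i j =
    mat n n (\<lambda>(i', j'). f (if i' < i then i' else Suc i', if j' < j then j' else Suc j'))"
  by (rule eq_matI) (auto simp: mat_delete_def)

text \<open>
  Bordering the matrix of \<open>h\<^sub>m - h\<^bsub>m-1\<^esub>/z\<close> by the row \<open>1, 1/z, 1/z\<^sup>2, \<dots>\<close> gives, after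
  column operations, the matrix of \<open>h\<^bsub>m-1\<^esub>\<close>; multiplication with \<open>H = \<Sum> h\<^sub>m z\<^sup>m\<close> turns the
  coefficients of \<open>z\<^sup>n\<close> of that row into \<open>h\<^sub>n, h\<^bsub>n+1\<^esub>, \<dots>\<close>.
\<close>

lemma fls_nth_creation_jt_det:
  fixes H :: "'a :: comm_ring_1 fls"
  assumes H: "\<And>n. fls_nth H n = h n" and s: "s \<le> N"
  shows "fls_nth (H * det (mat N N (\<lambda>(i, j). fls_const (h (mu i + int j)) - fls_X_inv * fls_const (h (mu i + int j - 1))))) n =
    (-1) ^ s * jt_det h (Suc N) (\<lambda>b. if b < s then mu b - 1 else if b = s then n else mu (b - 1) - 1)"
proof -
  let ?M = "mat N N (\<lambda>(i, j). fls_const (h (mu i + int j)) - fls_X_inv * fls_const (h (mu i + int j - 1)))"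
  let ?skip = "\<lambda>j j'. if j' < j then j' else Suc j'"
  define B where "B = mat (Suc N) (Suc N) (\<lambda>(i, j). if i = 0 then fls_X_inv ^ j else fls_const (h (mu (i - 1) + int j - 1)))"
  define m where "m j = det (mat N N (\<lambda>(i, j'). h (mu i + int (?skip j j') - 1)))" for j
  have B: "B \<in> carrier_mat (Suc N) (Suc N)" by (simp add: B_def)
  let ?B = "mat (Suc N) (Suc N) (\<lambda>(i, j). B $$ (i, j) - (if j = 0 then 0 else fls_X_inv * B $$ (i, j - 1)))"
  have "det B = det ?B"
    by (rule det_column_difference[OF B, symmetric])
  also have "\<dots> = det (mat_delete ?B 0 0)"
    by (rule det_unit_first_row[of _ N]) (auto simp: B_def power_eq_if)
  also have "mat_delete ?B 0 0 = ?M"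
    unfolding mat_delete_mat by (rule eq_matI) (auto simp: B_def algebra_simps)
  finally have "det ?M = det B" ..
  also have "\<dots> = (\<Sum>j<Suc N. B $$ (0, j) * cofactor B 0 j)"
    by (rule laplace_expansion_row[OF B]) simp
  also have "\<dots> = (\<Sum>j<Suc N. fls_X_inv ^ j * fls_const ((-1) ^ j * m j))"
  proof (intro sum.cong refl arg_cong2[of _ _ _ _ times])
    fix j assume j: "j \<in> {..<Suc N}"
    then show "B $$ (0, j) = fls_X_inv ^ j" by (simp add: B_def)
    have "mat_delete B 0 j = map_mat fls_const (mat N N (\<lambda>(i, j'). h (mu i + int (?skip j j') - 1)))"
      unfolding B_def mat_delete_mat by (rule eq_matI) auto
    then show "cofactor B 0 j = fls_const ((-1) ^ j * m j)"
      by (simp add: cofactor_def m_def fls_const_sign_mult)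
  qed
  finally have "fls_nth (H * det ?M) n =
      (\<Sum>j<Suc N. fls_nth (fls_const ((-1) ^ j * m j) * (fls_X_inv ^ j * H)) n)"
    by (simp only: sum_distrib_left fls_nth_sum mult_ac)
  also have "\<dots> = (\<Sum>j<Suc N. (-1) ^ j * m j * h (n + int j))"
    by (simp only: fls_X_inv_power_times_conv_shift fls_mult_const_nth fls_shift_nth H)
  finally have lhs: "fls_nth (H * det ?M) n = (\<Sum>j<Suc N. (-1) ^ j * m j * h (n + int j))" .
  \<comment> \<open>Expansion along row s meets the minors \<open>m j\<close> again, since the other
    rows of \<open>?R\<close> are the rows of \<open>B\<close> below its border; the place of row s
    accounts for the sign (-1)^s.\<close>
  let ?nu = "\<lambda>b. if b < s then mu b - 1 else if b = s then n else mu (b - 1) - 1"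
  let ?R = "mat (Suc N) (Suc N) (\<lambda>(i, j). h (?nu i + int j))"
  have "jt_det h (Suc N) ?nu = (\<Sum>j<Suc N. ?R $$ (s, j) * cofactor ?R s j)"
    unfolding jt_det_def by (rule laplace_expansion_row) (use s in auto)
  also have "\<dots> = (\<Sum>j<Suc N. h (n + int j) * ((-1) ^ (s + j) * m j))"
  proof (intro sum.cong refl arg_cong2[of _ _ _ _ times])
    fix j assume j: "j \<in> {..<Suc N}"
    then show "?R $$ (s, j) = h (n + int j)" using s by simp
    have "mat_delete ?R s j = mat N N (\<lambda>(i, j'). h (mu i + int (?skip j j') - 1))"
      unfolding mat_delete_mat using s by (intro eq_matI) (auto simp: algebra_simps)
    then show "cofactor ?R s j = (-1) ^ (s + j) * m j"
      by (simp add: cofactor_def m_def)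
  qed
  finally have "(-1) ^ s * jt_det h (Suc N) ?nu = (\<Sum>j<Suc N. (-1) ^ j * m j * h (n + int j))"
    by (cases "even s") (simp_all add: power_add mult_ac sum_negf)
  with lhs show ?thesis by simp
qed

text \<open>
  With \<open>G\<^sub>m = \<Sum>\<^bsub>r\<ge>0\<^esub> h\<^bsub>m-r\<^esub> z\<^bsup>-r\<^esup>\<close>, column operations reduce the determinant of the
  \<open>G\<^bsub>mu i + j\<^esub>\<close> to one with only the first column changed. There, \<open>z\<^bsup>mu i\<^esup> G\<^bsub>mu i\<^esub>\<close> is a truncation
  of \<open>H\<close>, and the omitted tail contributes determinants with two equal columns in degrees below \<open>N\<close>.
\<close>

lemma fls_nth_annihilation_jt_det:
  fixes H :: "'a :: comm_ring_1 fls"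
  assumes H: "\<And>n. fls_nth H n = h n" and h0: "\<And>n. n < 0 \<Longrightarrow> h n = 0" and HK: "H * fps_to_fls K = 1"
    and n: "n < int (Suc N)"
  shows "fls_nth (fps_to_fls K * det (mat (Suc N) (Suc N)
      (\<lambda>(i, j). \<Sum>r\<le>nat (mu i + int j). fls_const (h (mu i + int j - int r)) * fls_X_inv ^ r))) n =
    (\<Sum>i<Suc N. if mu i = - n then (-1) ^ i * jt_det h N (\<lambda>b. (if b < i then mu b else mu (Suc b)) + 1) else 0)"
proof -
  define G where "G n = (\<Sum>r\<le>nat n. fls_const (h (n - int r)) * fls_X_inv ^ r)" for n
  define m where "m i = (-1) ^ i * jt_det h N (\<lambda>b. (if b < i then mu b else mu (Suc b)) + 1)" for i
  have nthG: "fls_nth (G n) t = (if t \<le> 0 then h (n + t) else 0)" for n t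
  proof -
    have "fls_nth (G n) t = (\<Sum>r\<le>nat n. if t = - int r then h (n + t) else 0)"
      unfolding G_def fls_nth_sum fls_X_inv_power_conv_shift_1
      by (intro sum.cong refl) auto
    also have "\<dots> = (if t \<le> 0 then h (n + t) else 0)"
    proof (cases "t \<le> 0")
      case True
      then obtain r where r: "t = - int r" by (metis neg_le_0_iff_le nonneg_int_cases minus_minus neg_0_le_iff_le)
      show ?thesis by (auto simp: r h0)
    qed auto
    finally show ?thesis .
  qed
  have G_diff: "G n - fls_X_inv * G (n - 1) = fls_const (h n)" for n
    by (rule fls_eqI) (auto simp: nthG fls_X_inv_times_conv_shift)
  let ?M = "mat (Suc N) (Suc N) (\<lambda>(i, j). G (mu i + int j))"
  let ?B = "mat (Suc N) (Suc N) (\<lambda>(i, j). if j = 0 then G (mu i) else fls_const (h (mu i + int j)))"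
  \<comment> \<open>Cofactors along column 0 do not involve that column, so \<open>g\<close> stays
    arbitrary; below it is the zero column and then a column of coefficients of H.\<close>
  have cof: "cofactor (mat (Suc N) (Suc N) (\<lambda>(i, j). if j = 0 then g i else h (mu i + int j))) i 0 = m i"
    if "i < Suc N" for g i
  proof -
    have "mat_delete (mat (Suc N) (Suc N) (\<lambda>(i, j). if j = 0 then g i else h (mu i + int j))) i 0 =
        mat N N (\<lambda>(i', j). h ((if i' < i then mu i' else mu (Suc i')) + 1 + int j))"
      unfolding mat_delete_mat using that by (intro eq_matI) (auto simp: algebra_simps)
    then show ?thesis by (simp add: cofactor_def m_def jt_det_def)
  qed
  have "det ?M = det ?B"
  proof -
    have "det ?M = det (mat (Suc N) (Suc N) (\<lambda>(i, j). ?M $$ (i, j) - (if j = 0 then 0 else fls_X_inv * ?M $$ (i, j - 1))))"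
      by (rule det_column_difference[symmetric]) simp
    also have "mat (Suc N) (Suc N) (\<lambda>(i, j). ?M $$ (i, j) - (if j = 0 then 0 else fls_X_inv * ?M $$ (i, j - 1))) = ?B"
    proof (rule eq_matI)
      fix i j assume "i < dim_row ?B" "j < dim_col ?B"
      then show "mat (Suc N) (Suc N) (\<lambda>(i, j). ?M $$ (i, j) - (if j = 0 then 0 else fls_X_inv * ?M $$ (i, j - 1))) $$ (i, j) = ?B $$ (i, j)"
        using G_diff[of "mu i + int j"] by (auto simp: of_nat_diff algebra_simps)
    qed auto
    finally show ?thesis .
  qed
  also have "\<dots> = (\<Sum>i<Suc N. ?B $$ (i, 0) * cofactor ?B i 0)"
    by (rule laplace_expansion_column) auto
  also have "\<dots> = (\<Sum>i<Suc N. G (mu i) * fls_const (m i))"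
  proof (intro sum.cong refl arg_cong2[of _ _ _ _ times])
    fix i assume i: "i \<in> {..<Suc N}"
    let ?Z = "mat (Suc N) (Suc N) (\<lambda>(i, j). if j = 0 then (0 :: 'a) else h (mu i + int j))"
    have "mat_delete ?B i 0 = map_mat fls_const (mat_delete ?Z i 0)"
      unfolding mat_delete_mat by (rule eq_matI) auto
    then show "cofactor ?B i 0 = fls_const (m i)"
      using cof[of i "\<lambda>_. 0"] i
      by (simp add: cofactor_def fls_const_sign_mult[symmetric])
  qed simp
  finally have detM: "det ?M = (\<Sum>i<Suc N. G (mu i) * fls_const (m i))" .
  \<comment> \<open>\<open>fls_shift (mu i) H\<close> is z^(- mu i) H, and \<open>G (mu i)\<close>
    is its part in degrees at most 0; \<open>T i\<close> is the omitted tail.\<close>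
  define T where "T i = fls_shift (mu i) H - G (mu i)" for i
  have nthT: "fls_nth (T i) t = (if 0 < t then h (mu i + t) else 0)" for i t
    by (simp add: T_def nthG H add.commute)
  define W where "W = (\<Sum>i<Suc N. T i * fls_const (m i))"
  have nthW: "fls_nth W t = 0" if "t < int (Suc N)" for t
  proof (cases "0 < t")
    case False
    then show ?thesis unfolding W_def fls_nth_sum by (simp add: nthT)
  next
    case True
    \<comment> \<open>In degree t with 0 < t \<le> N, the tail column coincides with column t of the
      matrix.\<close>
    let ?C = "mat (Suc N) (Suc N) (\<lambda>(i, j). if j = 0 then h (mu i + t) else h (mu i + int j))"
    have t: "nat t < Suc N" "nat t \<noteq> 0" "int (nat t) = t" using True that by auto
    have "fls_nth W t = (\<Sum>i<Suc N. ?C $$ (i, 0) * cofactor ?C i 0)"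
      unfolding W_def fls_nth_sum using True
      by (intro sum.cong) (simp_all add: nthT cof)
    also have "\<dots> = det ?C"
      by (rule laplace_expansion_column[symmetric]) auto
    also have "\<dots> = 0"
    proof (rule det_identical_columns[of _ _ 0 "nat t"])
      show "col ?C 0 = col ?C (nat t)"
        using t by (intro eq_vecI) auto
    qed (use t in auto)
    finally show ?thesis .
  qed
  \<comment> \<open>\<open>K\<close> has no negative powers, so the tail contributes only from
    degree N + 1 on, beyond n.\<close>
  have "fls_nth (fps_to_fls K * W) n = 0"
  proof (cases "W = 0")
    case False
    then have "int (Suc N) \<le> fls_subdegree W"
      by (intro fls_subdegree_geI nthW)
    then show ?thesis
      using n fls_subdegree_fls_to_fps_gt0[of K] by (intro fls_times_nth_eq0) linarith
  qed simp
  moreover have "det ?M = (\<Sum>i<Suc N. fls_shift (mu i) H * fls_const (m i)) - W"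
    unfolding detM W_def T_def by (simp only: sum_subtractf[symmetric] left_diff_distrib) simp
  \<comment> \<open>Once \<open>K\<close> has cancelled H, entry i of column 0 is the single power
    z^(- mu i), which is seen in degree n only if mu i = - n.\<close>
  moreover have "fps_to_fls K * (fls_shift (mu i) H * c) = fls_shift (mu i) 1 * c" for i c
    using HK by (simp add: mult.assoc[symmetric] fls_shifted_times_simps mult.commute)
  ultimately have "fls_nth (fps_to_fls K * det ?M) n = (\<Sum>i<Suc N. fls_nth (fls_shift (mu i) 1 * fls_const (m i)) n)"
    by (simp only: right_diff_distrib sum_distrib_left fls_nth_sum fls_minus_nth) simp
  also have "\<dots> = (\<Sum>i<Suc N. if mu i = - n then m i else 0)"
    by (intro sum.cong refl) (auto simp: add_eq_0_iff2)
  finally show ?thesis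
    unfolding G_def m_def .
qed

section \<open>Diagrams as sets of particles\<close>

lemma down_closed_nat_eq_lessThan:
  fixes S :: "nat set"
  assumes "finite S" "\<And>a a'. a \<in> S \<Longrightarrow> a' \<le> a \<Longrightarrow> a' \<in> S"
  shows "S = {..<card S}"
proof (cases "S = {}")
  case False
  have "S = {..Max S}"
    by (auto intro: Max_ge[OF assms(1)] assms(2)[OF Max_in[OF assms(1) False]])
  then have "S = {..<Suc (Max S)}" by (simp add: lessThan_Suc_atMost)
  then show ?thesis by (metis card_lessThan)
qed simp

text \<open>The beta-number of row b. With n + 1/2 encoded by n, it is the position of the particle
  of that row; for the empty diagram these are the negative integers.\<close>

definition row_beta :: "diagram \<Rightarrow> nat \<Rightarrow> int" where
  "row_beta lam b = int (row_length lam b) - int b - 1"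

definition particles :: "diagram \<Rightarrow> int set" where
  "particles lam = range (row_beta lam)"

lemma young_diagrams_rows:
  assumes "\<And>b b'. b \<le> b' \<Longrightarrow> r b' \<le> r b" "\<And>b. b \<ge> N \<Longrightarrow> r b = 0"
  shows "{(a, b). a < r b} \<in> young_diagrams"
proof -
  have "{(a, b). a < r b} \<subseteq> {..<r 0} \<times> {..<N}"
  proof clarsimp
    fix a b assume "a < r b"
    moreover have "r b \<le> r 0" by (rule assms(1)) simp
    ultimately show "a < r 0 \<and> b < N"
      using assms(2)[of b] by (cases "N \<le> b") auto
  qed
  then have "finite {(a, b). a < r b}"
    by (rule finite_subset) auto
  then show ?thesis
    unfolding young_diagrams_def
    by (auto intro: le_less_trans less_le_trans[OF _ assms(1)])
qed

lemma row_length_rows: "row_length {(a, b). a < r b} b = r b"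
  by (simp add: row_length_def)

lemma strict_antimono_nat_int_less_iff:
  fixes f :: "nat \<Rightarrow> int"
  assumes "strict_antimono_on UNIV f"
  shows "f b < f b' \<longleftrightarrow> b' < b" "f b = f b' \<longleftrightarrow> b = b'"
  using monotoneD[OF assms, of b b'] monotoneD[OF assms, of b' b] by (cases b b' rule: linorder_cases; simp; linarith)+

text \<open>The index of an element is read off from the range alone, so a decreasing enumeration is
  determined by its range.\<close>

lemma card_greater_strict_antimono:
  fixes f :: "nat \<Rightarrow> int"
  assumes "strict_antimono_on UNIV f"
  shows "card {n \<in> range f. n > f b} = b"
proof -
  have "{n \<in> range f. n > f b} = f ` {..<b}"
    using strict_antimono_nat_int_less_iff[OF assms] by auto
  moreover have "inj f"
    using strict_antimono_nat_int_less_iff(2)[OF assms] by (auto intro!: injI)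
  ultimately show ?thesis
    by (simp add: card_image inj_on_subset)
qed

lemma strict_antimono_range_eq:
  fixes f g :: "nat \<Rightarrow> int"
  assumes "strict_antimono_on UNIV f" "strict_antimono_on UNIV g"
    and "range f = range g"
  shows "f = g"
proof
  fix b
  obtain b' where b': "f b = g b'" using assms(3) by (metis rangeE rangeI)
  have "b = b'"
    using card_greater_strict_antimono[OF assms(1), of b]
      card_greater_strict_antimono[OF assms(2), of b'] by (simp add: assms(3) b')
  with b' show "f b = g b" by simp
qed

context
  fixes lam assumes lam: "lam \<in> young_diagrams"
begin

lemma in_diagram_iff: "(a, b) \<in> lam \<longleftrightarrow> a < row_length lam b"
proof -
  have "finite {a. (a, b) \<in> lam}"
    by (rule finite_subset[of _ "fst ` lam"]) (use lam in \<open>force simp: young_diagrams_def\<close>)+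
  then have "{a. (a, b) \<in> lam} = {..<card {a. (a, b) \<in> lam}}"
    by (rule down_closed_nat_eq_lessThan) (use lam in \<open>auto simp: young_diagrams_def\<close>)
  then show ?thesis by (auto simp: row_length_def)
qed

lemma in_diagram_column_0_iff: "(0, b) \<in> lam \<longleftrightarrow> b < num_rows lam"
proof -
  have "finite {b. (0, b) \<in> lam}"
    by (rule finite_subset[of _ "snd ` lam"]) (use lam in \<open>force simp: young_diagrams_def\<close>)+
  then have "{b. (0, b) \<in> lam} = {..<card {b. (0, b) \<in> lam}}"
    by (rule down_closed_nat_eq_lessThan) (use lam in \<open>auto simp: young_diagrams_def\<close>)
  then show ?thesis by (auto simp: num_rows_def)
qed

lemma row_length_antimono: "b \<le> b' \<Longrightarrow> row_length lam b' \<le> row_length lam b"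
proof (rule ccontr)
  assume "b \<le> b'" "\<not> row_length lam b' \<le> row_length lam b"
  then have "(row_length lam b, b') \<in> lam" "(row_length lam b, b) \<notin> lam"
    by (simp_all add: in_diagram_iff)
  then show False using lam \<open>b \<le> b'\<close> by (auto simp: young_diagrams_def)
qed

lemma row_length_eq_0: "num_rows lam \<le> b \<Longrightarrow> row_length lam b = 0"
  using in_diagram_iff[of 0 b] in_diagram_column_0_iff[of b] by simp

lemma row_beta_strict_antimono: "strict_antimono_on UNIV (row_beta lam)"
proof (rule monotoneI)
  fix b b' :: nat assume "b < b'"
  then show "row_beta lam b' < row_beta lam b"
    using row_length_antimono[of b b'] by (simp add: row_beta_def)
qed

lemmas row_beta_less_iff = strict_antimono_nat_int_less_iff[OF row_beta_strict_antimono]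

lemma row_beta_ge: "- int b - 1 \<le> row_beta lam b"
  by (simp add: row_beta_def)

lemma finite_row_beta_ge: "finite {b. n \<le> row_beta lam b}"
proof (rule finite_subset)
  show "{b. n \<le> row_beta lam b} \<subseteq> {..num_rows lam + nat (- n)}"
  proof
    fix b assume b: "b \<in> {b. n \<le> row_beta lam b}"
    show "b \<in> {..num_rows lam + nat (- n)}"
      using b row_length_eq_0[of b] by (cases "num_rows lam \<le> b") (auto simp: row_beta_def)
  qed
qed simp

text \<open>Row b has a node of content n when n + b \<ge> 0 and n \<le>
  \<open>row_beta lam b\<close>. The - n rows with b < - n always satisfy the second condition;
  \<open>min n 0\<close> removes them.\<close>

lemma content_count_eq: "content_count n lam = int (card {b. n \<le> row_beta lam b}) + min n 0"
proof -
  let ?S = "{b. n \<le> row_beta lam b \<and> 0 \<le> int b + n}"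
  have "bij_betw snd {x \<in> lam. node_content x = n} ?S"
    by (rule bij_betwI[where g = "\<lambda>b. (nat (int b + n), b)"])
      (auto simp: in_diagram_iff node_content_def row_beta_def)
  then have "content_count n lam = int (card ?S)"
    by (simp add: content_count_def bij_betw_same_card)
  moreover have "{b. n \<le> row_beta lam b} = ?S \<union> {..<nat (- n)}"
  proof (rule Set.set_eqI)
    fix b
    show "b \<in> {b. n \<le> row_beta lam b} \<longleftrightarrow> b \<in> ?S \<union> {..<nat (- n)}"
      using row_beta_ge[of b] by auto
  qed
  moreover have "card (?S \<union> {..<nat (- n)}) = card ?S + nat (- n)"
    by (subst card_Un_disjoint) (use finite_subset[OF _ finite_row_beta_ge[of n]] in auto)
  ultimately show ?thesis by simp
qed

lemma content_count_diff:
  "content_count n lam - content_count (n + 1) lam = of_bool (n \<in> particles lam) - of_bool (n < 0)"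
proof -
  have "int (card {b. n \<le> row_beta lam b}) = int (card {b. n + 1 \<le> row_beta lam b}) + of_bool (n \<in> particles lam)"
  proof (cases "n \<in> particles lam")
    case True
    then obtain b where b: "n = row_beta lam b" by (auto simp: particles_def)
    have "{b. n \<le> row_beta lam b} = insert b {b. n + 1 \<le> row_beta lam b}"
    proof (rule Set.set_eqI)
      fix x
      show "x \<in> {b. n \<le> row_beta lam b} \<longleftrightarrow> x \<in> insert b {b. n + 1 \<le> row_beta lam b}"
        using row_beta_less_iff(2)[of b x] by (auto simp: b)
    qed
    then show ?thesis
      using True finite_row_beta_ge[of "n + 1"] by (simp add: card_insert_if) (simp add: b)
  next
    case False
    then have "{b. n \<le> row_beta lam b} = {b. n + 1 \<le> row_beta lam b}"
      by (auto simp: particles_def add1_zle_eq le_less)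
    with False show ?thesis by simp
  qed
  then show ?thesis by (simp add: content_count_eq)
qed

lemma maya_of_eq: "maya_of lam n = (if n \<in> particles lam then -1 else 1)"
  using content_count_diff[of n] by (auto simp: maya_of_def Let_def)

end

lemma young_diagrams_eq_iff:
  assumes "lam \<in> young_diagrams" "mu \<in> young_diagrams"
  shows "particles lam = particles mu \<longleftrightarrow> lam = mu"
proof
  assume "particles lam = particles mu"
  then have "row_beta lam = row_beta mu"
    unfolding particles_def by (intro strict_antimono_range_eq row_beta_strict_antimono assms)
  then have "row_length lam b = row_length mu b" for b
    by (auto simp: row_beta_def fun_eq_iff)
  then show "lam = mu"
    using in_diagram_iff[OF assms(1)] in_diagram_iff[OF assms(2)] by auto
qed simp

section \<open>Maya sets, their charges and their diagrams\<close>

definition maya_set :: "int set \<Rightarrow> bool" where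
  "maya_set P \<longleftrightarrow> (\<exists>K. (\<forall>n\<ge>K. n \<notin> P) \<and> (\<forall>n. n < - K \<longrightarrow> n \<in> P))"

definition set_charge :: "int set \<Rightarrow> int" where
  "set_charge P = int (card {n. n \<ge> 0 \<and> n \<in> P}) - int (card {n. n < 0 \<and> n \<notin> P})"

lemma set_charge_sum:
  assumes "\<And>n. n \<ge> b \<Longrightarrow> n \<notin> P" "\<And>n. n < a \<Longrightarrow> n \<in> P" "a \<le> 0" "0 \<le> b"
  shows "set_charge P = (\<Sum>n\<in>{a..<b}. of_bool (n \<in> P) - of_bool (n < 0))"
proof -
  have eq: "{n. n \<ge> 0 \<and> n \<in> P} = {n \<in> {a..<b}. n \<ge> 0 \<and> n \<in> P}"
    "{n. n < 0 \<and> n \<notin> P} = {n \<in> {a..<b}. n < 0 \<and> n \<notin> P}"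
    using assms by (auto simp: not_less[symmetric])
  have "set_charge P = (\<Sum>n\<in>{a..<b}. of_bool (n \<ge> 0 \<and> n \<in> P)) - (\<Sum>n\<in>{a..<b}. of_bool (n < 0 \<and> n \<notin> P))"
    unfolding set_charge_def eq by (simp add: Int_def)
  also have "\<dots> = (\<Sum>n\<in>{a..<b}. of_bool (n \<in> P) - of_bool (n < 0))"
    by (subst sum_subtractf[symmetric], rule sum.cong) auto
  finally show ?thesis .
qed

text \<open>Outside the window P agrees with the vacuum of negative integers, which has - a
  particles inside the window.\<close>

lemma set_charge_card:
  assumes "\<And>n. n \<ge> b \<Longrightarrow> n \<notin> P" "\<And>n. n < a \<Longrightarrow> n \<in> P" "a \<le> 0" "0 \<le> b"
  shows "set_charge P = int (card (P \<inter> {a..<b})) + a"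
proof -
  have "{a..<b} \<inter> {n. n < 0} = {a..<0}"
    using assms(4) by auto
  then have "(\<Sum>n\<in>{a..<b}. of_bool (n < 0) :: int) = int (card {a..<0})"
    by simp
  then show ?thesis
    using assms(3) by (simp add: set_charge_sum[OF assms] sum_subtractf Int_commute)
qed

lemma maya_setE:
  assumes "maya_set P"
  obtains K where "0 \<le> K" "\<And>n. n \<ge> K \<Longrightarrow> n \<notin> P" "\<And>n. n < - K \<Longrightarrow> n \<in> P"
proof -
  from assms obtain K where "\<forall>n\<ge>K. n \<notin> P" "\<forall>n. n < - K \<longrightarrow> n \<in> P"
    by (auto simp: maya_set_def)
  then show ?thesis by (intro that[of "max K 0"]) auto
qed

lemma maya_set_insert: "maya_set P \<Longrightarrow> maya_set (insert p P)"
proof (erule maya_setE)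
  fix K assume "0 \<le> K" "\<And>n. n \<ge> K \<Longrightarrow> n \<notin> P" "\<And>n. n < - K \<Longrightarrow> n \<in> P"
  then show ?thesis
    unfolding maya_set_def by (intro exI[of _ "max K (p + 1)"]) auto
qed

lemma maya_set_remove: "maya_set P \<Longrightarrow> maya_set (P - {p})"
proof (erule maya_setE)
  fix K assume "0 \<le> K" "\<And>n. n \<ge> K \<Longrightarrow> n \<notin> P" "\<And>n. n < - K \<Longrightarrow> n \<in> P"
  then show ?thesis
    unfolding maya_set_def by (intro exI[of _ "max K (- p)"]) auto
qed

lemma set_charge_insert:
  assumes "maya_set P" "p \<notin> P"
  shows "set_charge (insert p P) = set_charge P + 1"
proof -
  from assms(1) obtain K where K: "0 \<le> K" "\<And>n. n \<ge> K \<Longrightarrow> n \<notin> P" "\<And>n. n < - K \<Longrightarrow> n \<in> P"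
    by (rule maya_setE) blast
  have p: "- K \<le> p" using K(3)[of p] assms(2) by force
  \<comment> \<open>The window is widened on the right to contain p; on the left - K suffices
    because p is a hole.\<close>
  let ?b = "max K (p + 1)"
  have "set_charge P = int (card (P \<inter> {- K..<?b})) + - K"
    by (rule set_charge_card) (use K in auto)
  moreover have "set_charge (insert p P) = int (card (insert p P \<inter> {- K..<?b})) + - K"
    by (rule set_charge_card) (use K in auto)
  moreover have "insert p P \<inter> {- K..<?b} = insert p (P \<inter> {- K..<?b})"
    using p by auto
  ultimately show ?thesis using assms(2) by simp
qed

lemma set_charge_remove:
  assumes "maya_set P" "p \<in> P"
  shows "set_charge (P - {p}) = set_charge P - 1"
  using set_charge_insert[OF maya_set_remove[OF assms(1)], of p p] assms(2)
  by (simp add: insert_absorb)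

lemma maya_set_range:
  assumes "maya_set P"
  obtains f :: "nat \<Rightarrow> int" where "strict_antimono_on UNIV f" "range f = P"
proof -
  from assms obtain K where K: "0 \<le> K" "\<And>n. n \<ge> K \<Longrightarrow> n \<notin> P" "\<And>n. n < - K \<Longrightarrow> n \<in> P"
    by (rule maya_setE) blast
  \<comment> \<open>Reflection at K turns P into an infinite set of naturals; its increasing
    enumeration is reflected back into a decreasing one.\<close>
  define S where "S = {t. K - 1 - int t \<in> P}"
  have "{nat (2 * K)..} \<subseteq> S"
    using K by (auto simp: S_def)
  then have inf: "infinite S"
    using infinite_Ici infinite_super by blast
  define f where "f b = K - 1 - int (enumerate S b)" for b
  show ?thesis
  proof
    show "strict_antimono_on UNIV f"
      using enumerate_mono[OF _ inf] by (simp add: f_def monotone_def)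
    have "range f = (\<lambda>t. K - 1 - int t) ` S"
      using range_enumerate[OF inf] by (auto simp: f_def image_iff) (metis rangeE)
    also have "\<dots> = P"
    proof
      show "P \<subseteq> (\<lambda>t. K - 1 - int t) ` S"
      proof
        fix n assume n: "n \<in> P"
        then have "n < K" using K(2)[of n] by (cases "K \<le> n") auto
        with n show "n \<in> (\<lambda>t. K - 1 - int t) ` S"
          by (intro image_eqI[of _ _ "nat (K - 1 - n)"]) (auto simp: S_def)
      qed
    qed (auto simp: S_def)
    finally show "range f = P" .
  qed
qed

text \<open>
  Counting the particles above a position below all holes shows that an enumeration of \<open>P\<close>
  eventually is \<open>b \<mapsto> set_charge P - b - 1\<close>.
\<close>

lemma strict_antimono_eventually:
  assumes "maya_set P" "strict_antimono_on UNIV f" "range f = P"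
  shows "\<exists>N. \<forall>b\<ge>N. f b = set_charge P - int b - 1"
proof -
  from assms(1) obtain K where K: "0 \<le> K" "\<And>n. n \<ge> K \<Longrightarrow> n \<notin> P" "\<And>n. n < - K \<Longrightarrow> n \<in> P"
    by (rule maya_setE) blast
  have le: "f b \<le> K - 1 - int b" for b
  proof (induction b)
    case 0
    have "f 0 \<in> P" using assms(3) by auto
    then have "f 0 < K" using K(2)[of "f 0"] by (cases "K \<le> f 0") auto
    then show ?case by simp
  next
    case (Suc b)
    then show ?case using monotoneD[OF assms(2), of b "Suc b"] by simp
  qed
  \<comment> \<open>From b = 2 K on, the bound \<open>le\<close> puts \<open>f b\<close> below every
    hole, so a window may start at \<open>f b + 1\<close>.\<close>
  have "f b = set_charge P - int b - 1" if b: "nat (2 * K) \<le> b" for b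
  proof -
    have fb: "f b < - K" using le[of b] b K(1) by linarith
    have "set_charge P = int (card (P \<inter> {f b + 1..<K})) + (f b + 1)"
      by (rule set_charge_card) (use K fb in auto)
    also have "P \<inter> {f b + 1..<K} = {n \<in> range f. n > f b}"
    proof -
      have "n < K" if "n \<in> P" for n
        using K(2)[of n] that by (cases "K \<le> n") auto
      then show ?thesis by (auto simp: assms(3))
    qed
    also have "card \<dots> = b"
      by (rule card_greater_strict_antimono[OF assms(2)])
    finally show ?thesis by simp
  qed
  then show ?thesis by blast
qed

text \<open>Row lengths are the excess of the enumeration over the vacuum value c - b - 1. Strict
  decrease makes them weakly decreasing, and eventual equality makes them nonnegative and finally
  0.\<close>

lemma charged_diagram_exists:
  assumes "maya_set P"
  obtains lam where "lam \<in> young_diagrams" "particles lam = {n. n + set_charge P \<in> P}"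
proof -
  obtain f :: "nat \<Rightarrow> int" where f: "strict_antimono_on UNIV f" "range f = P"
    using maya_set_range[OF assms] by blast
  let ?c = "set_charge P"
  obtain N where N: "\<And>b. b \<ge> N \<Longrightarrow> f b = ?c - int b - 1"
    using strict_antimono_eventually[OF assms f] by blast
  have mono: "f b' + int b' \<le> f b + int b" if "b \<le> b'" for b b'
    using that
  proof (induction b' rule: dec_induct)
    case (step n)
    then show ?case using monotoneD[OF f(1), of n "Suc n"] by simp
  qed simp
  define r where "r b = nat (f b + int b + 1 - ?c)" for b
  have r: "int (r b) = f b + int b + 1 - ?c" for b
    using mono[of b "max b N"] N[of "max b N"] by (simp add: r_def)
  define lam where "lam = {(a, b). a < r b}"
  show ?thesis
  proof
    show "lam \<in> young_diagrams"
      unfolding lam_def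
    proof (rule young_diagrams_rows)
      show "r b' \<le> r b" if "b \<le> b'" for b b'
        using mono[OF that] r[of b] r[of b'] by linarith
      show "r b = 0" if "b \<ge> N" for b
        using r[of b] N[OF that] by simp
    qed
    have "row_beta lam b = f b - ?c" for b
      by (simp add: row_beta_def lam_def row_length_rows r)
    then have "particles lam = (\<lambda>n. n - ?c) ` P"
      unfolding particles_def f(2)[symmetric] by (simp add: image_image)
    then show "particles lam = {n. n + ?c \<in> P}"
      by (force simp: image_iff)
  qed
qed

definition set_diagram :: "int set \<Rightarrow> diagram" where
  "set_diagram P = maya_diagram (\<lambda>n. if n \<in> P then -1 else 1)"

lemma charge_eq_set_charge: "charge (\<lambda>n. if n \<in> P then -1 else 1) = set_charge P"
  unfolding charge_def set_charge_def by (intro arg_cong2[of _ _ _ _ minus] arg_cong[of _ _ "\<lambda>A. int (card A)"]) auto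

lemma maya_of_charged_eq_iff:
  assumes "lam \<in> young_diagrams"
  shows "maya_of_charged (c, lam) = (\<lambda>n. if n \<in> P then -1 else 1) \<longleftrightarrow> particles lam = {n. n + c \<in> P}"
proof -
  have "maya_of_charged (c, lam) = (\<lambda>n. if n \<in> P then -1 else 1) \<longleftrightarrow> (\<forall>n. n - c \<in> particles lam \<longleftrightarrow> n \<in> P)"
    by (auto simp: maya_of_charged_def maya_shift_def fun_eq_iff maya_of_eq[OF assms] split: if_splits)
  also have "\<dots> \<longleftrightarrow> particles lam = {n. n + c \<in> P}"
    by (metis (mono_tags, lifting) add_diff_cancel_right' diff_add_cancel mem_Collect_eq subsetI subset_antisym)
  finally show ?thesis .
qed

text \<open>\<open>maya_diagram\<close> is a definite description; injectivity of
  \<open>particles\<close> on diagrams resolves it.\<close>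

lemma set_diagram_unique:
  assumes "lam \<in> young_diagrams" "particles lam = {n. n + set_charge P \<in> P}"
  shows "set_diagram P = lam"
  unfolding set_diagram_def maya_diagram_def charge_eq_set_charge
proof (rule the_equality)
  fix mu assume "mu \<in> young_diagrams \<and> maya_of_charged (set_charge P, mu) = (\<lambda>n. if n \<in> P then -1 else 1)"
  then show "mu = lam"
    using maya_of_charged_eq_iff[of mu "set_charge P" P] assms young_diagrams_eq_iff[of mu lam] by blast
qed (use assms maya_of_charged_eq_iff in blast)

lemma set_diagram:
  assumes "maya_set P"
  shows "set_diagram P \<in> young_diagrams" "particles (set_diagram P) = {n. n + set_charge P \<in> P}"
  using charged_diagram_exists[OF assms] set_diagram_unique by metis+

text \<open>The decreasing enumeration of P, obtained by undoing the charge shift of the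
  beta-numbers. It labels the rows of a Schur determinant by particle positions.\<close>

definition maya_enum :: "int set \<Rightarrow> nat \<Rightarrow> int" where
  "maya_enum P b = row_beta (set_diagram P) b + set_charge P"

context
  fixes P assumes P: "maya_set P"
begin

lemma image_shift: "(\<lambda>n. n + c) ` {n. n + c \<in> A} = (A :: int set)"
proof
  show "A \<subseteq> (\<lambda>n. n + c) ` {n. n + c \<in> A}"
  proof
    fix x assume "x \<in> A"
    then show "x \<in> (\<lambda>n. n + c) ` {n. n + c \<in> A}"
      by (intro image_eqI[of _ _ "x - c"]) auto
  qed
qed auto

lemma maya_enum_strict_antimono: "strict_antimono_on UNIV (maya_enum P)"
  using row_beta_strict_antimono[OF set_diagram(1)[OF P]] by (simp add: maya_enum_def monotone_def)

lemma range_maya_enum: "range (maya_enum P) = P"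
proof -
  have "range (maya_enum P) = (\<lambda>n. n + set_charge P) ` particles (set_diagram P)"
    by (simp add: maya_enum_def[abs_def] particles_def image_image)
  then show ?thesis
    by (simp add: set_diagram(2)[OF P] image_shift)
qed

lemma maya_enum_unique:
  assumes "strict_antimono_on UNIV f" "range f = P"
  shows "maya_enum P = f"
  by (rule strict_antimono_range_eq[OF maya_enum_strict_antimono assms(1)])
    (simp_all add: assms(2) range_maya_enum)

lemmas maya_enum_less_iff = strict_antimono_nat_int_less_iff[OF maya_enum_strict_antimono]

lemma maya_enum_less_iff_card: "p < maya_enum P b \<longleftrightarrow> b < card {q \<in> P. q > p}"
proof -
  let ?S = "{b. p < maya_enum P b}"
  have fin: "finite {q \<in> P. q > p}"
  proof -
    obtain K where K: "\<And>n. n \<ge> K \<Longrightarrow> n \<notin> P" using P by (rule maya_setE) blast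
    have "q < K" if "q \<in> P" for q
      using K[of q] that by (cases "K \<le> q") auto
    then have "{q \<in> P. q > p} \<subseteq> {p..K}" by force
    then show ?thesis by (rule finite_subset) simp
  qed
  have "maya_enum P ` ?S = {q \<in> range (maya_enum P). q > p}"
    by auto
  then have img: "maya_enum P ` ?S = {q \<in> P. q > p}"
    by (simp only: range_maya_enum)
  have inj: "inj_on (maya_enum P) ?S"
    using maya_enum_less_iff(2) by (auto intro!: inj_onI)
  have "finite ?S" using fin img inj by (metis finite_imageD)
  moreover have "card ?S = card {q \<in> P. q > p}"
    using card_image[OF inj] img by simp
  moreover have "a' \<in> ?S" if "a \<in> ?S" "a' \<le> a" for a a'
    using that maya_enum_less_iff(1)[of a a'] by (cases "a = a'") auto
  ultimately show ?thesis
    using down_closed_nat_eq_lessThan[of ?S] by auto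
qed

end

text \<open>The new particle takes as index the number of particles to its right. This is the row
  pattern produced by \<open>fls_nth_creation_jt_det\<close>.\<close>

lemma maya_enum_insert:
  assumes "maya_set P" "p \<notin> P"
  defines "s \<equiv> card {q \<in> P. q > p}"
  shows "maya_enum (insert p P) b =
    (if b < s then maya_enum P b else if b = s then p else maya_enum P (b - 1))"
proof -
  let ?f = "\<lambda>b. if b < s then maya_enum P b else if b = s then p else maya_enum P (b - 1)"
  have gt: "p < maya_enum P b \<longleftrightarrow> b < s" for b
    unfolding s_def by (rule maya_enum_less_iff_card[OF assms(1)])
  have lt: "maya_enum P b < p \<longleftrightarrow> s \<le> b" for b
    using gt[of b] assms(2) range_maya_enum[OF assms(1)]
    by (metis linorder_neqE_linordered_idom not_le not_less_iff_gr_or_eq rangeI)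
  have "p \<in> range ?f" by (rule range_eqI[of _ _ s]) simp
  moreover have "maya_enum P b \<in> range ?f" for b
  proof (cases "b < s")
    case True
    then show ?thesis by (intro range_eqI[of _ _ b]) simp
  next
    case False
    then show ?thesis by (intro range_eqI[of _ _ "Suc b"]) simp
  qed
  moreover have "n \<in> range ?f" if "n \<in> P" for n
    using that calculation(2) range_maya_enum[OF assms(1)] by (metis (no_types, lifting) rangeE)
  moreover have "range ?f \<subseteq> insert p P"
    using range_maya_enum[OF assms(1)] by auto
  ultimately have "range ?f = insert p P"
    by blast
  then have "maya_enum (insert p P) = ?f"
    by (intro maya_enum_unique[OF maya_set_insert[OF assms(1)]])
      (auto intro!: monotoneI simp: maya_enum_less_iff[OF assms(1)] gt lt)
  then show ?thesis by simp
qed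

lemma maya_enum_remove:
  assumes "maya_set P"
  shows "maya_enum (P - {maya_enum P i}) b = (if b < i then maya_enum P b else maya_enum P (Suc b))"
proof -
  note P' = maya_set_remove[OF assms, of "maya_enum P i"]
  let ?f = "\<lambda>b. if b < i then maya_enum P b else maya_enum P (Suc b)"
  have "range ?f = P - {maya_enum P i}"
  proof
    show "range ?f \<subseteq> P - {maya_enum P i}"
      using range_maya_enum[OF assms] by (auto simp: maya_enum_less_iff[OF assms])
    show "P - {maya_enum P i} \<subseteq> range ?f"
    proof
      fix n assume n: "n \<in> P - {maya_enum P i}"
      then obtain b where b: "n = maya_enum P b" "b \<noteq> i"
        using range_maya_enum[OF assms] by blast
      show "n \<in> range ?f"
      proof (cases "b < i")
        case True
        then show ?thesis by (intro range_eqI[of _ _ b]) (simp add: b)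
      next
        case False
        then show ?thesis using b by (intro range_eqI[of _ _ "b - 1"]) auto
      qed
    qed
  qed
  then have "maya_enum (P - {maya_enum P i}) = ?f"
    by (intro maya_enum_unique[OF P']) (auto intro!: monotoneI simp: maya_enum_less_iff[OF assms])
  then show ?thesis by simp
qed

section \<open>Runners\<close>

lemma row_length_insert:
  assumes lam: "lam \<in> young_diagrams" and mu: "insert (a, b) lam \<in> young_diagrams" and new: "(a, b) \<notin> lam"
  shows "row_length lam b = a" "row_length (insert (a, b) lam) = (row_length lam)(b := Suc a)"
proof -
  let ?mu = "insert (a, b) lam"
  have *: "a' < row_length ?mu b' \<longleftrightarrow> a' = a \<and> b' = b \<or> a' < row_length lam b'" for a' b'
    using in_diagram_iff[OF lam] in_diagram_iff[OF mu] by auto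
  have "a \<ge> row_length lam b"
    using new in_diagram_iff[OF lam] by simp
  moreover have "\<not> row_length lam b < a"
    using *[of "row_length lam b" b] *[of a b] by auto
  ultimately show a: "row_length lam b = a" by simp
  show "row_length ?mu = (row_length lam)(b := Suc a)"
  proof
    fix b'
    show "row_length ?mu b' = ((row_length lam)(b := Suc a)) b'"
      using *[of "row_length ?mu b'" b'] *[of "((row_length lam)(b := Suc a)) b'" b'] a
      by (cases "b' = b") (auto simp: less_Suc_eq *[of a b])
  qed
qed

text \<open>Only the row of x changes, and its beta-number rises by one: a particle hops one step to
  the right, onto the content of x.\<close>

lemma particles_insert:
  assumes "lam \<in> young_diagrams" "insert x lam \<in> young_diagrams" "x \<notin> lam"
  shows "row_beta lam (snd x) = node_content x - 1"
    and "node_content x \<notin> particles lam"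
    and "particles (insert x lam) = insert (node_content x) (particles lam - {node_content x - 1})"
proof -
  obtain a b where x [simp]: "x = (a, b)" by force
  note rl = row_length_insert[OF assms(1) assms(2,3)[unfolded x]]
  have b: "row_beta (insert x lam) = (row_beta lam)(b := node_content x)"
    by (auto simp: row_beta_def rl node_content_def fun_eq_iff)
  show 1: "row_beta lam (snd x) = node_content x - 1"
    by (simp add: row_beta_def rl(1) node_content_def)
  have inj: "inj (row_beta lam)"
    using row_beta_less_iff(2)[OF assms(1)] by (auto intro: injI)
  \<comment> \<open>Otherwise two rows of the larger diagram would share a beta-number.\<close>
  show "node_content x \<notin> particles lam"
  proof
    assume "node_content x \<in> particles lam"
    then obtain b' where b': "row_beta lam b' = node_content x" by (auto simp: particles_def)
    with 1 have "b' \<noteq> b" by auto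
    then have "row_beta (insert x lam) b' = row_beta (insert x lam) b"
      by (simp only: b fun_upd_apply b') simp
    with \<open>b' \<noteq> b\<close> row_beta_less_iff(2)[OF assms(2)] show False by blast
  qed
  have "particles lam = insert (node_content x - 1) (row_beta lam ` (- {b}))"
    unfolding particles_def using 1 by (auto simp: image_iff) (metis)
  moreover have "node_content x - 1 \<notin> row_beta lam ` (- {b})"
    using 1 injD[OF inj] by auto
  ultimately have "particles lam - {node_content x - 1} = row_beta lam ` (- {b})"
    by auto
  moreover have "particles (insert x lam) = insert (node_content x) (row_beta lam ` (- {b}))"
    unfolding particles_def b by auto
  ultimately show "particles (insert x lam) = insert (node_content x) (particles lam - {node_content x - 1})"
    by simp
qed

lemma particles_remove:
  assumes "lam \<in> young_diagrams" "lam - {x} \<in> young_diagrams" "x \<in> lam"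
  shows "row_beta lam (snd x) = node_content x"
    and "node_content x - 1 \<notin> particles lam"
    and "particles (lam - {x}) = insert (node_content x - 1) (particles lam - {node_content x})"
proof -
  have ins: "insert x (lam - {x}) = lam" using assms(3) by auto
  note * = particles_insert[of "lam - {x}" x, unfolded ins, OF assms(2,1)]
  have mem: "node_content x - 1 \<in> particles (lam - {x})"
    using *(1) by (auto simp: particles_def) (metis rangeI)
  obtain a b where x: "x = (a, b)" by force
  have "row_length lam b = Suc a"
    using row_length_insert(2)[of "lam - {x}" a b] ins assms by (simp add: x)
  then show "row_beta lam (snd x) = node_content x"
    by (simp add: row_beta_def node_content_def x)
  show "node_content x - 1 \<notin> particles lam" "particles (lam - {x}) = insert (node_content x - 1) (particles lam - {node_content x})"
    using * mem by auto
qed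

text \<open>The node goes to the end of the row whose particle sits at j - 1. As j is free, the
  preceding row, if any, has beta-number at least j + 1 and is strictly longer, so the result is a
  diagram.\<close>

lemma addable_node_exists:
  assumes lam: "lam \<in> young_diagrams" and j: "j - 1 \<in> particles lam" "j \<notin> particles lam"
  obtains x where "x \<notin> lam" "insert x lam \<in> young_diagrams" "node_content x = j"
proof -
  obtain b where b: "j - 1 = row_beta lam b" using j(1) by (auto simp: particles_def)
  let ?r = "row_length lam" and ?x = "(row_length lam b, b)"
  have step: "?r (b - 1) \<ge> ?r b + 1" if "0 < b"
  proof -
    have "row_beta lam (b - 1) > row_beta lam b" using row_beta_less_iff(1)[OF lam] that by simp
    moreover have "row_beta lam (b - 1) \<noteq> j" using j(2) by (auto simp: particles_def)
    ultimately have "row_beta lam (b - 1) \<ge> row_beta lam b + 2" using b by linarith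
    then show ?thesis using that by (simp add: row_beta_def)
  qed
  show ?thesis
  proof
    show "?x \<notin> lam" by (simp add: in_diagram_iff[OF lam])
    show "node_content ?x = j" using b by (simp add: node_content_def row_beta_def)
    have "insert ?x lam = {(a', b'). a' < (?r(b := Suc (?r b))) b'}"
      using in_diagram_iff[OF lam] by auto
    also have "\<dots> \<in> young_diagrams"
    proof (rule young_diagrams_rows)
      fix b' b'' :: nat assume le: "b' \<le> b''"
      show "(?r(b := Suc (?r b))) b'' \<le> (?r(b := Suc (?r b))) b'"
      proof (cases "b'' = b \<and> b' \<noteq> b")
        case True
        then have "?r (b - 1) \<le> ?r b'" using le by (intro row_length_antimono[OF lam]) auto
        with step True le show ?thesis by simp
      next
        case False
        with row_length_antimono[OF lam le] show ?thesis by auto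
      qed
    next
      fix b' assume "b' \<ge> num_rows lam + Suc b"
      then show "(?r(b := Suc (?r b))) b' = 0"
        using row_length_eq_0[OF lam, of b'] by simp
    qed
    finally show "insert ?x lam \<in> young_diagrams" .
  qed
qed

lemma removable_node_exists:
  assumes lam: "lam \<in> young_diagrams" and j: "j \<in> particles lam" "j - 1 \<notin> particles lam"
  obtains x where "x \<in> lam" "lam - {x} \<in> young_diagrams" "node_content x = j"
proof -
  obtain b where b: "j = row_beta lam b" using j(1) by (auto simp: particles_def)
  let ?r = "row_length lam" and ?x = "(row_length lam b - 1, b)"
  have "row_beta lam (Suc b) < row_beta lam b" using row_beta_less_iff(1)[OF lam] by simp
  moreover have "row_beta lam (Suc b) \<noteq> j - 1" using j(2) unfolding particles_def by (metis rangeI)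
  ultimately have step: "?r (Suc b) < ?r b" using b by (simp add: row_beta_def)
  show ?thesis
  proof
    show "?x \<in> lam" using step by (simp add: in_diagram_iff[OF lam])
    show "node_content ?x = j" using b step by (simp add: node_content_def row_beta_def of_nat_diff)
    have "lam - {?x} = {(a', b'). a' < (?r(b := ?r b - 1)) b'}"
      using in_diagram_iff[OF lam] by auto
    also have "\<dots> \<in> young_diagrams"
    proof (rule young_diagrams_rows)
      fix b' b'' :: nat assume le: "b' \<le> b''"
      show "(?r(b := ?r b - 1)) b'' \<le> (?r(b := ?r b - 1)) b'"
      proof (cases "b' = b \<and> b'' \<noteq> b")
        case True
        then have "?r b'' \<le> ?r (Suc b)" using le by (intro row_length_antimono[OF lam]) auto
        with step True show ?thesis by simp
      next
        case False
        with row_length_antimono[OF lam le] show ?thesis by auto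
      qed
    next
      fix b' assume "b' \<ge> num_rows lam"
      then show "(?r(b := ?r b - 1)) b' = 0"
        using row_length_eq_0[OF lam, of b'] by auto
    qed
    finally show "lam - {?x} \<in> young_diagrams" .
  qed
qed

lemma node_eqI: "node_content x = node_content y \<Longrightarrow> snd x = snd y \<Longrightarrow> x = y"
  by (auto simp: node_content_def prod_eq_iff)

text \<open>The index is an integer so that i - 1 makes sense for i = 0: runner -1 is runner l - 1
  shifted by one position.\<close>

definition runner :: "nat \<Rightarrow> diagram \<Rightarrow> int \<Rightarrow> int set" where
  "runner l lam i = {q. int l * q + i \<in> particles lam}"

context
  fixes l :: nat and lam :: diagram
  assumes l: "0 < l" and lam: "lam \<in> young_diagrams"
begin

lemma residue_iff: "is_node_of_residue l i x \<longleftrightarrow> (\<exists>q. node_content x = int l * q + i)"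
proof -
  have "node_content x mod int l = i mod int l \<longleftrightarrow> int l dvd node_content x - i"
    by (rule mod_eq_dvd_iff)
  also have "\<dots> \<longleftrightarrow> (\<exists>q. node_content x = int l * q + i)"
    by (auto simp: dvd_def algebra_simps)
  finally show ?thesis by (simp add: is_node_of_residue_def)
qed

text \<open>An addable node of content l q + i means a particle at l q + i - 1 and a hole at l q +
  i, that is, q on runner i - 1 and not on runner i.\<close>

lemma bij_betw_addable:
  "bij_betw (\<lambda>x. (node_content x - i) div int l) (addable l i lam) (runner l lam (i - 1) - runner l lam i)"
proof (rule bij_betw_imageI)
  show "inj_on (\<lambda>x. (node_content x - i) div int l) (addable l i lam)"
  proof (rule inj_onI)
    fix x y assume xy: "x \<in> addable l i lam" "y \<in> addable l i lam"
      "(node_content x - i) div int l = (node_content y - i) div int l"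
    then have "node_content x = node_content y"
      using l by (auto simp: addable_def residue_iff)
    \<comment> \<open>The content fixes the beta-number of the row, hence the row, hence the
      node.\<close>
    moreover have "row_beta lam (snd x) = row_beta lam (snd y)"
      using xy particles_insert(1)[OF lam, of x] particles_insert(1)[OF lam, of y] calculation
      by (simp add: addable_def)
    ultimately show "x = y"
      using row_beta_less_iff(2)[OF lam] by (intro node_eqI) auto
  qed
  show "(\<lambda>x. (node_content x - i) div int l) ` addable l i lam = runner l lam (i - 1) - runner l lam i"
  proof (intro equalityI subsetI)
    fix q assume "q \<in> (\<lambda>x. (node_content x - i) div int l) ` addable l i lam"
    then obtain x where x: "x \<in> addable l i lam" "node_content x = int l * q + i"
      using l by (auto simp: addable_def residue_iff)
    then have "row_beta lam (snd x) = int l * q + i - 1" "int l * q + i \<notin> particles lam"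
      using particles_insert(1,2)[OF lam, of x] by (simp_all add: addable_def)
    then show "q \<in> runner l lam (i - 1) - runner l lam i"
      by (auto simp: runner_def particles_def) (metis add_diff_eq rangeI)
  next
    fix q assume q: "q \<in> runner l lam (i - 1) - runner l lam i"
    obtain x where "x \<notin> lam" "insert x lam \<in> young_diagrams" "node_content x = int l * q + i"
      using addable_node_exists[OF lam, of "int l * q + i"] q by (auto simp: runner_def algebra_simps)
    then show "q \<in> (\<lambda>x. (node_content x - i) div int l) ` addable l i lam"
      using l by (intro image_eqI[of _ _ x]) (auto simp: addable_def residue_iff)
  qed
qed

lemma bij_betw_removable:
  "bij_betw (\<lambda>x. (node_content x - i) div int l) (removable l i lam) (runner l lam i - runner l lam (i - 1))"
proof (rule bij_betw_imageI)
  show "inj_on (\<lambda>x. (node_content x - i) div int l) (removable l i lam)"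
  proof (rule inj_onI)
    fix x y assume xy: "x \<in> removable l i lam" "y \<in> removable l i lam"
      "(node_content x - i) div int l = (node_content y - i) div int l"
    then have "node_content x = node_content y"
      using l by (auto simp: removable_def residue_iff)
    moreover have "row_beta lam (snd x) = row_beta lam (snd y)"
      using xy particles_remove(1)[OF lam, of x] particles_remove(1)[OF lam, of y] calculation
      by (simp add: removable_def)
    ultimately show "x = y"
      using row_beta_less_iff(2)[OF lam] by (intro node_eqI) auto
  qed
  show "(\<lambda>x. (node_content x - i) div int l) ` removable l i lam = runner l lam i - runner l lam (i - 1)"
  proof (intro equalityI subsetI)
    fix q assume "q \<in> (\<lambda>x. (node_content x - i) div int l) ` removable l i lam"
    then obtain x where x: "x \<in> removable l i lam" "node_content x = int l * q + i"
      using l by (auto simp: removable_def residue_iff)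
    then have "row_beta lam (snd x) = int l * q + i" "int l * q + i - 1 \<notin> particles lam"
      using particles_remove(1,2)[OF lam, of x] by (simp_all add: removable_def)
    then show "q \<in> runner l lam i - runner l lam (i - 1)"
      by (auto simp: runner_def particles_def add_diff_eq) (metis rangeI)
  next
    fix q assume q: "q \<in> runner l lam i - runner l lam (i - 1)"
    obtain x where "x \<in> lam" "lam - {x} \<in> young_diagrams" "node_content x = int l * q + i"
      using removable_node_exists[OF lam, of "int l * q + i"] q by (auto simp: runner_def algebra_simps)
    then show "q \<in> (\<lambda>x. (node_content x - i) div int l) ` removable l i lam"
      using l by (intro image_eqI[of _ _ x]) (auto simp: removable_def residue_iff)
  qed
qed

lemma eta_minus_eq:
  assumes x: "node_content x = int l * p + i"
  shows "eta_minus l i lam x = int (card {q \<in> runner l lam (i - 1) - runner l lam i. q < p})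
    - int (card {q \<in> runner l lam i - runner l lam (i - 1). q < p})"
proof -
  let ?q = "\<lambda>x. (node_content x - i) div int l"
  have lt: "node_content y < node_content x \<longleftrightarrow> ?q y < p" if "is_node_of_residue l i y" for y
    using that l x by (auto simp: residue_iff)
  have "card {y \<in> S. node_content y < node_content x} = card {q \<in> T. q < p}"
    if S: "bij_betw ?q S T" "\<And>y. y \<in> S \<Longrightarrow> is_node_of_residue l i y" for S T
  proof (rule bij_betw_same_card[of ?q], rule bij_betw_subset[OF S(1)])
    show "?q ` {y \<in> S. node_content y < node_content x} = {q \<in> T. q < p}"
      using bij_betw_imp_surj_on[OF S(1)] S(2) lt by force
  qed auto
  from this[OF bij_betw_addable] this[OF bij_betw_removable] show ?thesis
    unfolding eta_minus_def by (simp add: addable_def removable_def)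
qed

lemma maya_set_particles: "maya_set (particles lam)"
proof -
  have "n \<in> particles lam" if n: "n < - int (num_rows lam)" for n
    unfolding particles_def
  proof (rule range_eqI)
    show "n = row_beta lam (nat (- n - 1))"
      using n row_length_eq_0[OF lam, of "nat (- n - 1)"] by (simp add: row_beta_def)
  qed
  moreover have "n \<notin> particles lam" if n: "n > row_beta lam 0" for n
  proof
    assume "n \<in> particles lam"
    then obtain b where "n = row_beta lam b" by (auto simp: particles_def)
    with row_beta_less_iff(1)[OF lam, of 0 b] n show False by simp
  qed
  ultimately show ?thesis
    unfolding maya_set_def
    by (intro exI[of _ "max (int (num_rows lam)) (row_beta lam 0 + 1)"]) auto
qed

lemma maya_set_runner: "maya_set (runner l lam i)"
proof -
  obtain K where K: "0 \<le> K" "\<And>n. n \<ge> K \<Longrightarrow> n \<notin> particles lam" "\<And>n. n < - K \<Longrightarrow> n \<in> particles lam"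
    using maya_setE[OF maya_set_particles] by blast
  have l1: "int l \<ge> 1" using l by simp
  have "int l * q + i \<ge> K" if "q \<ge> K + \<bar>i\<bar>" for q
  proof -
    have "0 \<le> (int l - 1) * q" using l1 that K(1) by (intro mult_nonneg_nonneg) auto
    then show ?thesis using that by (simp add: algebra_simps)
  qed
  moreover have "int l * q + i < - K" if "q < - (K + \<bar>i\<bar>)" for q
  proof -
    have "(int l - 1) * q \<le> 0" using l1 that K(1) by (intro mult_nonneg_nonpos) auto
    then show ?thesis using that by (simp add: algebra_simps)
  qed
  ultimately show ?thesis
    unfolding maya_set_def runner_def using K by (intro exI[of _ "K + \<bar>i\<bar>"]) auto
qed

end

section \<open>Comparing the charges and particle counts of two runners\<close>

lemma set_charge_shift:
  assumes "maya_set P"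
  shows "set_charge {q. q - 1 \<in> P} = set_charge P + 1"
proof -
  obtain K where K: "0 \<le> K" "\<And>n. n \<ge> K \<Longrightarrow> n \<notin> P" "\<And>n. n < - K \<Longrightarrow> n \<in> P"
    using maya_setE[OF assms] by blast
  have "set_charge P = int (card (P \<inter> {- K - 1..<K + 1})) + (- K - 1)"
    by (rule set_charge_card) (use K in auto)
  moreover have "set_charge {q. q - 1 \<in> P} = int (card ({q. q - 1 \<in> P} \<inter> {- K..<K + 2})) + - K"
    by (rule set_charge_card) (use K in auto)
  moreover have "bij_betw (\<lambda>q. q + 1) (P \<inter> {- K - 1..<K + 1}) ({q. q - 1 \<in> P} \<inter> {- K..<K + 2})"
    by (rule bij_betwI[where g = "\<lambda>q. q - 1"]) auto
  ultimately show ?thesis by (simp add: bij_betw_same_card)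
qed

lemma int_card_diff_card:
  assumes "finite A" "finite B"
  shows "int (card A) - int (card B) = int (card (A - B)) - int (card (B - A))"
proof -
  have "card A = card (A - B) + card (A \<inter> B)" "card B = card (B - A) + card (A \<inter> B)"
    using assms by (subst card_Un_disjoint[symmetric]; (auto intro: arg_cong[of _ _ card]))+
  then show ?thesis by simp
qed

lemma set_charge_diff:
  assumes "maya_set A" "maya_set B"
  shows "finite (A - B)" "set_charge A - set_charge B = int (card (A - B)) - int (card (B - A))"
proof -
  obtain K where K: "0 \<le> K" "\<And>n. n \<ge> K \<Longrightarrow> n \<notin> A" "\<And>n. n < - K \<Longrightarrow> n \<in> A"
    using maya_setE[OF assms(1)] by blast
  obtain L where L: "0 \<le> L" "\<And>n. n \<ge> L \<Longrightarrow> n \<notin> B" "\<And>n. n < - L \<Longrightarrow> n \<in> B"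
    using maya_setE[OF assms(2)] by blast
  let ?M = "max K L" and ?I = "{- max K L..<max K L}"
  have "set_charge A = int (card (A \<inter> ?I)) + - ?M" "set_charge B = int (card (B \<inter> ?I)) + - ?M"
    by (rule set_charge_card; use K L in auto)+
  moreover have AB: "A - B = (A \<inter> ?I) - (B \<inter> ?I)" "B - A = (B \<inter> ?I) - (A \<inter> ?I)"
  proof -
    have "n < K" if "n \<in> A" for n using K(2)[of n] that by (cases "K \<le> n") auto
    moreover have "n < L" if "n \<in> B" for n using L(2)[of n] that by (cases "L \<le> n") auto
    moreover have "- K \<le> n" if "n \<notin> A" for n using K(3)[of n] that by (cases "n < - K") auto
    moreover have "- L \<le> n" if "n \<notin> B" for n using L(3)[of n] that by (cases "n < - L") auto
    ultimately show "A - B = (A \<inter> ?I) - (B \<inter> ?I)" "B - A = (B \<inter> ?I) - (A \<inter> ?I)"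
      by fastforce+
  qed
  ultimately show "set_charge A - set_charge B = int (card (A - B)) - int (card (B - A))"
    using int_card_diff_card[of "A \<inter> ?I" "B \<inter> ?I"] by simp
  show "finite (A - B)" unfolding AB(1) by simp
qed

lemma finite_greater_maya_set: "maya_set P \<Longrightarrow> finite {q \<in> P. q > p}"
proof (erule maya_setE)
  fix K assume K: "\<And>n. K \<le> n \<Longrightarrow> n \<notin> P"
  have "q < K" if "q \<in> P" for q
    using K[of q] that by (cases "K \<le> q") auto
  then have "{q \<in> P. q > p} \<subseteq> {p..K}" by force
  then show "finite {q \<in> P. q > p}" by (rule finite_subset) simp
qed

text \<open>Particles common to A and B cancel, and the charge difference splits into the parts left
  of p, at p and right of p. This exchanges the right-hand counts of vertex operators for the
  left-hand counts of \<open>eta_minus\<close>.\<close>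

lemma card_greater_diff:
  assumes "maya_set A" "maya_set B"
  shows "int (card {q \<in> A. q > p}) - int (card {q \<in> B. q > p}) =
    set_charge A - set_charge B
    - (int (card {q \<in> A - B. q < p}) - int (card {q \<in> B - A. q < p}))
    - (of_bool (p \<in> A) - of_bool (p \<in> B))"
proof -
  have split: "int (card X) = int (card {q \<in> X. q < p}) + of_bool (p \<in> X) + int (card {q \<in> X. q > p})"
    if "finite X" for X :: "int set"
  proof -
    have "X = {q \<in> X. q < p} \<union> (X \<inter> {p}) \<union> {q \<in> X. q > p}" by auto
    then have "card X = card ({q \<in> X. q < p} \<union> (X \<inter> {p}) \<union> {q \<in> X. q > p})" by simp
    also have "\<dots> = card ({q \<in> X. q < p} \<union> (X \<inter> {p})) + card {q \<in> X. q > p}"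
      by (rule card_Un_disjoint) (use that in auto)
    also have "card ({q \<in> X. q < p} \<union> (X \<inter> {p})) = card {q \<in> X. q < p} + card (X \<inter> {p})"
      by (rule card_Un_disjoint) (use that in auto)
    finally show ?thesis by (auto simp: Int_insert_right)
  qed
  have "{q \<in> A. q > p} - {q \<in> B. q > p} = {q \<in> A - B. q > p}"
    "{q \<in> B. q > p} - {q \<in> A. q > p} = {q \<in> B - A. q > p}" by auto
  then have "int (card {q \<in> A. q > p}) - int (card {q \<in> B. q > p}) =
      int (card {q \<in> A - B. q > p}) - int (card {q \<in> B - A. q > p})"
    using int_card_diff_card[OF finite_greater_maya_set[OF assms(1), of p] finite_greater_maya_set[OF assms(2), of p]] by simp
  then show ?thesis
    using split[OF set_charge_diff(1)[OF assms]] split[OF set_charge_diff(1)[OF assms(2,1)]]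
      set_charge_diff(2)[OF assms] by (auto simp: of_bool_def split: if_splits)
qed

text \<open>Basis vectors indexed by configurations on the l runners; vertex operators are computed
  on these before the result is recognised as a diagram.\<close>

definition runner_state :: "nat \<Rightarrow> (nat \<Rightarrow> int set) \<Rightarrow> fk_space" where
  "runner_state l R = Poly_Mapping.single (\<lambda>k. if k < l then set_charge (R k) else 0)
     (\<Prod>k<l. schur k (set_diagram (R k)))"

lemma runner_state_cong: "(\<And>k. k < l \<Longrightarrow> R k = R' k) \<Longrightarrow> runner_state l R = runner_state l R'"
  unfolding runner_state_def by (intro arg_cong2[of _ _ _ _ Poly_Mapping.single] ext prod.cong) auto

lemma maya_component_eq:
  assumes "lam \<in> young_diagrams"
  shows "maya_component l lam k = (\<lambda>n. if n \<in> runner l lam (int k) then -1 else 1)"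
  by (simp add: maya_component_def maya_of_eq[OF assms] runner_def fun_eq_iff)

lemma core_charges_eq:
  assumes "lam \<in> young_diagrams"
  shows "core_charges l lam = (\<lambda>k. if k < l then set_charge (runner l lam (int k)) else 0)"
  by (simp add: core_charges_def maya_component_eq[OF assms] charge_eq_set_charge fun_eq_iff)

lemma basis_vec_eq:
  assumes "lam \<in> young_diagrams"
  shows "basis_vec l lam = runner_state l (\<lambda>k. runner l lam (int k))"
  by (simp add: basis_vec_def runner_state_def core_charges_eq[OF assms] diagram_quotient_def
      maya_component_eq[OF assms] set_diagram_def)

lemma runner_position_inject:
  assumes "j < l" "k < l"
  shows "int l * q + int j = int l * p + int k \<longleftrightarrow> q = p \<and> j = k"
proof
  assume eq: "int l * q + int j = int l * p + int k"
  have "(int l * q + int j) div int l = q" "(int l * p + int k) div int l = p"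
    using assms by simp_all
  with eq have "q = p" by simp
  with eq show "q = p \<and> j = k" by simp
qed simp

lemma runner_move:
  assumes "particles mu = insert (int l * p + int k) (particles lam - {int l * q + int k'})"
    and "k < l" "k' < l" "k \<noteq> k'" "j < l"
  shows "runner l mu (int j) = ((\<lambda>j. runner l lam (int j))(k := insert p (runner l lam (int k)), k' := runner l lam (int k') - {q})) j"
  using assms by (auto simp: runner_def runner_position_inject)

section \<open>Residue counts and the cocycle\<close>

lemma residue_count_eq_sum:
  assumes l: "0 < l" and lam: "lam \<in> young_diagrams"
  obtains K where "\<And>L. L \<ge> K \<Longrightarrow> int (residue_count l i lam) = (\<Sum>q\<in>{- L..<L}. content_count (int l * q + i) lam)"
proof -
  have fin: "finite lam" using lam by (simp add: young_diagrams_def)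
  obtain M where M: "\<And>x. x \<in> lam \<Longrightarrow> \<bar>node_content x\<bar> \<le> M"
    using finite_imageI[OF fin, of "\<lambda>x. \<bar>node_content x\<bar>"] by (metis bdd_above_finite bdd_above_def imageI)
  show ?thesis
  \<comment> \<open>A threshold is given instead of one window, so that two residues can be summed
    over the same window. The bound comes from |q| \<le> |l q| \<le> |M| + |i|.\<close>
  proof (rule that[of "\<bar>M\<bar> + \<bar>i\<bar> + 1"])
    fix L assume L: "L \<ge> \<bar>M\<bar> + \<bar>i\<bar> + 1"
    have bound: "q \<in> {- L..<L}" if "x \<in> lam" "node_content x = int l * q + i" for x q
    proof -
      have "\<bar>q\<bar> \<le> \<bar>int l * q\<bar>"
        using l mult_right_mono[of 1 "int l" "\<bar>q\<bar>"] by (simp add: abs_mult)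
      also have "\<dots> \<le> \<bar>M\<bar> + \<bar>i\<bar>"
        using M[OF that(1)] that(2) by linarith
      finally show ?thesis using L by auto
    qed
    have "{x \<in> lam. is_node_of_residue l i x} = (\<Union>q\<in>{- L..<L}. {x \<in> lam. node_content x = int l * q + i})"
    proof (intro equalityI subsetI)
      fix x assume x: "x \<in> {x \<in> lam. is_node_of_residue l i x}"
      then obtain q where "node_content x = int l * q + i"
        by (auto simp: residue_iff[OF l lam])
      with x show "x \<in> (\<Union>q\<in>{- L..<L}. {x \<in> lam. node_content x = int l * q + i})"
        using bound[of x q] by blast
    next
      fix x assume "x \<in> (\<Union>q\<in>{- L..<L}. {x \<in> lam. node_content x = int l * q + i})"
      then show "x \<in> {x \<in> lam. is_node_of_residue l i x}"
        by (simp add: residue_iff[OF l lam]) blast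
    qed
    then have "residue_count l i lam = card (\<Union>q\<in>{- L..<L}. {x \<in> lam. node_content x = int l * q + i})"
      by (simp add: residue_count_def)
    also have "\<dots> = (\<Sum>q\<in>{- L..<L}. card {x \<in> lam. node_content x = int l * q + i})"
      by (rule card_UN_disjoint) (use fin l in auto)
    finally show "int (residue_count l i lam) = (\<Sum>q\<in>{- L..<L}. content_count (int l * q + i) lam)"
      by (simp add: content_count_def)
  qed
qed

text \<open>Summing \<open>content_count_diff\<close> along the runner gives the charge, because for
  0 \<le> k < l the content l q + k is negative exactly when q is.\<close>

lemma residue_count_diff:
  assumes lam: "lam \<in> young_diagrams" and k: "k < l"
  shows "int (residue_count l (int k) lam) - int (residue_count l (int k + 1) lam) = set_charge (runner l lam (int k))"
proof -
  have l: "0 < l" using k by simp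
  obtain K1 where K1: "\<And>L. L \<ge> K1 \<Longrightarrow> int (residue_count l (int k) lam) = (\<Sum>q\<in>{- L..<L}. content_count (int l * q + int k) lam)"
    using residue_count_eq_sum[OF l lam] by blast
  obtain K2 where K2: "\<And>L. L \<ge> K2 \<Longrightarrow> int (residue_count l (int k + 1) lam) = (\<Sum>q\<in>{- L..<L}. content_count (int l * q + (int k + 1)) lam)"
    using residue_count_eq_sum[OF l lam] by blast
  obtain K3 where K3: "0 \<le> K3" "\<And>n. n \<ge> K3 \<Longrightarrow> n \<notin> runner l lam (int k)" "\<And>n. n < - K3 \<Longrightarrow> n \<in> runner l lam (int k)"
    using maya_setE[OF maya_set_runner[OF l lam]] by blast
  define L where "L = max K1 (max K2 K3)"
  have neg: "int l * q + int k < 0 \<longleftrightarrow> q < 0" for q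
  proof
    assume "q < 0"
    then have "int l * q \<le> - int l" using mult_left_mono[of q "-1" "int l"] by simp
    then show "int l * q + int k < 0" using k by simp
  next
    assume "int l * q + int k < 0"
    then show "q < 0" using mult_nonneg_nonneg[of "int l" q] by linarith
  qed
  have "int (residue_count l (int k) lam) - int (residue_count l (int k + 1) lam) =
      (\<Sum>q\<in>{- L..<L}. content_count (int l * q + int k) lam - content_count (int l * q + int k + 1) lam)"
    using K1[of L] K2[of L] by (simp add: L_def sum_subtractf add.assoc)
  also have "\<dots> = (\<Sum>q\<in>{- L..<L}. of_bool (q \<in> runner l lam (int k)) - of_bool (q < 0))"
    by (simp add: content_count_diff[OF lam] runner_def neg)
  also have "\<dots> = set_charge (runner l lam (int k))"
    by (rule set_charge_sum[symmetric]) (use K3 in \<open>auto simp: L_def\<close>)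
  finally show ?thesis .
qed

lemma residue_count_periodic: "residue_count l (i + int l) lam = residue_count l i lam"
  by (simp add: residue_count_def is_node_of_residue_def)

lemma root_coeff_core_charges:
  assumes "lam \<in> young_diagrams" "n \<le> l"
  shows "root_coeff (core_charges l lam) n = int (residue_count l 0 lam) - int (residue_count l (int n) lam)"
  using assms(2)
proof (induction n)
  case (Suc n)
  then show ?case
    using residue_count_diff[OF assms(1), of n l]
    by (simp add: root_coeff_def core_charges_eq[OF assms(1)] add.commute)
qed (simp add: root_coeff_def)

lemma power_int_minus_one_cong:
  assumes "even (m - n)"
  shows "(-1 :: 'a :: division_ring) powi m = (-1) powi n"
  using assms by (simp add: power_int_minus_left) 

text \<open>Pairing with \<alpha>_i involves only the coefficients i and i + 1 of the charge vector;
  their sum 2 v_0 - v_i - v_{i+1} has the stated parity.\<close>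

lemma cocycle_simple_root_core_charges:
  assumes lam: "lam \<in> young_diagrams" and i: "1 \<le> i" "i < l"
  shows "cocycle l (simple_root i) (core_charges l lam) =
    (-1) powi (int (residue_count l (int i) lam) + int (residue_count l (int i + 1) lam))"
proof -
  let ?b = "core_charges l lam"
  have "cocycle l (simple_root i) ?b =
      (\<Prod>i'\<in>{1..<l}. if i' = i then (\<Prod>j\<in>{1..<l}. (if j = i \<or> j = i + 1 then -1 else 1) powi root_coeff ?b j) else 1)"
    unfolding cocycle_def using i root_coeff_simple_root[OF i(1)] by (intro prod.cong refl) (auto simp del: One_nat_def)
  also have "\<dots> = (\<Prod>j\<in>{1..<l}. (if j = i \<or> j = i + 1 then -1 else 1) powi root_coeff ?b j)"
    using i by simp
  also have "\<dots> = (\<Prod>j\<in>{1..<l}. (if j = i then (-1) powi root_coeff ?b i else 1) * (if j = i + 1 then (-1) powi root_coeff ?b (i + 1) else 1))"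
    by (intro prod.cong) auto
  also have "\<dots> = (-1) powi root_coeff ?b i * (if i + 1 < l then (-1) powi root_coeff ?b (i + 1) else 1)"
    using i by (simp add: prod.distrib)
  \<comment> \<open>For i = l - 1 there is no factor j = l, but the coefficient at l is the total
    charge 0, so the missing factor is 1.\<close>
  also have "(if i + 1 < l then (-1) powi root_coeff ?b (i + 1) else 1) = (-1 :: complex) powi root_coeff ?b (i + 1)"
  proof (cases "i + 1 < l")
    case False
    then have "i + 1 = l" using i by simp
    moreover have "root_coeff ?b l = 0"
      using root_coeff_core_charges[OF lam, of l l] residue_count_periodic[of l 0 lam] by simp
    ultimately show ?thesis by simp
  qed simp
  also have "(-1 :: complex) powi root_coeff ?b i * (-1) powi root_coeff ?b (i + 1) =
      (-1) powi (root_coeff ?b i + root_coeff ?b (i + 1))"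
    by (simp add: power_int_add)
  also have "\<dots> = (-1) powi (int (residue_count l (int i) lam) + int (residue_count l (int i + 1) lam))"
    using i by (intro power_int_minus_one_cong)
      (simp add: root_coeff_core_charges[OF lam] add.commute)
  finally show ?thesis .
qed

text \<open>The root is \<alpha>_1 + ... + \<alpha>_n; in the product over these simple roots v_2,
  ..., v_n occur twice and cancel.\<close>

lemma cocycle_highest_root_core_charges:
  assumes lam: "lam \<in> young_diagrams" and n: "1 \<le> n" "n < l"
  shows "cocycle l (root_vec 0 n) (core_charges l lam) =
    (-1) powi (int (residue_count l 1 lam) + int (residue_count l (int n + 1) lam))"
  using n
proof (induction n rule: nat_induct_at_least)
  case base
  then show ?case using cocycle_simple_root_core_charges[OF lam, of 1 l] by simp
next
  case (Suc n)
  have "root_vec 0 (Suc n) = (\<lambda>k. root_vec 0 n k + simple_root (Suc n) k)"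
    by (auto simp: root_vec_def)
  then have "cocycle l (root_vec 0 (Suc n)) (core_charges l lam) =
      (-1) powi (int (residue_count l 1 lam) + int (residue_count l (int n + 1) lam)) *
      (-1) powi (int (residue_count l (int (Suc n)) lam) + int (residue_count l (int (Suc n) + 1) lam))"
    using Suc cocycle_simple_root_core_charges[OF lam, of "Suc n" l] by (simp add: cocycle_add_left)
  also have "\<dots> = (-1) powi (int (residue_count l 1 lam) + int (residue_count l (int (Suc n) + 1) lam))"
    by (subst power_int_add[symmetric], simp, rule power_int_minus_one_cong) (simp add: add.commute)
  finally show ?case .
qed

lemma cocycle_uminus_left:
  assumes "cocycle l alpha beta = (-1) powi m"
  shows "cocycle l (\<lambda>k. - alpha k) beta = (-1) powi m"
proof -
  have "cocycle l (\<lambda>k. alpha k + - alpha k) beta = 1"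
    by (simp add: cocycle_def root_coeff_def)
  then have "(-1) powi m * cocycle l (\<lambda>k. - alpha k) beta = 1"
    by (simp only: cocycle_add_left assms)
  then show ?thesis
    by (simp add: power_int_minus_left split: if_splits) (metis equation_minus_iff)
qed

section \<open>Vertex operators\<close>

text \<open>The last row is 0, ..., 0, 1. Appending empty rows therefore preserves the determinant,
  which gives Schur functions of different diagrams a common size.\<close>

lemma jt_det_Suc:
  assumes h: "h 0 = 1" "\<And>n. n < 0 \<Longrightarrow> h n = 0" and mu: "mu n = - int n"
  shows "jt_det h (Suc n) mu = jt_det h n mu"
proof -
  let ?A = "mat (Suc n) (Suc n) (\<lambda>(i, j). h (mu i + int j))"
  have "det ?A = (\<Sum>j<Suc n. ?A $$ (n, j) * cofactor ?A n j)"
    by (rule laplace_expansion_row) auto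
  also have "\<dots> = cofactor ?A n n"
    by (simp add: mu h)
  also have "\<dots> = det (mat_delete ?A n n)"
    by (simp add: cofactor_def)
  also have "mat_delete ?A n n = mat n n (\<lambda>(i, j). h (mu i + int j))"
    unfolding mat_delete_mat by (rule eq_matI) auto
  finally show ?thesis by (simp add: jt_det_def)
qed

lemma schur_eq_jt_det:
  assumes "lam \<in> young_diagrams" "num_rows lam \<le> n"
  shows "schur k lam = jt_det (complete_sym k) n (\<lambda>b. row_beta lam b + 1)"
  using assms(2)
proof (induction n rule: dec_induct)
  case base
  show ?case by (simp add: schur_def jt_det_def row_beta_def)
next
  case (step n)
  have "row_beta lam n + 1 = - int n"
    using row_length_eq_0[OF assms(1) step(1)] by (simp add: row_beta_def)
  then show ?case
    using step.IH by (subst jt_det_Suc) (simp_all add: complete_sym_0 complete_sym_neg)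
qed

lemma schur_set_diagram:
  assumes "maya_set P"
  obtains N where "\<And>n. n \<ge> N \<Longrightarrow> schur k (set_diagram P) =
    jt_det (complete_sym k) n (\<lambda>b. maya_enum P b - set_charge P + 1)"
proof
  fix n assume "n \<ge> num_rows (set_diagram P)"
  then show "schur k (set_diagram P) = jt_det (complete_sym k) n (\<lambda>b. maya_enum P b - set_charge P + 1)"
    by (simp add: schur_eq_jt_det[OF set_diagram(1)[OF assms]] maya_enum_def)
qed

lemma fls_nth_H_series: "fls_nth (fps_to_fls (H_series k)) n = complete_sym k n"
  by (cases "n < 0") (simp_all add: complete_sym_neg complete_sym_of_nat[symmetric])

text \<open>In degree p - c the bordering row is labelled by a particle at p, and the shift of the
  other labels by -1 is the rise of the charge from c to c + 1.\<close>

lemma fls_nth_creation_schur: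
  assumes P: "maya_set P" and kk': "k \<noteq> k'"
  shows "fls_nth (fps_to_fls (H_series k) * annihilator_series k k' (schur k (set_diagram P))) (p - set_charge P) =
    (if p \<in> P then 0 else (-1) ^ card {q \<in> P. q > p} * schur k (set_diagram (insert p P)))"
proof -
  let ?c = "set_charge P" and ?e = "maya_enum P" and ?h = "complete_sym k"
  let ?mu = "\<lambda>b. ?e b - ?c + 1"
  define s where "s = card {q \<in> P. q > p}"
  obtain N1 where N1: "\<And>n. n \<ge> N1 \<Longrightarrow> schur k (set_diagram P) = jt_det ?h n ?mu"
    using schur_set_diagram[OF P] by blast
  obtain N2 where N2: "\<And>n. n \<ge> N2 \<Longrightarrow> schur k (set_diagram (insert p P)) =
      jt_det ?h n (\<lambda>b. maya_enum (insert p P) b - set_charge (insert p P) + 1)"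
    using schur_set_diagram[OF maya_set_insert[OF P]] by blast
  \<comment> \<open>\<open>Suc s\<close> leaves room for the rows s and s + 1, which are compared
    when p is occupied.\<close>
  define N where "N = max (max N1 N2) (Suc s)"
  let ?nu = "\<lambda>b. if b < s then ?mu b - 1 else if b = s then p - ?c else ?mu (b - 1) - 1"
  have "annihilator_series k k' (schur k (set_diagram P)) =
      annihilator_series k k' (jt_det ?h N ?mu)"
    by (subst N1[of N]) (simp_all add: N_def)
  also have "\<dots> = det (map_mat (annihilator_series k k') (mat N N (\<lambda>(i, j). ?h (?mu i + int j))))"
    by (simp add: jt_det_def)
  also have "map_mat (annihilator_series k k') (mat N N (\<lambda>(i, j). ?h (?mu i + int j))) =
      mat N N (\<lambda>(i, j). fls_const (?h (?mu i + int j)) - fls_X_inv * fls_const (?h (?mu i + int j - 1)))"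
    by (rule eq_matI) (auto simp: annihilator_series_complete_sym_left[OF kk'])
  finally have series: "annihilator_series k k' (schur k (set_diagram P)) =
      det (mat N N (\<lambda>(i, j). fls_const (?h (?mu i + int j)) - fls_X_inv * fls_const (?h (?mu i + int j - 1))))" .
  have *: "fls_nth (fps_to_fls (H_series k) * annihilator_series k k' (schur k (set_diagram P))) (p - ?c) =
      (-1) ^ s * jt_det ?h (Suc N) ?nu"
    unfolding series by (rule fls_nth_creation_jt_det[OF fls_nth_H_series]) (simp add: N_def)
  show ?thesis
  proof (cases "p \<in> P")
    case False
    have "jt_det ?h (Suc N) ?nu = jt_det ?h (Suc N) (\<lambda>b. maya_enum (insert p P) b - set_charge (insert p P) + 1)"
      by (rule jt_det_cong) (simp add: maya_enum_insert[OF P False] set_charge_insert[OF P False] s_def)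
    also have "\<dots> = schur k (set_diagram (insert p P))"
      by (rule N2[symmetric]) (simp add: N_def)
    finally show ?thesis using * False by (simp add: s_def)
  next
    case True
    then obtain i where i: "p = ?e i" using range_maya_enum[OF P] by blast
    have "s = i"
      unfolding s_def i using card_greater_strict_antimono[OF maya_enum_strict_antimono[OF P], of i]
      by (simp add: range_maya_enum[OF P])
    \<comment> \<open>If p is occupied, the inserted row s repeats the old row of p, now at s + 1:
      the exclusion principle as equality of two rows.\<close>
    let ?A = "mat (Suc N) (Suc N) (\<lambda>(i, j). ?h (?nu i + int j))"
    have "det ?A = 0"
    proof (rule det_identical_rows[of _ _ s "Suc s"])
      show "row ?A s = row ?A (Suc s)"
        by (rule eq_vecI) (auto simp: N_def i \<open>s = i\<close>)
    qed (auto simp: N_def)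
    then show ?thesis using * True by (simp add: jt_det_def)
  qed
qed

text \<open>In this degree the condition \<open>?mu i = - ?n\<close> says that particle i sits at p,
  so at most one term survives; the shift of the other labels by +1 is the drop of the
  charge.\<close>

lemma fls_nth_annihilation_schur:
  assumes P: "maya_set P" and kk': "k \<noteq> k'"
  shows "fls_nth (fps_to_fls (H_inv_series k') * annihilator_series k k' (schur k' (set_diagram P))) (set_charge P - 1 - p) =
    (if p \<in> P then (-1) ^ card {q \<in> P. q > p} * schur k' (set_diagram (P - {p})) else 0)"
proof -
  let ?c = "set_charge P" and ?e = "maya_enum P" and ?h = "complete_sym k'"
  let ?mu = "\<lambda>b. ?e b - ?c + 1" and ?n = "set_charge P - 1 - p"
  define s where "s = card {q \<in> P. q > p}"
  obtain N1 where N1: "\<And>n. n \<ge> N1 \<Longrightarrow> schur k' (set_diagram P) = jt_det ?h n ?mu"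
    using schur_set_diagram[OF P] by blast
  obtain N2 where N2: "\<And>n. n \<ge> N2 \<Longrightarrow> schur k' (set_diagram (P - {p})) =
      jt_det ?h n (\<lambda>b. maya_enum (P - {p}) b - set_charge (P - {p}) + 1)"
    using schur_set_diagram[OF maya_set_remove[OF P]] by blast
  \<comment> \<open>\<open>nat ?n\<close> secures the degree bound of the determinant lemma, and s
    keeps the row of p inside the matrix.\<close>
  define N where "N = max (max N1 N2) (max s (nat ?n))"
  define t where "t i = (-1) ^ i * jt_det ?h N (\<lambda>b. (if b < i then ?mu b else ?mu (Suc b)) + 1)" for i
  have "annihilator_series k k' (schur k' (set_diagram P)) =
      annihilator_series k k' (jt_det ?h (Suc N) ?mu)"
    by (subst N1[of "Suc N"]) (simp_all add: N_def)
  also have "\<dots> = det (map_mat (annihilator_series k k') (mat (Suc N) (Suc N) (\<lambda>(i, j). ?h (?mu i + int j))))"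
    by (simp add: jt_det_def)
  also have "map_mat (annihilator_series k k') (mat (Suc N) (Suc N) (\<lambda>(i, j). ?h (?mu i + int j))) =
      mat (Suc N) (Suc N) (\<lambda>(i, j). \<Sum>r\<le>nat (?mu i + int j). fls_const (?h (?mu i + int j - int r)) * fls_X_inv ^ r)"
    by (rule eq_matI) (auto simp: annihilator_series_complete_sym_right[OF kk'])
  finally have series: "annihilator_series k k' (schur k' (set_diagram P)) = det (mat (Suc N) (Suc N)
      (\<lambda>(i, j). \<Sum>r\<le>nat (?mu i + int j). fls_const (?h (?mu i + int j - int r)) * fls_X_inv ^ r))" .
  have HK: "fps_to_fls (H_series k') * fps_to_fls (H_inv_series k') = 1"
    by (simp add: fls_times_fps_to_fls[symmetric] H_series_mult_inv)
  have *: "fls_nth (fps_to_fls (H_inv_series k') * annihilator_series k k' (schur k' (set_diagram P))) ?n =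
      (\<Sum>i<Suc N. if ?mu i = - ?n then t i else 0)"
    unfolding series t_def
    by (rule fls_nth_annihilation_jt_det[OF fls_nth_H_series complete_sym_neg HK]) (simp_all add: N_def)
  show ?thesis
  proof (cases "p \<in> P")
    case False
    then have "?mu i \<noteq> - ?n" for i
      using range_maya_enum[OF P] by (auto simp: algebra_simps)
    with * False show ?thesis by simp
  next
    case True
    then obtain i where i: "p = ?e i" using range_maya_enum[OF P] by blast
    have "s = i"
      unfolding s_def i using card_greater_strict_antimono[OF maya_enum_strict_antimono[OF P], of i]
      by (simp add: range_maya_enum[OF P])
    have "s < Suc N" by (simp add: N_def)
    have "?mu i' = - ?n \<longleftrightarrow> i' = s" for i'
      using maya_enum_less_iff(2)[OF P, of i' i] by (auto simp: i \<open>s = i\<close>)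
    then have "fls_nth (fps_to_fls (H_inv_series k') * annihilator_series k k' (schur k' (set_diagram P))) ?n = t s"
      unfolding * using \<open>s < Suc N\<close> by (simp del: sum.lessThan_Suc)
    also have "t s = (-1) ^ s * jt_det ?h N (\<lambda>b. maya_enum (P - {p}) b - set_charge (P - {p}) + 1)"
      unfolding t_def
      by (intro arg_cong2[of _ _ _ _ times] refl jt_det_cong)
        (simp add: set_charge_remove[OF P True], simp add: i maya_enum_remove[OF P] \<open>s = i\<close>)
    also have "jt_det ?h N (\<lambda>b. maya_enum (P - {p}) b - set_charge (P - {p}) + 1) = schur k' (set_diagram (P - {p}))"
      by (rule N2[symmetric]) (simp add: N_def)
    finally show ?thesis using True by (simp add: s_def)
  qed
qed

lemma annihilator_series_schur_neutral:
  assumes "j \<noteq> k" "j \<noteq> k'"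
  shows "annihilator_series k k' (schur j lam) = fls_const (schur j lam)"
proof -
  let ?M = "mat (num_rows lam) (num_rows lam) (\<lambda>(i, i'). complete_sym j (int (row_length lam i) - int i + int i'))"
  have "map_mat (annihilator_series k k') ?M = map_mat fls_const ?M"
    by (rule eq_matI) (auto simp: annihilator_series_complete_sym_neutral[OF assms])
  then have "det (map_mat (annihilator_series k k') ?M) = det (map_mat fls_const ?M)"
    by simp
  then show ?thesis unfolding schur_def by simp
qed

lemma fls_times_nth_support:
  fixes f g :: "'a :: comm_ring_1 fls"
  assumes "finite T" "\<And>a. a \<notin> T \<Longrightarrow> fls_nth f a * fls_nth g (n - a) = 0"
  shows "fls_nth (f * g) n = (\<Sum>a\<in>T. fls_nth f a * fls_nth g (n - a))"
proof -
  let ?I = "{fls_subdegree f..n - fls_subdegree g}"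
  have "fls_nth (f * g) n = (\<Sum>a\<in>?I. fls_nth f a * fls_nth g (n - a))"
    by (rule fls_times_nth(2))
  also have "\<dots> = (\<Sum>a\<in>?I \<union> T. fls_nth f a * fls_nth g (n - a))"
    by (rule sum.mono_neutral_left) (use assms(1) in auto)
  also have "\<dots> = (\<Sum>a\<in>T. fls_nth f a * fls_nth g (n - a))"
    by (rule sum.mono_neutral_right) (use assms in auto)
  finally show ?thesis .
qed

section \<open>Modes of root vertex operators\<close>

lemma root_coeff_root_vec: "root_coeff (root_vec k k') i = of_bool (k < i) - of_bool (k' < i)"
  by (simp add: root_coeff_def root_vec_def sum_subtractf)

lemma sum_telescope_of_bool:
  fixes g :: "nat \<Rightarrow> 'a :: ring_1"
  assumes "k < l"
  shows "(\<Sum>i\<in>{1..<l}. of_bool (k < i) * (g (i - 1) - g i)) = g k - g (l - 1)"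
  using assms
proof (induction l)
  case (Suc n)
  show ?case
  proof (cases "k = n")
    case False
    with Suc have "k < n" by simp
    then have "{1..<Suc n} = insert n {1..<n}" by auto
    with Suc.IH[OF \<open>k < n\<close>] \<open>k < n\<close> show ?thesis by simp
  qed simp
qed simp

text \<open>Each of the two partial sums telescopes to runner l - 1, and these end terms
  cancel.\<close>

lemma heis_root_root_vec:
  assumes "k < l" "k' < l"
  shows "heis_root l (root_vec k k') m f = heis_factor k m f - heis_factor k' m f"
proof -
  have "heis_root l (root_vec k k') m f =
      (\<Sum>i\<in>{1..<l}. of_bool (k < i) * (heis_factor (i - 1) m f - heis_factor i m f))
      - (\<Sum>i\<in>{1..<l}. of_bool (k' < i) * (heis_factor (i - 1) m f - heis_factor i m f))"
    unfolding heis_root_def heis_def root_coeff_root_vec sum_subtractf[symmetric]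
    by (intro sum.cong refl) (auto simp: of_bool_def)
  also have "\<dots> = heis_factor k m f - heis_factor (l - 1) m f - (heis_factor k' m f - heis_factor (l - 1) m f)"
    by (intro arg_cong2[of _ _ _ _ minus] sum_telescope_of_bool assms)
  finally show ?thesis by simp
qed

lemma creation_part_root_vec:
  assumes "k < l" "k' < l"
  shows "creation_part l (root_vec k k') n f = fps_nth (H_series k * H_inv_series k') n * f"
proof -
  have "creation_part l (root_vec k k') n f = exp_coeff (\<lambda>m f. (pvar k m + - pvar k' m) * f) n f"
    unfolding creation_part_def
  proof (rule exp_coeff_cong)
    fix m :: nat and f assume m: "0 < m"
    have *: "fock_const (1 / of_nat m) * (of_nat m * (x * f)) = x * f" for x
      using m by (simp add: mult.assoc[symmetric] fock_const_of_nat[symmetric] fock_const_mult)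
    show "fock_const (1 / of_nat m) * heis_root l (root_vec k k') (- int m) f = (pvar k m + - pvar k' m) * f"
      using m * unfolding heis_root_root_vec[OF assms]
      by (simp add: heis_factor_def right_diff_distrib left_diff_distrib mult.assoc)
  qed
  then show ?thesis
    by (simp only: exp_coeff_mult_eq exp_series_add H_inv_series_def)
qed

lemma annihilation_part_root_vec:
  assumes "k < l" "k' < l"
  shows "annihilation_part l (root_vec k k') r f = annihilator k k' r f"
  unfolding annihilation_part_def annihilator_def
  by (rule exp_coeff_cong) (simp add: heis_root_root_vec[OF assms] heis_factor_def deriv_diff_def)

lemma fk_scale_single: "fk_scale c (Poly_Mapping.single b f) = Poly_Mapping.single b (fock_const c * f)"
  by (simp add: fk_scale_def)

lemma single_sum: "Poly_Mapping.single b (\<Sum>x\<in>A. f x) = (\<Sum>x\<in>A. Poly_Mapping.single b (f x))"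
  by (induction A rule: infinite_finite_induct) (simp_all add: single_add)

lemma lattice_form_root_vec:
  assumes "k < l" "k' < l"
  shows "lattice_form l (root_vec k k') beta = beta k - beta k'"
proof -
  have "lattice_form l (root_vec k k') beta = (\<Sum>j<l. (if j = k then beta k else 0) - (if j = k' then beta k' else 0))"
    unfolding lattice_form_def root_vec_def by (intro sum.cong) auto
  also have "\<dots> = beta k - beta k'"
    using assms by (simp add: sum_subtractf)
  finally show ?thesis .
qed

lemma finite_movable_particles:
  assumes "maya_set A" "maya_set B"
  shows "finite {q \<in> A. q + m \<notin> B}"
proof -
  obtain K where K: "\<And>n. n \<ge> K \<Longrightarrow> n \<notin> A" using maya_setE[OF assms(1)] by blast
  obtain L where L: "\<And>n. n < - L \<Longrightarrow> n \<in> B" using maya_setE[OF assms(2)] by blast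
  have "{q \<in> A. q + m \<notin> B} \<subseteq> {- L - m..<K}"
  proof
    fix q assume "q \<in> {q \<in> A. q + m \<notin> B}"
    with K[of q] L[of "q + m"] show "q \<in> {- L - m..<K}"
      by (cases "K \<le> q"; cases "q + m < - L") auto
  qed
  then show ?thesis by (rule finite_subset) simp
qed

lemma prod_lessThan_two:
  fixes F :: "nat \<Rightarrow> 'a :: comm_monoid_mult"
  assumes "k < l" "k' < l" "k \<noteq> k'"
  shows "(\<Prod>j<l. F j) = F k * F k' * (\<Prod>j\<in>{..<l} - {k, k'}. F j)"
proof -
  have "(\<Prod>j<l. F j) = F k * (\<Prod>j\<in>{..<l} - {k}. F j)"
    using assms by (intro prod.remove) auto
  also have "(\<Prod>j\<in>{..<l} - {k}. F j) = F k' * (\<Prod>j\<in>{..<l} - {k} - {k'}. F j)"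
    using assms by (intro prod.remove) auto
  also have "{..<l} - {k} - {k'} = {..<l} - {k, k'}"
    by auto
  finally show ?thesis by (simp add: mult.assoc)
qed

text \<open>A summand needs a particle at q on runner k' and a hole at q + m on runner k; signs and
  charge changes are those of the two one-runner operators.\<close>

lemma vertex_mode_root_vec:
  fixes R :: "nat \<Rightarrow> int set"
  assumes k: "k < l" "k' < l" "k \<noteq> k'" and R: "\<And>j. j < l \<Longrightarrow> maya_set (R j)"
  shows "vertex_mode l (root_vec k k') m (\<lambda>j. if j < l then set_charge (R j) else 0) (\<Prod>j<l. schur j (set_diagram (R j))) =
    (\<Sum>q\<in>{q \<in> R k'. q + m \<notin> R k}. fk_scale ((-1) ^ (card {p \<in> R k. p > q + m} + card {p \<in> R k'. p > q}))
      (runner_state l (R(k := insert (q + m) (R k), k' := R k' - {q}))))"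
proof -
  let ?beta = "\<lambda>j. if j < l then set_charge (R j) else 0"
  let ?f = "\<Prod>j<l. schur j (set_diagram (R j))"
  let ?g = "\<Prod>j\<in>{..<l} - {k, k'}. schur j (set_diagram (R j))"
  let ?Q = "{q \<in> R k'. q + m \<notin> R k}"
  let ?ck = "set_charge (R k)" and ?ck' = "set_charge (R k')"
  let ?sign = "\<lambda>q. (-1) ^ (card {p \<in> R k. p > q + m} + card {p \<in> R k'. p > q})"
  \<comment> \<open>The Laurent degree left after the exponent 1 + c_k - c_k' is taken off. Written
    as (q + m - c_k) + (c_k' - 1 - q), it splits into the degrees of a creation at q + m and an
    annihilation at q.\<close>
  define n where "n = m - (1 + ?ck - ?ck')"
  define F where "F = fps_to_fls (H_series k) * annihilator_series k k' (schur k (set_diagram (R k)))"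
  define G where "G = fps_to_fls (H_inv_series k') * annihilator_series k k' (schur k' (set_diagram (R k')))"
  have nthF: "fls_nth F (p - ?ck) = (if p \<in> R k then 0
      else (-1) ^ card {q \<in> R k. q > p} * schur k (set_diagram (insert p (R k))))" for p
    unfolding F_def by (rule fls_nth_creation_schur) (use k R in auto)
  have nthG: "fls_nth G (?ck' - 1 - p) = (if p \<in> R k'
      then (-1) ^ card {q \<in> R k'. q > p} * schur k' (set_diagram (R k' - {p})) else 0)" for p
    unfolding G_def by (rule fls_nth_annihilation_schur) (use k R in auto)
  have finQ: "finite ?Q" by (rule finite_movable_particles) (use k R in auto)
  have "annihilator_series k k' ?f = annihilator_series k k' (schur k (set_diagram (R k))) *
      annihilator_series k k' (schur k' (set_diagram (R k'))) * fls_const ?g"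
  proof -
    have "annihilator_series k k' (\<Prod>j\<in>J. schur j (set_diagram (R j))) = fls_const (\<Prod>j\<in>J. schur j (set_diagram (R j)))"
      if "k \<notin> J" "k' \<notin> J" "finite J" for J
      using that(3,1,2)
      by induction (auto simp: annihilator_series_hom.hom_mult annihilator_series_schur_neutral)
    from this[of "{..<l} - {k, k'}"] show ?thesis
      unfolding prod_lessThan_two[OF k] by (simp add: annihilator_series_hom.hom_mult)
  qed
  then have FG: "fps_to_fls (H_series k * H_inv_series k') * annihilator_series k k' ?f = F * G * fls_const ?g"
    by (simp add: F_def G_def fls_times_fps_to_fls mult_ac)
  have "vertex_mode l (root_vec k k') m ?beta ?f =
      Poly_Mapping.single (\<lambda>j. root_vec k k' j + ?beta j)
        (fls_nth (fps_to_fls (H_series k * H_inv_series k') * annihilator_series k k' ?f) n)"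
  proof -
    have "lattice_form l (root_vec k k') (root_vec k k') div 2 + lattice_form l (root_vec k k') ?beta = 1 + ?ck - ?ck'"
      using k by (simp add: lattice_form_root_vec) (simp add: root_vec_def)
    then show ?thesis
      unfolding vertex_mode_def Let_def fls_nth_mult_annihilator_series
      by (simp add: creation_part_root_vec[OF k(1,2)] annihilation_part_root_vec[OF k(1,2)] n_def)
  qed
  also have "fls_nth (fps_to_fls (H_series k * H_inv_series k') * annihilator_series k k' ?f) n = fls_nth (F * G) n * ?g"
    unfolding FG by simp
  also have "fls_nth (F * G) n = (\<Sum>a\<in>(\<lambda>q. q + m - ?ck) ` ?Q. fls_nth F a * fls_nth G (n - a))"
  proof (rule fls_times_nth_support)
    fix a assume a: "a \<notin> (\<lambda>q. q + m - ?ck) ` ?Q"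
    define q where "q = a + ?ck - m"
    have "q \<notin> ?Q" using a by (auto simp: q_def image_iff)
    moreover have "a = (q + m) - ?ck" and na: "n - a = ?ck' - 1 - q"
      by (simp_all add: q_def n_def)
    then have "fls_nth F a = 0" if "q + m \<in> R k"
      using nthF[of "q + m"] that by simp
    moreover have "fls_nth G (n - a) = 0" if "q \<notin> R k'"
      unfolding na using nthG[of q] that by simp
    ultimately show "fls_nth F a * fls_nth G (n - a) = 0"
      by auto
  qed (use finQ in simp)
  also have "\<dots> = (\<Sum>q\<in>?Q. fls_nth F (q + m - ?ck) * fls_nth G (n - (q + m - ?ck)))"
    by (subst sum.reindex) (auto intro!: inj_onI)
  also have "\<dots> = (\<Sum>q\<in>?Q. ?sign q * (schur k (set_diagram (insert (q + m) (R k))) * schur k' (set_diagram (R k' - {q}))))"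
  proof (intro sum.cong refl)
    fix q assume q: "q \<in> ?Q"
    have na: "n - (q + m - ?ck) = ?ck' - 1 - q" by (simp add: n_def)
    show "fls_nth F (q + m - ?ck) * fls_nth G (n - (q + m - ?ck)) =
        ?sign q * (schur k (set_diagram (insert (q + m) (R k))) * schur k' (set_diagram (R k' - {q})))"
      unfolding na nthF nthG using q by (simp add: power_add mult_ac)
  qed
  finally have "vertex_mode l (root_vec k k') m ?beta ?f =
      (\<Sum>q\<in>?Q. Poly_Mapping.single (\<lambda>j. root_vec k k' j + ?beta j)
        (?sign q * (schur k (set_diagram (insert (q + m) (R k))) * schur k' (set_diagram (R k' - {q})) * ?g)))"
    by (simp add: sum_distrib_right mult.assoc single_sum)
  also have "\<dots> = (\<Sum>q\<in>?Q. fk_scale (?sign q) (runner_state l (R(k := insert (q + m) (R k), k' := R k' - {q}))))"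
  proof (intro sum.cong refl)
    fix q assume q: "q \<in> ?Q"
    let ?R = "R(k := insert (q + m) (R k), k' := R k' - {q})"
    have "(\<lambda>j. root_vec k k' j + ?beta j) = (\<lambda>j. if j < l then set_charge (?R j) else 0)"
      using q k R by (auto simp: root_vec_def set_charge_insert set_charge_remove)
    moreover have "(\<Prod>j\<in>{..<l} - {k, k'}. schur j (set_diagram (?R j))) = ?g"
      by (intro prod.cong) auto
    then have "(\<Prod>j<l. schur j (set_diagram (?R j))) =
        schur k (set_diagram (insert (q + m) (R k))) * schur k' (set_diagram (R k' - {q})) * ?g"
      unfolding prod_lessThan_two[OF k] using k by simp
    moreover have "fock_const (?sign q) = ?sign q"
      by (cases "even (card {p \<in> R k. p > q + m} + card {p \<in> R k'. p > q})") (simp_all add: fock_const_uminus)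
    ultimately show "Poly_Mapping.single (\<lambda>j. root_vec k k' j + ?beta j)
        (?sign q * (schur k (set_diagram (insert (q + m) (R k))) * schur k' (set_diagram (R k' - {q})) * ?g)) =
        fk_scale (?sign q) (runner_state l ?R)"
      by (simp add: runner_state_def fk_scale_single)
  qed
  finally show ?thesis .
qed

section \<open>Chevalley generators\<close>

lemma lookup_fk_scale: "Poly_Mapping.lookup (fk_scale c w) b = fock_const c * Poly_Mapping.lookup w b"
  by (simp add: fk_scale_def map.rep_eq when_def)

lemma fk_scale_add: "fk_scale c (v + w) = fk_scale c v + fk_scale c w"
  by (rule poly_mapping_eqI) (simp add: lookup_fk_scale lookup_add ring_distribs)

lemma fk_scale_0_right [simp]: "fk_scale c 0 = 0"
  by (rule poly_mapping_eqI) (simp add: lookup_fk_scale)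

lemma fk_scale_0_left [simp]: "fk_scale 0 w = 0"
  by (rule poly_mapping_eqI) (simp add: lookup_fk_scale)

lemma fk_scale_1 [simp]: "fk_scale 1 w = w"
  by (rule poly_mapping_eqI) (simp add: lookup_fk_scale)

lemma fk_scale_fk_scale: "fk_scale c (fk_scale d w) = fk_scale (c * d) w"
  by (rule poly_mapping_eqI) (simp add: lookup_fk_scale fock_const_mult[symmetric] mult.assoc)

lemma fk_scale_sum: "fk_scale c (\<Sum>x\<in>A. f x) = (\<Sum>x\<in>A. fk_scale c (f x))"
  by (induction A rule: infinite_finite_induct) (simp_all add: fk_scale_add)

lemma exp_coeff_zero: "(\<And>m. A m 0 = 0) \<Longrightarrow> exp_coeff A n 0 = 0"
proof -
  assume "\<And>m. A m 0 = 0"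
  then have "foldr A ms 0 = 0" for ms by (induction ms) simp_all
  then show ?thesis by (simp add: exp_coeff_def)
qed

lemma heis_zero: "heis i m 0 = 0"
  by (simp add: heis_def heis_factor_def fock_linear_0[OF fock_linear_fock_deriv])

lemma vertex_mode_zero: "vertex_mode l alpha m beta 0 = 0"
proof -
  have "annihilation_part l alpha r 0 = 0" for r
    unfolding annihilation_part_def by (rule exp_coeff_zero) (simp add: heis_root_def heis_zero)
  then show ?thesis by (simp add: vertex_mode_def)
qed

lemma act_h_zero: "act_h l i m beta 0 = 0"
  by (cases "m = 0") (simp_all add: act_h_def heis_zero)

lemma fk_action_homogeneous_zero: "fk_action_homogeneous l x beta 0 = 0"
  by (simp add: fk_action_homogeneous_def act_h_zero act_e_def act_f_def vertex_mode_zero)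

text \<open>\<open>fk_action\<close> sums over keys, and a single entry 0 has none; hence all
  constituents of the action had to be shown to kill 0.\<close>

lemma fk_action_single: "fk_action l x (Poly_Mapping.single beta f) = fk_action_homogeneous l x beta f"
  by (cases "f = 0") (simp_all add: fk_action_def fk_action_homogeneous_zero)

lemma loop_support_loop_elem:
  assumes "A \<noteq> 0\<^sub>m l l"
  shows "loop_support l (loop_elem l A m a) = {m}"
  using assms by (auto simp: loop_support_def loop_elem_def)

lemma unit_mat_index: "i < l \<Longrightarrow> j < l \<Longrightarrow> unit_mat l r s $$ (i, j) = (if i = r \<and> j = s then 1 else 0)"
  by (simp add: unit_mat_def)

lemma sum_lessThan_pairs_delta:
  fixes l :: nat
  assumes "r < s" "s < l"
  shows "(\<Sum>k'<l. \<Sum>k<k'. if k = r \<and> k' = s then f k k' else 0) = (f r s :: 'a :: comm_monoid_add)"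
proof -
  have "(\<Sum>k<k'. if k = r \<and> k' = s then f k k' else 0) = (if k' = s then f r s else 0)" for k'
    using assms(1) by (cases "k' = s") auto
  then show ?thesis using assms(2) by simp
qed

lemma fk_action_homogeneous_unit_mat:
  assumes rs: "r \<noteq> s" "r < l" "s < l"
  shows "fk_action_homogeneous l (loop_elem l (unit_mat l r s) m 0) beta f =
    (if r < s then act_e l (root_vec r s) m beta f else act_f l (root_vec s r) m beta f)"
proof -
  have "unit_mat l r s $$ (r, s) \<noteq> 0\<^sub>m l l $$ (r, s)"
    using rs by (simp add: unit_mat_index)
  then have supp: "loop_support l (loop_elem l (unit_mat l r s) m 0) = {m}"
    by (intro loop_support_loop_elem) auto
  have "fk_action_homogeneous l (loop_elem l (unit_mat l r s) m 0) beta f =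
      (\<Sum>i\<in>{1..<l}. fk_scale (\<Sum>k<i. unit_mat l r s $$ (k, k)) (act_h l i m beta f))
        + (\<Sum>k'<l. \<Sum>k<k'.
             fk_scale (unit_mat l r s $$ (k, k')) (act_e l (root_vec k k') m beta f)
             + fk_scale (unit_mat l r s $$ (k', k)) (act_f l (root_vec k k') m beta f))"
    unfolding fk_action_homogeneous_def supp by (simp add: loop_elem_def)
  also have "(\<Sum>i\<in>{1..<l}. fk_scale (\<Sum>k<i. unit_mat l r s $$ (k, k)) (act_h l i m beta f)) = 0"
  proof (rule sum.neutral, rule ballI)
    fix i assume "i \<in> {1..<l}"
    then have "(\<Sum>k<i. unit_mat l r s $$ (k, k)) = 0"
      using rs by (intro sum.neutral) (auto simp: unit_mat_index)
    then show "fk_scale (\<Sum>k<i. unit_mat l r s $$ (k, k)) (act_h l i m beta f) = 0" by simp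
  qed
  also have "(\<Sum>k'<l. \<Sum>k<k'. fk_scale (unit_mat l r s $$ (k, k')) (act_e l (root_vec k k') m beta f)
             + fk_scale (unit_mat l r s $$ (k', k)) (act_f l (root_vec k k') m beta f)) =
      (\<Sum>k'<l. \<Sum>k<k'. (if k = r \<and> k' = s then act_e l (root_vec k k') m beta f else 0)
        + (if k = s \<and> k' = r then act_f l (root_vec k k') m beta f else 0))"
    by (intro sum.cong refl) (auto simp: unit_mat_index)
  also have "\<dots> = (if r < s then act_e l (root_vec r s) m beta f else act_f l (root_vec s r) m beta f)"
  proof (cases "r < s")
    case True
    then have "(\<Sum>k'<l. \<Sum>k<k'. (if k = r \<and> k' = s then act_e l (root_vec k k') m beta f else 0)
        + (if k = s \<and> k' = r then act_f l (root_vec k k') m beta f else 0)) =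
        (\<Sum>k'<l. \<Sum>k<k'. if k = r \<and> k' = s then act_e l (root_vec k k') m beta f else 0)"
      by (intro sum.cong refl) auto
    with True rs show ?thesis by (simp add: sum_lessThan_pairs_delta)
  next
    case False
    then have "s < r" using rs by simp
    then have "(\<Sum>k'<l. \<Sum>k<k'. (if k = r \<and> k' = s then act_e l (root_vec k k') m beta f else 0)
        + (if k = s \<and> k' = r then act_f l (root_vec k k') m beta f else 0)) =
        (\<Sum>k'<l. \<Sum>k<k'. if k = s \<and> k' = r then act_f l (root_vec k k') m beta f else 0)"
      by (intro sum.cong refl) auto
    with False \<open>s < r\<close> rs show ?thesis by (simp add: sum_lessThan_pairs_delta)
  qed
  finally show ?thesis by simp
qed

lemma uminus_root_vec: "(\<lambda>k. - root_vec r s k) = root_vec s r"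
  by (auto simp: root_vec_def)

text \<open>One formula covers both kinds of root vectors: for r > s, \<open>act_f\<close> uses the
  negated root, which is again \<open>root_vec r s\<close>, and an extra minus sign. The mode - m
  turns q + m into q - m.\<close>

lemma fk_action_unit_mat:
  fixes R :: "nat \<Rightarrow> int set"
  assumes rs: "r \<noteq> s" "r < l" "s < l" and R: "\<And>j. j < l \<Longrightarrow> maya_set (R j)"
  shows "fk_action l (loop_elem l (unit_mat l r s) m 0) (runner_state l R) =
    fk_scale ((if r < s then 1 else -1) * cocycle l (root_vec r s) (\<lambda>j. if j < l then set_charge (R j) else 0))
      (\<Sum>q\<in>{q \<in> R s. q - m \<notin> R r}. fk_scale ((-1) ^ (card {p \<in> R r. p > q - m} + card {p \<in> R s. p > q}))
        (runner_state l (R(r := insert (q - m) (R r), s := R s - {q}))))"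
  using vertex_mode_root_vec[OF rs(2,3,1) R, where m = "- m"]
  by (simp add: runner_state_def[of l R] fk_action_single fk_action_homogeneous_unit_mat[OF rs]
      act_e_def act_f_def uminus_root_vec)

lemma act_h_zero_mode:
  assumes "1 \<le> i" "i < l"
  shows "act_h l i 0 beta f = Poly_Mapping.single beta (of_int (beta (i - 1) - beta i) * f)"
  using assms by (simp add: act_h_def lattice_form_root_vec)

text \<open>The coefficients of the h_i are partial sums of the diagonal, and against the
  differences of \<open>beta\<close> they telescope to \<open>beta r - beta s\<close>.\<close>

lemma fk_action_homogeneous_diag:
  assumes rs: "r \<noteq> s" "r < l" "s < l"
  shows "fk_action_homogeneous l (loop_elem l (unit_mat l r r - unit_mat l s s) 0 a) beta f =
    fk_scale (of_int (beta r - beta s) + a) (Poly_Mapping.single beta f)"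
proof -
  let ?D = "unit_mat l r r - unit_mat l s s"
  have D: "?D $$ (i, j) = (if i = r \<and> j = r then 1 else 0) - (if i = s \<and> j = s then 1 else 0)"
    if "i < l" "j < l" for i j
    using that by (simp add: unit_mat_def)
  have "?D $$ (r, r) \<noteq> 0\<^sub>m l l $$ (r, r)"
    using rs by (simp add: D)
  then have supp: "loop_support l (loop_elem l ?D 0 a) = {0}"
    by (intro loop_support_loop_elem) auto
  have offdiag: "(\<Sum>k'<l. \<Sum>k<k'. fk_scale (?D $$ (k, k')) (act_e l (root_vec k k') 0 beta f)
             + fk_scale (?D $$ (k', k)) (act_f l (root_vec k k') 0 beta f)) = 0"
  proof (intro sum.neutral ballI)
    fix k' k assume "k' \<in> {..<l}" "k \<in> {..<k'}"
    then have "?D $$ (k, k') = 0" "?D $$ (k', k) = 0" by (subst D; auto)+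
    then show "fk_scale (?D $$ (k, k')) (act_e l (root_vec k k') 0 beta f)
             + fk_scale (?D $$ (k', k)) (act_f l (root_vec k k') 0 beta f) = 0" by simp
  qed
  have "fk_scale (\<Sum>k<i. ?D $$ (k, k)) (act_h l i 0 beta f) =
      Poly_Mapping.single beta (fock_const ((of_bool (r < i) - of_bool (s < i)) * (of_int (beta (i - 1)) - of_int (beta i))) * f)"
    if "i \<in> {1..<l}" for i
  proof -
    have "(\<Sum>k<i. ?D $$ (k, k)) = (\<Sum>k<i. (if k = r then 1 else 0) - (if k = s then 1 else 0))"
      using that by (intro sum.cong) (auto simp: D)
    also have "\<dots> = of_bool (r < i) - of_bool (s < i)"
      by (simp add: sum_subtractf)
    finally show ?thesis
      using that by (simp add: act_h_zero_mode fk_scale_single fock_const_mult[symmetric] mult.assoc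
          fock_const_of_int[symmetric])
  qed
  then have "(\<Sum>i\<in>{1..<l}. fk_scale (\<Sum>k<i. ?D $$ (k, k)) (act_h l i 0 beta f)) =
      (\<Sum>i\<in>{1..<l}. Poly_Mapping.single beta (fock_const ((of_bool (r < i) - of_bool (s < i)) * (of_int (beta (i - 1)) - of_int (beta i))) * f))"
    by (intro sum.cong refl)
  also have "\<dots> = Poly_Mapping.single beta (fock_const (\<Sum>i\<in>{1..<l}. (of_bool (r < i) - of_bool (s < i)) * (of_int (beta (i - 1)) - of_int (beta i))) * f)"
  proof -
    have "fock_const (\<Sum>i\<in>J. c i) = (\<Sum>i\<in>J. fock_const (c i))" for J :: "nat set" and c
      by (induction J rule: infinite_finite_induct) (simp_all add: fock_const_add)
    then show ?thesis by (simp only: single_sum sum_distrib_right)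
  qed
  also have "(\<Sum>i\<in>{1..<l}. (of_bool (r < i) - of_bool (s < i)) * (of_int (beta (i - 1)) - of_int (beta i)) :: complex) =
      of_int (beta r) - of_int (beta (l - 1)) - (of_int (beta s) - of_int (beta (l - 1)))"
    unfolding left_diff_distrib sum_subtractf
    by (intro arg_cong2[of _ _ _ _ minus] sum_telescope_of_bool rs)
  finally have diag: "(\<Sum>i\<in>{1..<l}. fk_scale (\<Sum>k<i. ?D $$ (k, k)) (act_h l i 0 beta f)) =
      Poly_Mapping.single beta (fock_const (of_int (beta r - beta s)) * f)"
    by simp
  have "fk_action_homogeneous l (loop_elem l ?D 0 a) beta f =
      (\<Sum>i\<in>{1..<l}. fk_scale (\<Sum>k<i. ?D $$ (k, k)) (act_h l i 0 beta f))
      + (\<Sum>k'<l. \<Sum>k<k'. fk_scale (?D $$ (k, k')) (act_e l (root_vec k k') 0 beta f)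
             + fk_scale (?D $$ (k', k)) (act_f l (root_vec k k') 0 beta f))
      + fk_scale a (Poly_Mapping.single beta f)"
    unfolding fk_action_homogeneous_def supp by (simp add: loop_elem_def)
  then show ?thesis
    unfolding offdiag diag
    by (simp add: fk_scale_single fock_const_add ring_distribs single_add)
qed

section \<open>Cyclic neighbours of a runner\<close>

definition pred_index :: "nat \<Rightarrow> nat \<Rightarrow> nat" where
  "pred_index l i = (if i = 0 then l - 1 else i - 1)"

text \<open>This number is also the power of t in \<open>e_hat\<close> and the central coefficient
  of \<open>h_hat\<close>, which makes i = 0 fit the general pattern.\<close>

definition wrap :: "nat \<Rightarrow> int" where
  "wrap i = (if i = 0 then 1 else 0)"

text \<open>
  A node of content \<open>l q + i\<close> corresponds to position \<open>q\<close> on runner \<open>i\<close> and to position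
  \<open>q - wrap i\<close> on the preceding runner.
\<close>

context
  fixes l i :: nat and lam :: diagram
  assumes l: "3 \<le> l" and i: "i < l" and lam: "lam \<in> young_diagrams"
begin

lemma pred_index: "pred_index l i < l" "pred_index l i \<noteq> i"
  using l i by (auto simp: pred_index_def)

lemma pred_position: "int l * (q - wrap i) + int (pred_index l i) = int l * q + int i - 1"
  using l i by (auto simp: pred_index_def wrap_def of_nat_diff algebra_simps)

lemma runner_pred: "runner l lam (int i - 1) = {q. q - wrap i \<in> runner l lam (int (pred_index l i))}"
  unfolding runner_def by (simp add: pred_position add_diff_eq)

lemma card_greater_runner_pred:
  "card {p \<in> runner l lam (int i - 1). p > q} = card {p \<in> runner l lam (int (pred_index l i)). p > q - wrap i}"
  by (rule bij_betw_same_card[of "\<lambda>p. p - wrap i"], rule bij_betwI[where g = "\<lambda>p. p + wrap i"])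
    (auto simp: runner_pred)

lemma set_charge_runner_pred:
  "set_charge (runner l lam (int i - 1)) = set_charge (runner l lam (int (pred_index l i))) + wrap i"
proof (cases "i = 0")
  case True
  have "maya_set (runner l lam (int (pred_index l i)))"
    using l by (intro maya_set_runner lam) auto
  from set_charge_shift[OF this] show ?thesis
    unfolding runner_pred by (simp add: True wrap_def)
qed (use runner_pred in \<open>simp add: wrap_def\<close>)

abbreviation (input) "vcount j \<equiv> int (residue_count l j lam)"

text \<open>Each charge is a first difference of residue counts, so their difference is a second
  one; \<open>wrap i\<close> stems from the shift of the preceding runner at i = 0.\<close>

lemma set_charge_runner_diff:
  "set_charge (runner l lam (int i - 1)) - set_charge (runner l lam (int i)) =
    vcount (int i - 1) - 2 * vcount (int i) + vcount (int i + 1) + wrap i"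
proof -
  have "vcount (int (pred_index l i)) = vcount (int i - 1)" "vcount (int (pred_index l i) + 1) = vcount (int i)"
    using residue_count_periodic[of l "int i - 1" lam] residue_count_periodic[of l "int i" lam] l i
    by (auto simp: pred_index_def of_nat_diff)
  then show ?thesis
    using residue_count_diff[OF lam pred_index(1)] residue_count_diff[OF lam i]
    by (simp add: set_charge_runner_pred)
qed

text \<open>For i = 0 the matrix unit of \<open>e_hat\<close> is lower triangular and brings the
  minus sign of \<open>act_f\<close>, recorded by \<open>wrap i\<close>. For \<open>f_hat\<close>
  the two cases are exchanged, hence the additional 1.\<close>

lemma cocycle_core_charges:
  "(if pred_index l i < i then 1 else -1) * cocycle l (root_vec (pred_index l i) i) (core_charges l lam) =
    (-1) powi (vcount (int i) + vcount (int i + 1) + wrap i)"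
  "(if i < pred_index l i then 1 else -1) * cocycle l (root_vec i (pred_index l i)) (core_charges l lam) =
    (-1) powi (vcount (int i) + vcount (int i + 1) + wrap i + 1)"
proof -
  have *: "cocycle l (root_vec (pred_index l i) i) (core_charges l lam) = (-1) powi (vcount (int i) + vcount (int i + 1))
      \<and> cocycle l (root_vec i (pred_index l i)) (core_charges l lam) = (-1) powi (vcount (int i) + vcount (int i + 1))"
  proof (cases "i = 0")
    case True
    have "cocycle l (root_vec 0 (l - 1)) (core_charges l lam) = (-1) powi (vcount 1 + vcount (int (l - 1) + 1))"
      by (rule cocycle_highest_root_core_charges[OF lam]) (use l in auto)
    also have "int (l - 1) + 1 = 0 + int l" using l by simp
    finally have "cocycle l (root_vec 0 (l - 1)) (core_charges l lam) = (-1) powi (vcount 0 + vcount 1)"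
      by (simp only: residue_count_periodic add.commute)
    with cocycle_uminus_left[OF this] True show ?thesis
      by (simp add: pred_index_def uminus_root_vec)
  next
    case False
    have "cocycle l (root_vec (i - 1) i) (core_charges l lam) = (-1) powi (vcount (int i) + vcount (int i + 1))"
      by (rule cocycle_simple_root_core_charges[OF lam]) (use False i in auto)
    with cocycle_uminus_left[OF this] False show ?thesis
      by (simp add: pred_index_def uminus_root_vec)
  qed
  have "pred_index l i < i \<longleftrightarrow> i \<noteq> 0" "i < pred_index l i \<longleftrightarrow> i = 0"
    using l i by (auto simp: pred_index_def)
  with * show "(if pred_index l i < i then 1 else -1) * cocycle l (root_vec (pred_index l i) i) (core_charges l lam) =
      (-1) powi (vcount (int i) + vcount (int i + 1) + wrap i)"
    "(if i < pred_index l i then 1 else -1) * cocycle l (root_vec i (pred_index l i)) (core_charges l lam) =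
      (-1) powi (vcount (int i) + vcount (int i + 1) + wrap i + 1)"
    by (simp_all add: wrap_def power_int_add)
qed

lemma maya_set_runners: "maya_set (runner l lam j)"
  using l by (intro maya_set_runner lam) auto

lemma node_position:
  assumes "is_node_of_residue l (int i) x"
  shows "node_content x = int l * ((node_content x - int i) div int l) + int i"
  using assms l residue_iff[of l lam "int i" x] lam by auto

lemma basis_vec_remove:
  assumes "x \<in> removable l (int i) lam"
  defines "q \<equiv> (node_content x - int i) div int l"
  shows "basis_vec l (lam - {x}) = runner_state l ((\<lambda>j. runner l lam (int j))
    (pred_index l i := insert (q - wrap i) (runner l lam (int (pred_index l i))), i := runner l lam (int i) - {q}))"
proof -
  have x: "x \<in> lam" "lam - {x} \<in> young_diagrams" "is_node_of_residue l (int i) x"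
    using assms(1) by (simp_all add: removable_def)
  have c: "node_content x = int l * q + int i" "node_content x - 1 = int l * (q - wrap i) + int (pred_index l i)"
    using node_position[OF x(3)] by (simp_all only: pred_position q_def)
  show ?thesis
    unfolding basis_vec_eq[OF x(2)]
  proof (rule runner_state_cong)
    fix j assume "j < l"
    with particles_remove(3)[OF lam x(2,1)] show "runner l (lam - {x}) (int j) = ((\<lambda>j. runner l lam (int j))
        (pred_index l i := insert (q - wrap i) (runner l lam (int (pred_index l i))), i := runner l lam (int i) - {q})) j"
      unfolding c(2) unfolding c(1) by (intro runner_move pred_index i)
  qed
qed

lemma basis_vec_insert:
  assumes "x \<in> addable l (int i) lam"
  defines "q \<equiv> (node_content x - int i) div int l"
  shows "basis_vec l (insert x lam) = runner_state l ((\<lambda>j. runner l lam (int j))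
    (i := insert q (runner l lam (int i)), pred_index l i := runner l lam (int (pred_index l i)) - {q - wrap i}))"
proof -
  have x: "x \<notin> lam" "insert x lam \<in> young_diagrams" "is_node_of_residue l (int i) x"
    using assms(1) by (simp_all add: addable_def)
  have c: "node_content x = int l * q + int i" "node_content x - 1 = int l * (q - wrap i) + int (pred_index l i)"
    using node_position[OF x(3)] by (simp_all only: pred_position q_def)
  show ?thesis
    unfolding basis_vec_eq[OF x(2)]
  proof (rule runner_state_cong)
    fix j assume "j < l"
    with particles_insert(3)[OF lam x(2,1)] show "runner l (insert x lam) (int j) = ((\<lambda>j. runner l lam (int j))
        (i := insert q (runner l lam (int i)), pred_index l i := runner l lam (int (pred_index l i)) - {q - wrap i})) j"
      unfolding c(2) unfolding c(1) by (intro runner_move pred_index(1) pred_index(2)[symmetric] i)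
  qed
qed

lemma e_hat_eq: "e_hat l i = loop_elem l (unit_mat l (pred_index l i) i) (wrap i) 0"
  by (simp add: e_hat_def pred_index_def wrap_def)

lemma f_hat_eq: "f_hat l i = loop_elem l (unit_mat l i (pred_index l i)) (- wrap i) 0"
  by (simp add: f_hat_def pred_index_def wrap_def)

lemma h_hat_eq: "h_hat l i =
    loop_elem l (unit_mat l (pred_index l i) (pred_index l i) - unit_mat l i i) 0 (of_int (wrap i))"
  by (simp add: h_hat_def pred_index_def wrap_def)

text \<open>Modulo 2 the cocycle gives v_i + v_{i+1}, the particle counts give v_{i-1} + v_{i+1} + 1
  + \<open>eta_minus\<close>, and two terms \<open>wrap i\<close> cancel. This leaves v_{i-1} + v_i
  + 1; the informal prefactor v_i + v_{i+1} would belong, up to \<open>wrap i\<close>, to nodes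
  counted on the right of x.\<close>

lemma fk_action_e_hat: "fk_action l (e_hat l i) (basis_vec l lam) =
  fk_scale ((-1) ^ (residue_count l (int i - 1) lam + residue_count l (int i) lam + 1))
    (\<Sum>x\<in>removable l (int i) lam.
       fk_scale ((-1) powi eta_minus l (int i) lam x) (basis_vec l (lam - {x})))"
proof -
  let ?R = "\<lambda>j. runner l lam (int j)" and ?k = "pred_index l i"
  let ?A = "runner l lam (int i - 1)" and ?B = "runner l lam (int i)"
  let ?q = "\<lambda>x. (node_content x - int i) div int l"
  let ?s = "\<lambda>q. card {p \<in> ?R ?k. p > q - wrap i} + card {p \<in> ?B. p > q}"
  let ?S = "\<lambda>q. runner_state l (?R(?k := insert (q - wrap i) (?R ?k), i := ?B - {q}))"
  have "fk_action l (e_hat l i) (basis_vec l lam) =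
      fk_scale ((-1) powi (vcount (int i) + vcount (int i + 1) + wrap i))
        (\<Sum>q\<in>{q \<in> ?B. q - wrap i \<notin> ?R ?k}. fk_scale ((-1) ^ ?s q) (?S q))"
    unfolding e_hat_eq basis_vec_eq[OF lam] cocycle_core_charges(1)[symmetric] core_charges_eq[OF lam]
    by (rule fk_action_unit_mat[OF pred_index(2,1) i]) (rule maya_set_runners)
  also have "{q \<in> ?B. q - wrap i \<notin> ?R ?k} = ?B - ?A"
    by (auto simp: runner_pred)
  also have "(\<Sum>q\<in>?B - ?A. fk_scale ((-1) ^ ?s q) (?S q)) =
      (\<Sum>x\<in>removable l (int i) lam. fk_scale ((-1) ^ ?s (?q x)) (?S (?q x)))"
    by (rule sum.reindex_bij_betw[OF bij_betw_removable, symmetric]) (use l lam in auto)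
  finally have "fk_action l (e_hat l i) (basis_vec l lam) =
      (\<Sum>x\<in>removable l (int i) lam. fk_scale ((-1) powi (vcount (int i) + vcount (int i + 1) + wrap i) * (-1) ^ ?s (?q x))
        (basis_vec l (lam - {x})))"
    by (simp add: fk_scale_sum fk_scale_fk_scale basis_vec_remove)
  also have "\<dots> = (\<Sum>x\<in>removable l (int i) lam.
      fk_scale ((-1) ^ (residue_count l (int i - 1) lam + residue_count l (int i) lam + 1) * (-1) powi eta_minus l (int i) lam x)
        (basis_vec l (lam - {x})))"
  proof (intro sum.cong refl arg_cong2[of _ _ _ _ fk_scale])
    fix x assume x: "x \<in> removable l (int i) lam"
    let ?p = "?q x"
    have "?p \<in> ?B - ?A"
      using bij_betwE[OF bij_betw_removable[of l lam "int i"]] x l lam by auto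
    moreover have "eta_minus l (int i) lam x = int (card {q \<in> ?A - ?B. q < ?p}) - int (card {q \<in> ?B - ?A. q < ?p})"
      using l x by (intro eta_minus_eq node_position) (auto simp: lam removable_def)
    \<comment> \<open>The + 1 comes from the moving particle, which is on runner i, not on runner i
      - 1, and belongs to neither side.\<close>
    ultimately have "int (card {p \<in> ?A. p > ?p}) - int (card {p \<in> ?B. p > ?p}) =
        vcount (int i - 1) - 2 * vcount (int i) + vcount (int i + 1) + wrap i - eta_minus l (int i) lam x + 1"
      using card_greater_diff[OF maya_set_runners maya_set_runners, of "int i - 1" ?p "int i"] set_charge_runner_diff
      by simp
    then have "even (vcount (int i) + vcount (int i + 1) + wrap i + int (?s ?p)
        - (vcount (int i - 1) + vcount (int i) + 1 + eta_minus l (int i) lam x))"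
      unfolding card_greater_runner_pred by presburger
    then have "(-1 :: complex) powi (vcount (int i) + vcount (int i + 1) + wrap i + int (?s ?p)) =
        (-1) powi (vcount (int i - 1) + vcount (int i) + 1 + eta_minus l (int i) lam x)"
      by (rule power_int_minus_one_cong)
    then show "(-1 :: complex) powi (vcount (int i) + vcount (int i + 1) + wrap i) * (-1) ^ ?s ?p =
        (-1) ^ (residue_count l (int i - 1) lam + residue_count l (int i) lam + 1) * (-1) powi eta_minus l (int i) lam x"
      by (simp add: power_int_add power_add)
  qed
  finally show ?thesis
    by (simp only: fk_scale_sum fk_scale_fk_scale)
qed

text \<open>The moving particle now contributes - 1 and the cocycle one sign more than for
  \<open>e_hat\<close>; the two cancel modulo 2, so the prefactor has no extra 1.\<close>

lemma fk_action_f_hat: "fk_action l (f_hat l i) (basis_vec l lam) =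
  fk_scale ((-1) ^ (residue_count l (int i - 1) lam + residue_count l (int i) lam))
    (\<Sum>x\<in>addable l (int i) lam.
       fk_scale ((-1) powi eta_minus l (int i) lam x) (basis_vec l (insert x lam)))"
proof -
  let ?R = "\<lambda>j. runner l lam (int j)" and ?k = "pred_index l i"
  let ?A = "runner l lam (int i - 1)" and ?B = "runner l lam (int i)"
  let ?q = "\<lambda>x. (node_content x - int i) div int l"
  let ?s = "\<lambda>q. card {p \<in> ?B. p > q} + card {p \<in> ?R ?k. p > q - wrap i}"
  let ?S = "\<lambda>q. runner_state l (?R(i := insert q ?B, ?k := ?R ?k - {q - wrap i}))"
  have "fk_action l (f_hat l i) (basis_vec l lam) =
      fk_scale ((-1) powi (vcount (int i) + vcount (int i + 1) + wrap i + 1))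
        (\<Sum>q\<in>{q \<in> ?R ?k. q - (- wrap i) \<notin> ?B}.
          fk_scale ((-1) ^ (card {p \<in> ?B. p > q - (- wrap i)} + card {p \<in> ?R ?k. p > q}))
            (runner_state l (?R(i := insert (q - (- wrap i)) ?B, ?k := ?R ?k - {q}))))"
    unfolding f_hat_eq basis_vec_eq[OF lam] cocycle_core_charges(2)[symmetric] core_charges_eq[OF lam]
    by (rule fk_action_unit_mat[OF pred_index(2)[symmetric] i pred_index(1)]) (rule maya_set_runners)
  \<comment> \<open>The sum is reindexed by the target position on runner i in place of the source
    position on the preceding runner.\<close>
  also have "(\<Sum>q\<in>{q \<in> ?R ?k. q - (- wrap i) \<notin> ?B}.
          fk_scale ((-1) ^ (card {p \<in> ?B. p > q - (- wrap i)} + card {p \<in> ?R ?k. p > q}))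
            (runner_state l (?R(i := insert (q - (- wrap i)) ?B, ?k := ?R ?k - {q})))) =
      (\<Sum>q\<in>?A - ?B. fk_scale ((-1) ^ ?s q) (?S q))"
    by (rule sum.reindex_bij_witness[where i = "\<lambda>q. q - wrap i" and j = "\<lambda>q. q + wrap i"])
      (auto simp: runner_pred)
  also have "\<dots> = (\<Sum>x\<in>addable l (int i) lam. fk_scale ((-1) ^ ?s (?q x)) (?S (?q x)))"
    by (rule sum.reindex_bij_betw[OF bij_betw_addable, symmetric]) (use l lam in auto)
  finally have "fk_action l (f_hat l i) (basis_vec l lam) =
      (\<Sum>x\<in>addable l (int i) lam. fk_scale ((-1) powi (vcount (int i) + vcount (int i + 1) + wrap i + 1) * (-1) ^ ?s (?q x))
        (basis_vec l (insert x lam)))"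
    by (simp add: fk_scale_sum fk_scale_fk_scale basis_vec_insert)
  also have "\<dots> = (\<Sum>x\<in>addable l (int i) lam.
      fk_scale ((-1) ^ (residue_count l (int i - 1) lam + residue_count l (int i) lam) * (-1) powi eta_minus l (int i) lam x)
        (basis_vec l (insert x lam)))"
  proof (intro sum.cong refl arg_cong2[of _ _ _ _ fk_scale])
    fix x assume x: "x \<in> addable l (int i) lam"
    let ?p = "?q x"
    have "?p \<in> ?A - ?B"
      using bij_betwE[OF bij_betw_addable[of l lam "int i"]] x l lam by auto
    moreover have "eta_minus l (int i) lam x = int (card {q \<in> ?A - ?B. q < ?p}) - int (card {q \<in> ?B - ?A. q < ?p})"
      using l x by (intro eta_minus_eq node_position) (auto simp: lam addable_def)
    ultimately have "int (card {p \<in> ?A. p > ?p}) - int (card {p \<in> ?B. p > ?p}) =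
        vcount (int i - 1) - 2 * vcount (int i) + vcount (int i + 1) + wrap i - eta_minus l (int i) lam x - 1"
      using card_greater_diff[OF maya_set_runners maya_set_runners, of "int i - 1" ?p "int i"] set_charge_runner_diff
      by simp
    then have "even (vcount (int i) + vcount (int i + 1) + wrap i + 1 + int (?s ?p)
        - (vcount (int i - 1) + vcount (int i) + eta_minus l (int i) lam x))"
      unfolding card_greater_runner_pred by presburger
    then have "(-1 :: complex) powi (vcount (int i) + vcount (int i + 1) + wrap i + 1 + int (?s ?p)) =
        (-1) powi (vcount (int i - 1) + vcount (int i) + eta_minus l (int i) lam x)"
      by (rule power_int_minus_one_cong)
    then show "(-1 :: complex) powi (vcount (int i) + vcount (int i + 1) + wrap i + 1) * (-1) ^ ?s ?p =
        (-1) ^ (residue_count l (int i - 1) lam + residue_count l (int i) lam) * (-1) powi eta_minus l (int i) lam x"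
      by (simp add: power_int_add power_add)
  qed
  finally show ?thesis
    by (simp only: fk_scale_sum fk_scale_fk_scale)
qed

text \<open>The Cartan part acts by the difference of the two charges, and for i = 0 the central
  element supplies the missing \<open>wrap i\<close>.\<close>

lemma fk_action_h_hat: "fk_action l (h_hat l i) (basis_vec l lam) =
  fk_scale (of_nat (card (addable l (int i) lam)) - of_nat (card (removable l (int i) lam))) (basis_vec l lam)"
proof -
  let ?A = "runner l lam (int i - 1)" and ?B = "runner l lam (int i)"
  have "card (addable l (int i) lam) = card (?A - ?B)" "card (removable l (int i) lam) = card (?B - ?A)"
    using bij_betw_same_card[OF bij_betw_addable] bij_betw_same_card[OF bij_betw_removable] l lam by simp_all
  then have "int (card (addable l (int i) lam)) - int (card (removable l (int i) lam)) =
      core_charges l lam (pred_index l i) - core_charges l lam i + wrap i"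
    using set_charge_diff(2)[OF maya_set_runners maya_set_runners, of "int i - 1" "int i"]
    by (simp add: core_charges_eq[OF lam] set_charge_runner_pred pred_index i)
  then have "of_nat (card (addable l (int i) lam)) - of_nat (card (removable l (int i) lam)) =
      of_int (core_charges l lam (pred_index l i) - core_charges l lam i) + (of_int (wrap i) :: complex)"
    by (metis of_int_add of_int_diff of_int_of_nat_eq)
  then show ?thesis
    unfolding h_hat_eq basis_vec_def fk_action_single
    by (simp only: fk_action_homogeneous_diag[OF pred_index(2,1) i])
qed

end

theorem theorem3p3p2:
  fixes l i :: nat and lam :: diagram
  assumes "3 \<le> l" and "i < l" and "lam \<in> young_diagrams"
  shows "(fk_action l (e_hat l i) (basis_vec l lam) =
           fk_scale ((-1) ^ (residue_count l (int i - 1) lam + residue_count l (int i) lam + 1))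
             (\<Sum>x\<in>removable l (int i) lam.
                fk_scale ((-1) powi eta_minus l (int i) lam x) (basis_vec l (lam - {x}))))
    \<and> (fk_action l (f_hat l i) (basis_vec l lam) =
           fk_scale ((-1) ^ (residue_count l (int i - 1) lam + residue_count l (int i) lam))
             (\<Sum>x\<in>addable l (int i) lam.
                fk_scale ((-1) powi eta_minus l (int i) lam x) (basis_vec l (insert x lam))))
    \<and> (fk_action l (h_hat l i) (basis_vec l lam) =
           fk_scale (of_nat (card (addable l (int i) lam)) - of_nat (card (removable l (int i) lam)))
             (basis_vec l lam))"
  by (intro conjI fk_action_e_hat fk_action_f_hat fk_action_h_hat assms)

end
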